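(* Let $E$ be a Borel state space and $K$ a two-point transition kernel on $E$. Suppose there exist a measurable subset $C\subset E$, a probability measure $\phi$ on $E$ and constants $0<\rho_1<1$, $0<\rho_2<1$ with $\rho_1^2\rho_2>2/3$ such that $$K(C\mid y_1,y_2)\ge\rho_1\quad\forall (y_1,y_2)\in E^2,$$ $$K(A\mid y_1,y_2)\ge\rho_2\,\phi(A)\quad\forall (y_1,y_2)\in C^2\text{ and every measurable }A\subset E.$$ Then: 1. $K$ is uniformly ergodic. 2. For any finite region $\Lambda\subset\mathbb Z^2$ such that every $(i,j)\in\partial_I\Lambda$ has $i+j$ even, the law of the stationary version $\mathbf X'_\Lambda$ (the restriction to $\Lambda$ of the equilibrium field of $K$) is the same as the law of $\Upsilon^{D(\Lambda)}(\mathbf U_{D(\Lambda)})$. 3. $\mathbb E|D(\Lambda)|=|\Lambda|+O(|\partial_I\Lambda|)$, i.e. there is a constant $c<\infty$ not depending on $\Lambda$ such that $|\Lambda|\le\mathbb E|D(\Lambda)|\le|\Lambda|+c|\partial_I\Lambda|$ for all such $\Lambda$.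
   Context: **Kernels and fields.** A Borel state space $E$ is a Borel subset of a Polish space with its Borel $\sigma$-algebra. A two-point transition kernel is a map $K:E^2\to\mathcal P(E)$ such that $(x,y)\mapsto K(B\mid x,y)=K(x,y)(B)$ is measurable for every measurable $B\subset E$. Let $\mathbb N^+=\{1,2,\dots\}$, $\Lambda_{m,n}=\{1,\dots,m\}\times\{1,\dots,n\}$. For boundary conditions $\mathbf x=\{x_{i,0},x_{0,i}:i\in\mathbb N^+\}$ in $E$, the unilateral field $\mathbf X^{\mathbf x}$ on $(\mathbb N^+)^2$ has $P(\mathbf X^{\mathbf x}_{\Lambda_{m,n}}\in B)=\int_B\prod_{i=1}^m\prod_{j=1}^nK(dx_{i,j}\mid x_{i-1,j},x_{i,j-1})$. **Uniform ergodicity.** $K$ is uniformly ergodic if there is a stationary (translation invariant) $E$-valued field $\mathbf X'=\{X'_{i,j}\}_{i,j\ge0}$ such that for all $m,n$, $\|\mathcal L(\mathbf X^{\mathbf x}_{(h,l)+\Lambda_{m,n}})-\mathcal L(\mathbf X'_{\Lambda_{m,n}})\|\to0$ in total variation as $h\to\infty$ and $l\to\infty$, uniformly in $\mathbf x$. $\mathbf X'$, extended to a stationary field on $\mathbb Z^2$, is the equilibrium field (stationary version) of $K$; it is unique in law. **Boundaries.** The parents of $(i,j)\in\mathbb Z^2$ are $(i-1,j)$ and $(i,j-1)$. For $S\subset\mathbb Z^2$, $\overrightarrow{\partial}S$ is the set of parents of elements of $S$ not in $S$; $\partial_IS$ is the set of vertices of $S$ with at least one parent in $\overrightarrow{\partial}S$.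 **Coupling functions.** Let $f_0:(0,1)\to E$ and $f_1,\dots,f_4:(0,1)\times E^2\to E$ be measurable functions such that, for $U_1$ uniform on $(0,1)$ and all $y_1,y_2\in E$: - $f_0(U_1)\sim\phi$; - $f_1(U_1;y_1,y_2)\sim\frac{1}{1-\rho_2}[K(\cdot\mid y_1,y_2)-\rho_2\phi(\cdot)]$ if $y_1,y_2\in C$, and $\sim K(\cdot\mid y_1,y_2)$ otherwise; - $f_2(U_1;y_1,y_2)\sim K(\cdot\mid y_1,y_2)$; - $f_3(U_1;y_1,y_2)\sim\frac{K(\cdot\cap C\mid y_1,y_2)}{K(C\mid y_1,y_2)}$, with $f_3$ taking values in $C$; - $f_4(U_1;y_1,y_2)\sim\frac1{1-\rho_1}\left\{K(\cdot\mid y_1,y_2)-\rho_1\frac{K(\cdot\cap C\mid y_1,y_2)}{K(C\mid y_1,y_2)}\right\}$. For $u=(u_1,u_2)\in(0,1)^2$ define: $s_0(u;y_1,y_2)=f_0(u_1)$ if $y_1,y_2\in C$ and $u_2\in(0,\rho_2)$; $s_0(u;y_1,y_2)=f_1(u_1;y_1,y_2)$ if $y_1,y_2\in C$ and $u_2\notin(0,\rho_2)$; $s_0(u;y_1,y_2)=f_2(u_1;y_1,y_2)$ if $(y_1,y_2)\notin C^2$. Define $s_1(u;y_1,y_2)=f_3(u_1;y_1,y_2)$ if $u_2\in(0,\rho_1)$ and $f_4(u_1;y_1,y_2)$ otherwise. Let $\mathbf U=\{U_{i,j}=((U_1)_{i,j},(U_2)_{i,j})\}_{(i,j)\in\mathbb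 Z^2}$ be i.i.d. uniform on $(0,1)^2$. **The binary field and random region.** Let $\mathcal V=\{(h,k)\in\mathbb Z^2:h+k\text{ even}\}$. For $(h,k)\in\mathcal V$, $$W_{h,k}=1-1_{(0,\rho_1)}((U_2)_{h-1,k})\,1_{(0,\rho_1)}((U_2)_{h,k-1})\,1_{(0,\rho_2)}((U_2)_{h,k}).$$ The $\mathcal V$-parents of $(h,k)\in\mathcal V$ are $(h-2,k),(h-1,k-1),(h,k-2)$. A path of length $m>0$ is a sequence $v_0,\dots,v_m\in\mathcal V$ with $v_k$ a $\mathcal V$-parent of $v_{k+1}$; it is open if $W_{v_k}=1$ for $k=1,\dots,m$ (no requirement on $v_0$). For finite $\Lambda$ with $\partial_I\Lambda\subset\mathcal V$, $\sigma(\Lambda)$ is the set of $v\in\mathcal V$ from which there is an open path to some element of $\partial_I\Lambda$, and $D(\Lambda)=\Lambda\cup\sigma(\Lambda)$. **The function $\Upsilon$.** When $\sigma(\Lambda)$ is finite, define recursively $Y_{h,k}\in E$ for $(h,k)\in\partial_I\Lambda\cup\sigma(\Lambda)$: $Y_{h,k}=f_0((U_1)_{h,k})$ if $W_{h,k}=0$, and if $W_{h,k}=1$ (in which case all $\mathcal V$-parents of $(h,k)$ are in $\sigma(\Lambda)$) $$Y_{h,k}=s_0\bigl(U_{h,k};\,s_1(U_{h-1,k};Y_{h-2,k},Y_{h-1,k-1}),\,s_1(U_{h,k-1};Y_{h-1,k-1},Y_{h,k-2})\bigr).$$ Then $\Upsilon^{D(\Lambda)}(\mathbf U_{D(\Lambda)})\in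 E^\Lambda$ is the configuration equal to $Y$ on $\partial_I\Lambda$ and extended to $\Lambda\setminus\partial_I\Lambda$ by the recursion $X_{i,j}=s_{m(i,j)}(U_{i,j};X_{i-1,j},X_{i,j-1})$, where $m(i,j)=0$ if $i+j$ is even and $1$ if $i+j$ is odd. (It depends on $U$ at the sites of $\Lambda$, at the sites $(h,k)\in\partial_I\Lambda\cup\sigma(\Lambda)$ and at their parents $(h-1,k),(h,k-1)$.) *)

theory Defs
  imports "HOL-Probability.Probability"
begin

type_synonym site = "int \<times> int"

text \<open>
  A Borel state space is a Borel set \<open>E\<close> in a Polish space, with the trace of the Borel
  \<open>\<sigma>\<close>-algebra; the definitions below take this measurable space as a parameter \<open>M\<close>.
  Only the measurable structure of \<open>M\<close> is used.
\<close>

abbreviation borel_on :: "'a::topological_space set \<Rightarrow> 'a measure" where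
  "borel_on E \<equiv> restrict_space borel E"

abbreviation config_space :: "'a measure \<Rightarrow> site set \<Rightarrow> (site \<Rightarrow> 'a) measure" where
  "config_space M S \<equiv> Pi\<^sub>M S (\<lambda>_. M)"

text \<open>The value \<open>K (x, y)\<close> is the measure \<open>K(\<cdot> | x, y)\<close>.\<close>

abbreviation two_point_kernel :: "'a measure \<Rightarrow> ('a \<times> 'a \<Rightarrow> 'a measure) \<Rightarrow> bool" where
  "two_point_kernel M K \<equiv> K \<in> M \<Otimes>\<^sub>M M \<rightarrow>\<^sub>M prob_algebra M"


section \<open>Unilateral fields and uniform ergodicity\<close>

definition rect :: "nat \<Rightarrow> nat \<Rightarrow> site set" where
  "rect m n = {1..int m} \<times> {1..int n}"

text \<open>
  \<open>iterated_kernel M K S vs x\<close> is the law, on configurations over \<open>S\<close>, obtained from \<open>x\<close> by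
  resampling the sites in \<open>vs\<close> one after the other, each from \<open>K\<close> given the current values at
  its parents. If \<open>vs\<close> enumerates \<open>S\<close> with parents first, this is the measure
  \<open>B \<mapsto> \<integral>\<^sub>B \<Prod> K(dx\<^sub>i\<^sub>,\<^sub>j | x\<^sub>i\<^sub>-\<^sub>1\<^sub>,\<^sub>j, x\<^sub>i\<^sub>,\<^sub>j\<^sub>-\<^sub>1)\<close>.
\<close>

primrec iterated_kernel ::
  "'a measure \<Rightarrow> ('a \<times> 'a \<Rightarrow> 'a measure) \<Rightarrow> site set \<Rightarrow> site list \<Rightarrow> (site \<Rightarrow> 'a) \<Rightarrow> (site \<Rightarrow> 'a) measure"
where
  "iterated_kernel M K S [] x = return (config_space M S) (restrict x S)"
| "iterated_kernel M K S (v # vs) x =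
     K (x (fst v - 1, snd v), x (fst v, snd v - 1)) \<bind> (\<lambda>y. iterated_kernel M K S vs (x(v := y)))"

definition unilateral_law ::
  "'a measure \<Rightarrow> ('a \<times> 'a \<Rightarrow> 'a measure) \<Rightarrow> (site \<Rightarrow> 'a) \<Rightarrow> nat \<Rightarrow> nat \<Rightarrow> (site \<Rightarrow> 'a) measure"
where
  "unilateral_law M K x m n =
     iterated_kernel M K (rect m n) [(i, j). i \<leftarrow> [1..int m], j \<leftarrow> [1..int n]] x"

text \<open>
  The law of the unilateral field on the window \<open>(h, l) + rect m n\<close>, transported to
  \<open>rect m n\<close>; it is a marginal of the law on \<open>rect (h + m) (l + n)\<close>.
\<close>

definition unilateral_window_law ::
  "'a measure \<Rightarrow> ('a \<times> 'a \<Rightarrow> 'a measure) \<Rightarrow> (site \<Rightarrow> 'a) \<Rightarrow> nat \<Rightarrow> nat \<Rightarrow> nat \<Rightarrow> nat \<Rightarrow> (site \<Rightarrow> 'a) measure"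
where
  "unilateral_window_law M K x h l m n =
     distr (unilateral_law M K x (h + m) (l + n)) (config_space M (rect m n))
       (\<lambda>w. \<lambda>v\<in>rect m n. w (v + (int h, int l)))"

text \<open>Boundary conditions: only the values on the two positive half-axes matter.\<close>

definition boundary_conditions :: "'a measure \<Rightarrow> (site \<Rightarrow> 'a) set" where
  "boundary_conditions M = {x. \<forall>i\<ge>1. x (i, 0) \<in> space M \<and> x (0, i) \<in> space M}"

definition tv_dist :: "'b measure \<Rightarrow> 'b measure \<Rightarrow> real" where
  "tv_dist P Q = (SUP A\<in>sets P. \<bar>measure P A - measure Q A\<bar>)"

text \<open>
  A field indexed by \<open>S\<close> is given by its law. For \<open>S\<close> the quadrant, the translations mapping
  \<open>S\<close> to itself are those by nonnegative vectors; for \<open>S = UNIV\<close> they are all translations.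
\<close>

definition stationary_field :: "'a measure \<Rightarrow> site set \<Rightarrow> (site \<Rightarrow> 'a) measure \<Rightarrow> bool" where
  "stationary_field M S \<mu> \<longleftrightarrow>
     prob_space \<mu> \<and> sets \<mu> = sets (config_space M S) \<and>
     (\<forall>t. (\<forall>v\<in>S. v + t \<in> S) \<longrightarrow>
        distr \<mu> (config_space M S) (\<lambda>w. \<lambda>v\<in>S. w (v + t)) = \<mu>)"

definition marginal :: "'a measure \<Rightarrow> (site \<Rightarrow> 'a) measure \<Rightarrow> site set \<Rightarrow> (site \<Rightarrow> 'a) measure" where
  "marginal M \<mu> S = distr \<mu> (config_space M S) (\<lambda>w. restrict w S)"

definition quadrant :: "site set" where
  "quadrant = {0..} \<times> {0..}"

definition ergodic_limit ::
  "'a measure \<Rightarrow> ('a \<times> 'a \<Rightarrow> 'a measure) \<Rightarrow> (site \<Rightarrow> 'a) measure \<Rightarrow> bool"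
where
  "ergodic_limit M K \<nu> \<longleftrightarrow>
     stationary_field M quadrant \<nu> \<and>
     (\<forall>m n. uniform_limit (boundary_conditions M)
        (\<lambda>(h, l) x. tv_dist (unilateral_window_law M K x h l m n) (marginal M \<nu> (rect m n)))
        (\<lambda>_. 0) (sequentially \<times>\<^sub>F sequentially))"

definition uniformly_ergodic :: "'a measure \<Rightarrow> ('a \<times> 'a \<Rightarrow> 'a measure) \<Rightarrow> bool" where
  "uniformly_ergodic M K \<longleftrightarrow> (\<exists>\<nu>. ergodic_limit M K \<nu>)"

definition equilibrium_field ::
  "'a measure \<Rightarrow> ('a \<times> 'a \<Rightarrow> 'a measure) \<Rightarrow> (site \<Rightarrow> 'a) measure \<Rightarrow> bool"
where
  "equilibrium_field M K \<mu> \<longleftrightarrow>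
     stationary_field M UNIV \<mu> \<and> ergodic_limit M K (marginal M \<mu> quadrant)"


section \<open>Boundaries\<close>

definition parents :: "site \<Rightarrow> site set" where
  "parents v = {(fst v - 1, snd v), (fst v, snd v - 1)}"

definition parent_boundary :: "site set \<Rightarrow> site set" where
  "parent_boundary S = (\<Union>v\<in>S. parents v) - S"

definition inner_boundary :: "site set \<Rightarrow> site set" where
  "inner_boundary S = {v \<in> S. parents v \<inter> parent_boundary S \<noteq> {}}"

definition even_sites :: "site set" where
  "even_sites = {(h, k). even (h + k)}"


section \<open>Coupling functions\<close>

abbreviation unit_interval :: "real measure" where
  "unit_interval \<equiv> restrict_space lborel {0<..<1}"

definition coupling_functions ::
  "'a measure \<Rightarrow> ('a \<times> 'a \<Rightarrow> 'a measure) \<Rightarrow> 'a set \<Rightarrow> 'a measure \<Rightarrow> real \<Rightarrow> real \<Rightarrow>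
   (real \<Rightarrow> 'a) \<Rightarrow> (real \<Rightarrow> 'a \<Rightarrow> 'a \<Rightarrow> 'a) \<Rightarrow> (real \<Rightarrow> 'a \<Rightarrow> 'a \<Rightarrow> 'a) \<Rightarrow>
   (real \<Rightarrow> 'a \<Rightarrow> 'a \<Rightarrow> 'a) \<Rightarrow> (real \<Rightarrow> 'a \<Rightarrow> 'a \<Rightarrow> 'a) \<Rightarrow> bool"
where
  "coupling_functions M K C \<phi> \<rho>1 \<rho>2 f0 f1 f2 f3 f4 \<longleftrightarrow>
     f0 \<in> unit_interval \<rightarrow>\<^sub>M M \<and>
     (\<forall>f\<in>{f1, f2, f3, f4}.
        (\<lambda>(u, y1, y2). f u y1 y2) \<in> unit_interval \<Otimes>\<^sub>M (M \<Otimes>\<^sub>M M) \<rightarrow>\<^sub>M M) \<and>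
     distr unit_interval M f0 = \<phi> \<and>
     (\<forall>y1\<in>space M. \<forall>y2\<in>space M.
        (if y1 \<in> C \<and> y2 \<in> C
         then \<forall>A\<in>sets M. measure (distr unit_interval M (\<lambda>u. f1 u y1 y2)) A =
                1 / (1 - \<rho>2) * (measure (K (y1, y2)) A - \<rho>2 * measure \<phi> A)
         else distr unit_interval M (\<lambda>u. f1 u y1 y2) = K (y1, y2)) \<and>
        distr unit_interval M (\<lambda>u. f2 u y1 y2) = K (y1, y2) \<and>
        (\<forall>u\<in>{0<..<1}. f3 u y1 y2 \<in> C) \<and>
        (\<forall>A\<in>sets M. measure (distr unit_interval M (\<lambda>u. f3 u y1 y2)) A =
           measure (K (y1, y2)) (A \<inter> C) / measure (K (y1, y2)) C) \<and>
        (\<forall>A\<in>sets M. measure (distr unit_interval M (\<lambda>u. f4 u y1 y2)) A =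
           1 / (1 - \<rho>1) * (measure (K (y1, y2)) A
             - \<rho>1 * (measure (K (y1, y2)) (A \<inter> C) / measure (K (y1, y2)) C))))"

definition even_update ::
  "'a set \<Rightarrow> real \<Rightarrow> (real \<Rightarrow> 'a) \<Rightarrow> (real \<Rightarrow> 'a \<Rightarrow> 'a \<Rightarrow> 'a) \<Rightarrow> (real \<Rightarrow> 'a \<Rightarrow> 'a \<Rightarrow> 'a) \<Rightarrow>
   real \<times> real \<Rightarrow> 'a \<Rightarrow> 'a \<Rightarrow> 'a"
where
  "even_update C \<rho>2 f0 f1 f2 u y1 y2 =
     (if y1 \<in> C \<and> y2 \<in> C
      then (if snd u \<in> {0<..<\<rho>2} then f0 (fst u) else f1 (fst u) y1 y2)
      else f2 (fst u) y1 y2)"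

definition odd_update ::
  "real \<Rightarrow> (real \<Rightarrow> 'a \<Rightarrow> 'a \<Rightarrow> 'a) \<Rightarrow> (real \<Rightarrow> 'a \<Rightarrow> 'a \<Rightarrow> 'a) \<Rightarrow> real \<times> real \<Rightarrow> 'a \<Rightarrow> 'a \<Rightarrow> 'a"
where
  "odd_update \<rho>1 f3 f4 u y1 y2 =
     (if snd u \<in> {0<..<\<rho>1} then f3 (fst u) y1 y2 else f4 (fst u) y1 y2)"

text \<open>The canonical i.i.d. family of uniform variables on \<open>(0,1)\<^sup>2\<close> indexed by the sites.\<close>

definition noise :: "(site \<Rightarrow> real \<times> real) measure" where
  "noise = Pi\<^sub>M UNIV (\<lambda>_. unit_interval \<Otimes>\<^sub>M unit_interval)"


section \<open>The binary field and the random region\<close>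

definition W :: "real \<Rightarrow> real \<Rightarrow> (site \<Rightarrow> real \<times> real) \<Rightarrow> site \<Rightarrow> int" where
  "W \<rho>1 \<rho>2 u = (\<lambda>(h, k).
     1 - indicator {0<..<\<rho>1} (snd (u (h - 1, k))) * indicator {0<..<\<rho>1} (snd (u (h, k - 1)))
       * indicator {0<..<\<rho>2} (snd (u (h, k))))"

definition even_parents :: "site \<Rightarrow> site set" where
  "even_parents = (\<lambda>(h, k). {(h - 2, k), (h - 1, k - 1), (h, k - 2)})"

definition open_path ::
  "real \<Rightarrow> real \<Rightarrow> (site \<Rightarrow> real \<times> real) \<Rightarrow> nat \<Rightarrow> (nat \<Rightarrow> site) \<Rightarrow> bool"
where
  "open_path \<rho>1 \<rho>2 u m p \<longleftrightarrow>
     m > 0 \<and> (\<forall>k\<le>m. p k \<in> even_sites) \<and> (\<forall>k<m. p k \<in> even_parents (p (Suc k))) \<and>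
     (\<forall>k\<in>{1..m}. W \<rho>1 \<rho>2 u (p k) = 1)"

definition open_ancestors ::
  "real \<Rightarrow> real \<Rightarrow> site set \<Rightarrow> (site \<Rightarrow> real \<times> real) \<Rightarrow> site set"
where
  "open_ancestors \<rho>1 \<rho>2 \<Lambda> u =
     {v \<in> even_sites. \<exists>m p. open_path \<rho>1 \<rho>2 u m p \<and> p 0 = v \<and> p m \<in> inner_boundary \<Lambda>}"

definition random_region ::
  "real \<Rightarrow> real \<Rightarrow> site set \<Rightarrow> (site \<Rightarrow> real \<times> real) \<Rightarrow> site set"
where
  "random_region \<rho>1 \<rho>2 \<Lambda> u = \<Lambda> \<union> open_ancestors \<rho>1 \<rho>2 \<Lambda> u"


section \<open>The function Upsilon\<close>

text \<open>
  Both recursions are partial functions: the first is meaningful where it terminates, in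
  particular on \<open>inner_boundary \<Lambda> \<union> open_ancestors \<rho>1 \<rho>2 \<Lambda> u\<close> if the latter set is finite, and
  the second then on a finite \<open>\<Lambda>\<close>, where the parents of a site outside \<open>inner_boundary \<Lambda>\<close>
  belong to \<open>\<Lambda>\<close>.
\<close>

context
  fixes f0 :: "real \<Rightarrow> 'a" and s0 s1 :: "real \<times> real \<Rightarrow> 'a \<Rightarrow> 'a \<Rightarrow> 'a"
    and \<rho>1 \<rho>2 :: real and \<Lambda> :: "site set" and u :: "site \<Rightarrow> real \<times> real"
begin

function (domintros) Y_value :: "site \<Rightarrow> 'a" where
  "Y_value (h, k) =
     (if W \<rho>1 \<rho>2 u (h, k) = 0 then f0 (fst (u (h, k)))
      else s0 (u (h, k))
             (s1 (u (h - 1, k)) (Y_value (h - 2, k)) (Y_value (h - 1, k - 1)))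
             (s1 (u (h, k - 1)) (Y_value (h - 1, k - 1)) (Y_value (h, k - 2))))"
  by pat_completeness auto

function (domintros) X_value :: "site \<Rightarrow> 'a" where
  "X_value (i, j) =
     (if (i, j) \<in> inner_boundary \<Lambda> then Y_value (i, j)
      else (if even (i + j) then s0 else s1) (u (i, j)) (X_value (i - 1, j)) (X_value (i, j - 1)))"
  by pat_completeness auto

end

text \<open>
  If \<open>open_ancestors\<close> is infinite, the mathematical object is undefined; an arbitrary constant
  configuration in the state space is used there.
\<close>

definition Upsilon ::
  "'a measure \<Rightarrow> (real \<Rightarrow> 'a) \<Rightarrow> (real \<times> real \<Rightarrow> 'a \<Rightarrow> 'a \<Rightarrow> 'a) \<Rightarrow> (real \<times> real \<Rightarrow> 'a \<Rightarrow> 'a \<Rightarrow> 'a) \<Rightarrow>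
   real \<Rightarrow> real \<Rightarrow> site set \<Rightarrow> (site \<Rightarrow> real \<times> real) \<Rightarrow> site \<Rightarrow> 'a"
where
  "Upsilon M f0 s0 s1 \<rho>1 \<rho>2 \<Lambda> u =
     (if finite (open_ancestors \<rho>1 \<rho>2 \<Lambda> u)
      then (\<lambda>v\<in>\<Lambda>. X_value f0 s0 s1 \<rho>1 \<rho>2 \<Lambda> u v)
      else (\<lambda>v\<in>\<Lambda>. SOME e. e \<in> space M))"

end

(*
  Generate the unilateral field from i.i.d. noise, with the update s0 at even and s1 at odd sites;
  both have law K. If W = 0 at an even site, then both its parents land in C whatever lies below,
  and the site takes the fresh value f0: its past is forgotten. Hence the value at an even site
  depends only on the sites reached backwards along open paths. The value of W depends on noise at
  levels disjoint from those read further down a path, so the mean number of open paths of length n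
  ending at a given site is (3 (1 - rho1^2 rho2))^n, which decays geometrically. Off an event of
  geometrically small probability, the field in a window is a function of the noise near the window
  that does not involve the boundary conditions; this gives the convergence in total variation, and
  the limit is the law of that function, which is Upsilon. Summing the mean path counts bounds the
  size of the random region.
*)
theory Submission
  imports Defs
begin

text \<open>Uniform ergodicity is a statement about \<open>K\<close> alone, while the argument runs
  on \<open>s0\<close> and \<open>s1\<close>. Coupling functions must therefore be shown to exist,
  and this is where the Borel structure of \<open>E\<close> enters: a kernel into \<open>E\<close>
  is realised by a quantile function once \<open>E\<close> is embedded in the line. The region
  formula, in contrast, is claimed for arbitrary coupling functions; uniqueness of the equilibrium
  field ties all of them to one law. The constant 2/3 is a branching threshold: an even site has
  three even parents and is open with probability \<open>1 - \<rho>1\<^sup>2 * \<rho>2\<close>, so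
  the mean factor per generation is below 1 exactly when
  \<open>\<rho>1\<^sup>2 * \<rho>2 > 2/3\<close>. The obstacle is stationarity. The updates
  alternate with parity, so a shift by a vector with odd coordinate sum exchanges \<open>s0\<close>
  and \<open>s1\<close>, and the constructed field is not visibly invariant under it. The remedy is
  to compare the unilateral field with noise read at an arbitrary offset: both updates have law
  \<open>K\<close>, hence the offset does not change the law, and all offsets lead to the same
  limit.\<close>

section \<open>Randomization of kernels\<close>

text \<open>Digits 0 and 1 in base 3 leave a tail of at most half a unit after scaling, so the floor
  reads the digit exactly. In base 2 an infinite tail of ones would carry.\<close>

lemma ternary_digit:
  fixes b :: "nat \<Rightarrow> bool"
  defines "z \<equiv> (\<Sum>a. of_bool (b a) * (1/3::real) ^ Suc a)"
  shows "\<lfloor>3 ^ Suc a * z\<rfloor> mod 3 = of_bool (b a)"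
proof -
  let ?t = "\<lambda>a. of_bool (b a) * (1/3::real) ^ Suc a"
  have geo: "summable (\<lambda>a. (1/3::real) ^ Suc a)"
    by (subst summable_Suc_iff) (rule summable_geometric, simp)
  have summ: "summable ?t"
    by (rule summable_comparison_test'[OF geo, of 0]) auto
  have tail_summ: "summable (\<lambda>i. ?t (i + Suc a))"
    using summ by (rule summable_ignore_initial_segment)
  define r where "r = (\<Sum>i. ?t (i + Suc a))"
  have z: "z = r + (\<Sum>i<Suc a. ?t i)"
    unfolding z_def r_def by (rule suminf_split_initial_segment[OF summ])
  have "r \<ge> 0" unfolding r_def by (intro suminf_nonneg tail_summ) auto
  have "r \<le> (\<Sum>i. (1/3::real) ^ Suc (i + Suc a))"
    unfolding r_def
    by (intro suminf_le tail_summ summable_ignore_initial_segment[OF geo]) auto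
  also have "\<dots> = (\<Sum>i. (1/3::real) ^ Suc (Suc a) * (1/3) ^ i)"
    by (simp add: power_add mult_ac)
  also have "\<dots> = (1/3) ^ Suc (Suc a) * (3/2)"
    by (subst suminf_mult) (simp_all add: suminf_geometric)
  finally have "r \<le> (1/3) ^ Suc a / 2" by simp
  then have "3 ^ Suc a * r \<le> 3 ^ Suc a * ((1/3) ^ Suc a / 2)"
    by (intro mult_left_mono) auto
  also have "\<dots> = 1 / 2" by (simp add: power_divide)
  finally have r1: "3 ^ Suc a * r < 1" by simp
  have r0: "0 \<le> 3 ^ Suc a * r" using \<open>r \<ge> 0\<close> by simp
  define k :: int where "k = (\<Sum>i<a. of_bool (b i) * 3 ^ (a - Suc i))"
  have "3 ^ Suc a * (\<Sum>i<a. ?t i) = (\<Sum>i<a. of_bool (b i) * (3 * 3 ^ (a - Suc i)))"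
    unfolding sum_distrib_left
  proof (intro sum.cong refl)
    fix i assume "i \<in> {..<a}"
    then have "(3::real) ^ Suc a = 3 ^ Suc i * (3 * 3 ^ (a - Suc i))"
      by (subst power_Suc[symmetric], subst power_add[symmetric]) auto
    then show "3 ^ Suc a * ?t i = of_bool (b i) * (3 * 3 ^ (a - Suc i))"
      by (simp add: power_divide)
  qed
  also have "\<dots> = real_of_int (3 * k)"
    unfolding k_def of_int_mult of_int_sum sum_distrib_left by (intro sum.cong) (auto simp: of_bool_def)
  finally have "3 ^ Suc a * z = real_of_int (3 * k + of_bool (b a)) + 3 ^ Suc a * r"
    unfolding z by (simp add: distrib_left power_divide)
  then have "\<lfloor>3 ^ Suc a * z\<rfloor> = 3 * k + of_bool (b a)"
    using r0 r1 by (intro floor_unique) auto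
  then show ?thesis by simp
qed

text \<open>
  A point is encoded by the sequence of indices of the first \<open>2\<^sup>-\<^sup>k\<close>-close elements of a countable
  dense set, written as ternary digits; it is recovered as a limit, so the decoding is measurable.
\<close>

lemma borel_real_retract:
  fixes E :: "'a::polish_space set"
  assumes E: "E \<in> sets borel" "E \<noteq> {}"
  obtains g :: "'a \<Rightarrow> real" and r :: "real \<Rightarrow> 'a"
  where "g \<in> borel_on E \<rightarrow>\<^sub>M borel" "r \<in> borel \<rightarrow>\<^sub>M borel_on E" "\<And>x. x \<in> E \<Longrightarrow> r (g x) = x"
proof -
  obtain D :: "'a set" where D: "countable D" "\<And>X. open X \<Longrightarrow> X \<noteq> {} \<Longrightarrow> \<exists>d\<in>D. d \<in> X"
    using countable_dense_exists by blast
  define d where "d = from_nat_into D"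
  obtain e where e: "e \<in> E" using E by auto
  have dense: "\<exists>n. dist x (d n) < (1/2) ^ k" for x k
  proof -
    have "ball x ((1/2) ^ k) \<noteq> {}" by (auto simp: ball_eq_empty not_le)
    from D(2)[OF open_ball this] obtain y where "y \<in> D" "dist x y < (1/2) ^ k" by auto
    then show ?thesis using from_nat_into_surj[OF D(1)] unfolding d_def by metis
  qed
  define c where "c k x = (LEAST n. dist x (d n) < (1/2) ^ k)" for k and x :: 'a
  have c: "dist x (d (c k x)) < (1/2) ^ k" for k x
    unfolding c_def by (rule LeastI_ex[OF dense])
  have c_meas[measurable]: "c k \<in> borel \<rightarrow>\<^sub>M count_space UNIV" for k
    unfolding c_def[abs_def] by measurable
  \<comment> \<open>The index \<open>a\<close> codes a pair \<open>(k, i)\<close>, and its digit is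
    1 when \<open>c k x = i\<close>. Each row \<open>k\<close> has exactly one digit 1, so the
    digits determine every \<open>c k x\<close>.\<close>
  define b where "b a x \<longleftrightarrow> c (fst (prod_decode a)) x = snd (prod_decode a)" for a x
  have [measurable]: "Measurable.pred borel (b a)" for a
    unfolding b_def[abs_def] by measurable
  define g where "g x = (\<Sum>a. of_bool (b a x) * (1/3::real) ^ Suc a)" for x
  have g_meas: "g \<in> borel \<rightarrow>\<^sub>M borel"
    unfolding g_def[abs_def] of_bool_def by measurable
  define n where "n k z = (LEAST i. \<lfloor>3 ^ Suc (prod_encode (k, i)) * z\<rfloor> mod 3 = 1)" for k and z :: real
  have n_meas[measurable]: "n k \<in> borel \<rightarrow>\<^sub>M count_space UNIV" for k
    unfolding n_def[abs_def] by measurable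
  have n_g: "n k (g x) = c k x" for k x
    unfolding n_def g_def ternary_digit by (simp add: b_def Least_equality)
  \<comment> \<open>Reals outside the range of \<open>g\<close> may decode to a sequence without a
    limit. A constant sequence replaces it, so that the limit exists everywhere and is
    measurable.\<close>
  define good where "good z \<longleftrightarrow> Cauchy (\<lambda>k. d (n k z))" for z
  have [measurable]: "(\<lambda>z. d (n k z)) \<in> borel \<rightarrow>\<^sub>M borel" for k
    by (rule measurable_compose[OF n_meas]) simp
  have [measurable]: "Measurable.pred borel good"
    unfolding good_def[abs_def] pred_def by (rule sets_Collect_Cauchy) measurable
  define s where "s k z = (if good z then d (n k z) else e)" for k z
  have s_meas: "s k \<in> borel \<rightarrow>\<^sub>M borel" for k
    unfolding s_def[abs_def] by measurable
  have "convergent (\<lambda>k. s k z)" for z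
    by (cases "good z") (auto simp: s_def good_def Cauchy_convergent convergent_const)
  then have lim: "(\<lambda>k. s k z) \<longlonglongrightarrow> lim (\<lambda>k. s k z)" for z
    by (simp add: convergent_LIMSEQ_iff)
  have lim_meas[measurable]: "(\<lambda>z. lim (\<lambda>k. s k z)) \<in> borel \<rightarrow>\<^sub>M borel"
    by (rule borel_measurable_LIMSEQ_metric[OF s_meas lim])
  define r where "r z = (if lim (\<lambda>k. s k z) \<in> E then lim (\<lambda>k. s k z) else e)" for z
  have "r \<in> borel \<rightarrow>\<^sub>M borel"
    unfolding r_def[abs_def] using E(1) by measurable
  then have r_meas: "r \<in> borel \<rightarrow>\<^sub>M borel_on E"
    by (rule measurable_restrict_space2[rotated]) (auto simp: r_def e)
  have "r (g x) = x" if "x \<in> E" for x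
  proof -
    have c_lim: "(\<lambda>k. d (c k x)) \<longlonglongrightarrow> x"
    proof (rule metric_LIMSEQ_I)
      fix \<epsilon> :: real assume "0 < \<epsilon>"
      then obtain M where M: "(1/2) ^ M < \<epsilon>"
        using real_arch_pow_inv[of "\<epsilon>" "1/2"] by auto
      have "dist (d (c k x)) x < \<epsilon>" if "k \<ge> M" for k
      proof -
        have "(1/2::real) ^ k \<le> (1/2) ^ M" using that by (intro power_decreasing) auto
        then show ?thesis using c[of x k] M by (simp only: dist_commute[of _ x])
      qed
      then show "\<exists>no. \<forall>k\<ge>no. dist (d (c k x)) x < \<epsilon>" by blast
    qed
    then have "s k (g x) = d (c k x)" for k
      by (simp add: s_def good_def n_g LIMSEQ_imp_Cauchy)
    with c_lim have "lim (\<lambda>k. s k (g x)) = x" by (simp add: limI)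
    then show ?thesis using that by (simp add: r_def)
  qed
  moreover have "g \<in> borel_on E \<rightarrow>\<^sub>M borel" using g_meas by (rule measurable_restrict_space1)
  ultimately show thesis using r_meas that by blast
qed

lemma prob_space_unit_interval: "prob_space unit_interval"
  by (auto simp: emeasure_restrict_space space_restrict_space intro!: prob_spaceI)

text \<open>Quantile transform with a parameter: \<open>Q y\<close> is carried to the line by
  \<open>g\<close>, sampled there by the generalized inverse of its distribution function, and
  carried back by \<open>r\<close>. Joint measurability rests on the equivalence of
  \<open>q u y \<le> t\<close> with \<open>u \<le> cdf (R y) t\<close>.\<close>

lemma kernel_randomization:
  fixes E :: "'a::polish_space set"
  assumes E: "E \<in> sets borel" and Q[measurable]: "Q \<in> N \<rightarrow>\<^sub>M prob_algebra (borel_on E)"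
    and "space N \<noteq> {}"
  obtains f where "(\<lambda>(u, y). f u y) \<in> unit_interval \<Otimes>\<^sub>M N \<rightarrow>\<^sub>M borel_on E"
    "\<And>y. y \<in> space N \<Longrightarrow> distr unit_interval (borel_on E) (\<lambda>u. f u y) = Q y"
proof -
  have Q_prob: "prob_space (Q y)" and Q_sets: "sets (Q y) = sets (borel_on E)"
    if "y \<in> space N" for y
    using measurable_space[OF Q that] by (auto simp: space_prob_algebra)
  obtain y0 where "y0 \<in> space N" using assms(3) by auto
  then have "E \<noteq> {}"
    using prob_space.not_empty[OF Q_prob] sets_eq_imp_space_eq[OF Q_sets]
    by (fastforce simp: space_restrict_space)
  from borel_real_retract[OF E this] obtain g :: "'a \<Rightarrow> real" and r where
    g[measurable]: "g \<in> borel_on E \<rightarrow>\<^sub>M borel" and r[measurable]: "r \<in> borel \<rightarrow>\<^sub>M borel_on E"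
    and rg: "\<And>x. x \<in> E \<Longrightarrow> r (g x) = x" by metis
  define R where "R y = distr (Q y) borel g" for y
  have R_meas[measurable]: "R \<in> N \<rightarrow>\<^sub>M prob_algebra borel"
    unfolding R_def[abs_def] by measurable
  have R: "cdf_distribution (R y)" if "y \<in> space N" for y
  proof -
    have "prob_space (R y)" "sets (R y) = sets borel"
      using measurable_space[OF R_meas that] by (auto simp: space_prob_algebra)
    then show ?thesis
      by (simp add: cdf_distribution_def real_distribution_def real_distribution_axioms_def)
  qed
  define q where "q u y = Inf {t. u \<le> cdf (R y) t}" for u y
  have cdf_meas[measurable]: "(\<lambda>y. cdf (R y) t) \<in> borel_measurable N" for t
    unfolding cdf_def by measurable
  have q_meas[measurable]: "(\<lambda>(u, y). q u y) \<in> unit_interval \<Otimes>\<^sub>M N \<rightarrow>\<^sub>M borel"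
  proof (rule borel_measurableI_le)
    fix t
    have "{w \<in> space (unit_interval \<Otimes>\<^sub>M N). (case w of (u, y) \<Rightarrow> q u y) \<le> t}
        = {w \<in> space (unit_interval \<Otimes>\<^sub>M N). fst w \<le> cdf (R (snd w)) t}"
    proof (intro Collect_cong conj_cong refl)
      fix w assume "w \<in> space (unit_interval \<Otimes>\<^sub>M N)"
      then have w: "0 < fst w" "fst w < 1" "snd w \<in> space N"
        by (auto simp: space_pair_measure space_restrict_space)
      interpret cdf_distribution "R (snd w)" by (rule R[OF w(3)])
      show "((case w of (u, y) \<Rightarrow> q u y) \<le> t) = (fst w \<le> cdf (R (snd w)) t)"
        unfolding q_def case_prod_beta by (rule pseudoinverse[OF w(1,2), symmetric])
    qed
    moreover have "{w \<in> space (unit_interval \<Otimes>\<^sub>M N). fst w \<le> cdf (R (snd w)) t}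
        \<in> sets (unit_interval \<Otimes>\<^sub>M N)"
    proof -
      have [measurable]: "fst \<in> unit_interval \<Otimes>\<^sub>M N \<rightarrow>\<^sub>M (borel :: real measure)"
        by (rule measurable_compose[OF measurable_fst]) (simp add: measurable_restrict_space1)
      show ?thesis by measurable
    qed
    ultimately show "{w \<in> space (unit_interval \<Otimes>\<^sub>M N). (case w of (u, y) \<Rightarrow> q u y) \<le> t}
        \<in> sets (unit_interval \<Otimes>\<^sub>M N)" by simp
  qed
  show thesis
  proof
    show "(\<lambda>(u, y). r (q u y)) \<in> unit_interval \<Otimes>\<^sub>M N \<rightarrow>\<^sub>M borel_on E"
      using measurable_compose[OF q_meas r] by (simp add: split_beta)
    fix y assume y: "y \<in> space N"
    interpret cdf_distribution "R y" by (rule R[OF y])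
    have [measurable]: "(\<lambda>u. q u y) \<in> unit_interval \<rightarrow>\<^sub>M borel"
      using measurable_compose[OF measurable_Pair2'[OF y] q_meas] by simp
    have [measurable_cong]: "sets (Q y) = sets (borel_on E)" using Q_sets y .
    have "distr unit_interval (borel_on E) (\<lambda>u. r (q u y))
        = distr (distr unit_interval borel (\<lambda>u. q u y)) (borel_on E) r"
      by (simp add: distr_distr comp_def)
    also have "distr unit_interval borel (\<lambda>u. q u y) = distr (Q y) borel g"
      using distr_I_eq_M unfolding q_def R_def by simp
    also have "distr \<dots> (borel_on E) r = distr (Q y) (borel_on E) (\<lambda>x. r (g x))"
      by (simp add: distr_distr comp_def)
    also have "\<dots> = distr (Q y) (borel_on E) (\<lambda>x. x)"
      using sets_eq_imp_space_eq[OF Q_sets[OF y]]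
      by (intro distr_cong refl) (simp add: rg space_restrict_space)
    also have "\<dots> = Q y" by (rule distr_id2) (simp add: Q_sets y)
    finally show "distr unit_interval (borel_on E) (\<lambda>u. r (q u y)) = Q y" .
  qed
qed

section \<open>Remainder kernels, conditional kernels and the coupling functions\<close>

lemma measurable_prob_algebra_measureI:
  assumes "\<And>y. y \<in> space N \<Longrightarrow> prob_space (R y)" "\<And>y. y \<in> space N \<Longrightarrow> sets (R y) = sets M"
    and "\<And>A. A \<in> sets M \<Longrightarrow> (\<lambda>y. measure (R y) A) \<in> borel_measurable N"
  shows "R \<in> N \<rightarrow>\<^sub>M prob_algebra M"
proof (rule measurable_prob_algebraI[OF assms(1)], assumption)
  show "R \<in> N \<rightarrow>\<^sub>M subprob_algebra M"
  proof (rule measurable_subprob_algebra)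
    fix A assume "A \<in> sets M"
    have "(\<lambda>y. emeasure (R y) A) \<in> borel_measurable N \<longleftrightarrow>
        (\<lambda>y. ennreal (measure (R y) A)) \<in> borel_measurable N"
      using assms(1) by (intro measurable_cong) (simp add: finite_measure.emeasure_eq_measure prob_space.axioms(1))
    then show "(\<lambda>y. emeasure (R y) A) \<in> borel_measurable N"
      using assms(3)[OF \<open>A \<in> sets M\<close>] by simp
  qed (use assms in \<open>auto simp: prob_space_imp_subprob_space\<close>)
qed

text \<open>\<open>R\<close> is the remainder in the splitting
  \<open>P = \<rho> Q + (1 - \<rho>) R\<close>. Domination makes the difference a measure, of mass
  \<open>1 - \<rho>\<close>. The laws of \<open>f1\<close> and \<open>f4\<close> are of this
  kind.\<close>

lemma residual_kernel:
  assumes P[measurable]: "P \<in> N \<rightarrow>\<^sub>M prob_algebra M" and Q[measurable]: "Q \<in> N \<rightarrow>\<^sub>M prob_algebra M"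
    and \<rho>: "0 \<le> \<rho>" "\<rho> < 1"
    and le: "\<And>y A. y \<in> space N \<Longrightarrow> A \<in> sets M \<Longrightarrow> \<rho> * measure (Q y) A \<le> measure (P y) A"
  obtains R where "R \<in> N \<rightarrow>\<^sub>M prob_algebra M"
    "\<And>y A. y \<in> space N \<Longrightarrow> A \<in> sets M \<Longrightarrow>
       measure (R y) A = 1 / (1 - \<rho>) * (measure (P y) A - \<rho> * measure (Q y) A)"
proof -
  define R where "R y = scale_measure (ennreal (1 / (1 - \<rho>)))
    (diff_measure (P y) (scale_measure (ennreal \<rho>) (Q y)))" for y
  have em: "emeasure (R y) A = ennreal (1 / (1 - \<rho>) * (measure (P y) A - \<rho> * measure (Q y) A))"
    and R_sets: "sets (R y) = sets M"
    if y: "y \<in> space N" and A: "A \<in> sets M" for y A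
  proof -
    have p: "prob_space (P y)" "prob_space (Q y)" "sets (P y) = sets M" "sets (Q y) = sets M"
      using measurable_space[OF P y] measurable_space[OF Q y] by (auto simp: space_prob_algebra)
    interpret P: prob_space "P y" by fact
    interpret Q: prob_space "Q y" by fact
    have sc: "emeasure (scale_measure (ennreal \<rho>) (Q y)) B = ennreal (\<rho> * measure (Q y) B)" for B
      using \<rho> by (simp add: Q.emeasure_eq_measure ennreal_mult)
    have "finite_measure (scale_measure (ennreal \<rho>) (Q y))"
      by (rule finite_measureI) (unfold sc, simp)
    then have "emeasure (diff_measure (P y) (scale_measure (ennreal \<rho>) (Q y))) A
        = ennreal (measure (P y) A) - ennreal (\<rho> * measure (Q y) A)"
      using A p le[OF y] unfolding sc[symmetric] P.emeasure_eq_measure[symmetric]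
      by (intro emeasure_diff_measure) (auto simp only: sc P.emeasure_eq_measure ennreal_leI sets_scale_measure p P.finite_measure_axioms)
    also have "\<dots> = ennreal (measure (P y) A - \<rho> * measure (Q y) A)"
      using \<rho> by (simp add: ennreal_minus)
    finally show "emeasure (R y) A = ennreal (1 / (1 - \<rho>) * (measure (P y) A - \<rho> * measure (Q y) A))"
      using \<rho> le[OF y A] by (simp add: R_def ennreal_mult del: times_divide_eq_left)
    show "sets (R y) = sets M" by (simp add: R_def p)
  qed
  have R_measure: "measure (R y) A = 1 / (1 - \<rho>) * (measure (P y) A - \<rho> * measure (Q y) A)"
    if "y \<in> space N" "A \<in> sets M" for y A
    using em[OF that] le[OF that] \<rho> by (simp add: measure_def)
  have "R \<in> N \<rightarrow>\<^sub>M prob_algebra M"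
  proof (rule measurable_prob_algebra_measureI)
    fix y assume y: "y \<in> space N"
    show "sets (R y) = sets M" using R_sets[OF y sets.top] .
    then have sp: "space (R y) = space M" by (rule sets_eq_imp_space_eq)
    have "prob_space (P y)" "prob_space (Q y)" "space (P y) = space M" "space (Q y) = space M"
      using measurable_space[OF P y] measurable_space[OF Q y]
      by (auto simp: space_prob_algebra dest: sets_eq_imp_space_eq)
    then have "measure (P y) (space M) = 1" "measure (Q y) (space M) = 1"
      by (metis prob_space.prob_space)+
    then show "prob_space (R y)"
      using em[OF y sets.top] \<rho> by (intro prob_spaceI) (simp add: sp)
  next
    fix A assume [measurable]: "A \<in> sets M"
    have "(\<lambda>y. 1 / (1 - \<rho>) * (measure (P y) A - \<rho> * measure (Q y) A)) \<in> borel_measurable N"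
      by measurable
    then show "(\<lambda>y. measure (R y) A) \<in> borel_measurable N"
      by (subst measurable_cong[OF R_measure]) auto
  qed
  then show thesis using R_measure that by blast
qed

text \<open>The law of \<open>f3\<close>. Conditioning is written as a density, which keeps the
  sigma-algebra of \<open>M\<close> where a trace measure would change it.\<close>

lemma conditional_kernel:
  assumes P[measurable]: "P \<in> N \<rightarrow>\<^sub>M prob_algebra M" and C[measurable]: "C \<in> sets M"
    and pos: "\<And>y. y \<in> space N \<Longrightarrow> 0 < measure (P y) C"
  obtains R where "R \<in> N \<rightarrow>\<^sub>M prob_algebra M"
    "\<And>y A. y \<in> space N \<Longrightarrow> A \<in> sets M \<Longrightarrow>
       measure (R y) A = measure (P y) (A \<inter> C) / measure (P y) C"
proof -
  define R where "R y = scale_measure (ennreal (1 / measure (P y) C)) (density (P y) (indicator C))" for y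
  have em: "emeasure (R y) A = ennreal (measure (P y) (A \<inter> C) / measure (P y) C)"
    and R_sets: "sets (R y) = sets M"
    if y: "y \<in> space N" and A: "A \<in> sets M" for y A
  proof -
    have p: "prob_space (P y)" "sets (P y) = sets M"
      using measurable_space[OF P y] by (auto simp: space_prob_algebra)
    interpret P: prob_space "P y" by fact
    have "emeasure (density (P y) (indicator C)) A = ennreal (measure (P y) (A \<inter> C))"
      using A C p by (simp add: emeasure_density nn_integral_restrict_space
          P.emeasure_eq_measure[symmetric] Int_commute flip: indicator_inter_arith)
    then show "emeasure (R y) A = ennreal (measure (P y) (A \<inter> C) / measure (P y) C)"
      using pos[OF y] by (simp add: R_def flip: ennreal_mult)
    show "sets (R y) = sets M" by (simp add: R_def p)
  qed
  have R_measure: "measure (R y) A = measure (P y) (A \<inter> C) / measure (P y) C"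
    if "y \<in> space N" "A \<in> sets M" for y A
    using em[OF that] by (simp add: measure_def)
  have "R \<in> N \<rightarrow>\<^sub>M prob_algebra M"
  proof (rule measurable_prob_algebra_measureI)
    fix y assume y: "y \<in> space N"
    show "sets (R y) = sets M" using R_sets[OF y sets.top] .
    then have sp: "space (R y) = space M" by (rule sets_eq_imp_space_eq)
    have "space M \<inter> C = C" using sets.sets_into_space[OF C] by auto
    then show "prob_space (R y)"
      using em[OF y sets.top] pos[OF y] by (intro prob_spaceI) (simp add: sp)
  next
    fix A assume [measurable]: "A \<in> sets M"
    have "(\<lambda>y. measure (P y) (A \<inter> C) / measure (P y) C) \<in> borel_measurable N"
      by measurable
    then show "(\<lambda>y. measure (R y) A) \<in> borel_measurable N"
      by (subst measurable_cong[OF R_measure]) auto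
  qed
  then show thesis using R_measure that by blast
qed

lemma coupling_functions_exist:
  fixes E C :: "'a::polish_space set"
  assumes E: "E \<in> sets borel"
    and K: "two_point_kernel (borel_on E) K"
    and C: "C \<in> sets (borel_on E)"
    and \<phi>: "prob_space \<phi>" "sets \<phi> = sets (borel_on E)"
    and \<rho>: "0 < \<rho>1" "\<rho>1 < 1" "0 < \<rho>2" "\<rho>2 < 1"
    and to_C: "\<And>y1 y2. y1 \<in> E \<Longrightarrow> y2 \<in> E \<Longrightarrow> \<rho>1 \<le> measure (K (y1, y2)) C"
    and minor: "\<And>y1 y2 A. y1 \<in> C \<Longrightarrow> y2 \<in> C \<Longrightarrow> A \<in> sets (borel_on E) \<Longrightarrow>
      \<rho>2 * measure \<phi> A \<le> measure (K (y1, y2)) A"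
  obtains f0 f1 f2 f3 f4 where "coupling_functions (borel_on E) K C \<phi> \<rho>1 \<rho>2 f0 f1 f2 f3 f4"
proof -
  let ?M = "borel_on E" and ?N = "borel_on E \<Otimes>\<^sub>M borel_on E"
  have sp_M: "space ?M = E" by (simp add: space_restrict_space)
  have sp_N: "space ?N = E \<times> E" by (simp add: space_pair_measure sp_M)
  have CE: "C \<subseteq> E" using sets.sets_into_space[OF C] sp_M by simp
  note [measurable] = K C
  have \<phi>_alg: "\<phi> \<in> space (prob_algebra ?M)" using \<phi> by (simp add: space_prob_algebra)
  then have \<phi>_meas[measurable]: "(\<lambda>_. \<phi>) \<in> ?N \<rightarrow>\<^sub>M prob_algebra ?M" by simp
  have "E \<noteq> {}"
    using prob_space.not_empty[OF \<phi>(1)] sets_eq_imp_space_eq[OF \<phi>(2)] sp_M by simp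
  then obtain e where e: "e \<in> E" by auto
  have ne: "space ?N \<noteq> {}" using e sp_N by auto
  have K_prob: "prob_space (K y)" "sets (K y) = sets ?M" if "y \<in> E \<times> E" for y
    using measurable_space[OF K] that by (auto simp: space_prob_algebra sp_N)
  obtain c where c: "c \<in> C" using to_C[OF e e] \<rho>(1) by fastforce

  \<comment> \<open>The minorization is assumed on \<open>C \<times> C\<close> only. Elsewhere
    \<open>\<phi>\<close> stands in for \<open>K\<close>, as it dominates \<open>\<rho>2\<close>
    times itself; the remainder is used on \<open>C \<times> C\<close> only.\<close>
  define P where "P y = (if y \<in> C \<times> C then K y else \<phi>)" for y
  have "P \<in> ?N \<rightarrow>\<^sub>M prob_algebra ?M" unfolding P_def[abs_def] by measurable
  moreover have "\<rho>2 * measure \<phi> A \<le> measure (P y) A" if "A \<in> sets ?M" for y A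
    using minor[OF _ _ that] \<rho>
    by (cases y) (auto simp: P_def intro!: mult_left_le_one_le)
  ultimately obtain R1 where R1_meas[measurable]: "R1 \<in> ?N \<rightarrow>\<^sub>M prob_algebra ?M"
    and R1: "\<And>y A. y \<in> space ?N \<Longrightarrow> A \<in> sets ?M \<Longrightarrow>
       measure (R1 y) A = 1 / (1 - \<rho>2) * (measure (P y) A - \<rho>2 * measure \<phi> A)"
    using residual_kernel[of P ?N ?M "\<lambda>_. \<phi>" \<rho>2] \<rho> \<phi>_meas by (metis less_imp_le)
  have pos: "0 < measure (K y) C" if "y \<in> space ?N" for y
    using to_C \<rho>(1) that by (fastforce simp: sp_N)
  obtain R3 where R3_meas[measurable]: "R3 \<in> ?N \<rightarrow>\<^sub>M prob_algebra ?M"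
    and R3: "\<And>y A. y \<in> space ?N \<Longrightarrow> A \<in> sets ?M \<Longrightarrow>
       measure (R3 y) A = measure (K y) (A \<inter> C) / measure (K y) C"
    using conditional_kernel[OF K C pos] by metis
  have "\<rho>1 * measure (R3 y) A \<le> measure (K y) A" if y: "y \<in> space ?N" and A: "A \<in> sets ?M" for y A
  proof -
    interpret prob_space "K y" using K_prob y by (simp add: sp_N)
    have "\<rho>1 * measure (K y) (A \<inter> C) \<le> measure (K y) C * measure (K y) A"
      using to_C y A C K_prob(2)[of y]
      by (intro mult_mono finite_measure_mono) (auto simp: sp_N)
    then show ?thesis using pos[OF y] by (simp add: R3[OF y A] pos_divide_le_eq mult.commute)
  qed
  from residual_kernel[OF K R3_meas less_imp_le[OF \<rho>(1)] \<rho>(2) this]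
  obtain R4 where R4_meas[measurable]: "R4 \<in> ?N \<rightarrow>\<^sub>M prob_algebra ?M"
    and R4: "\<And>y A. y \<in> space ?N \<Longrightarrow> A \<in> sets ?M \<Longrightarrow>
       measure (R4 y) A = 1 / (1 - \<rho>1) * (measure (K y) A - \<rho>1 * measure (R3 y) A)"
    by metis

  obtain f0 where f0: "(\<lambda>(u, y). f0 u y) \<in> unit_interval \<Otimes>\<^sub>M ?N \<rightarrow>\<^sub>M ?M"
    "\<And>y. y \<in> space ?N \<Longrightarrow> distr unit_interval ?M (\<lambda>u. f0 u y) = \<phi>"
    using kernel_randomization[OF E \<phi>_meas ne] by metis
  have "(\<lambda>y. if y \<in> C \<times> C then R1 y else K y) \<in> ?N \<rightarrow>\<^sub>M prob_algebra ?M" by measurable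
  from kernel_randomization[OF E this ne] obtain f1 where
    f1: "(\<lambda>(u, y). f1 u y) \<in> unit_interval \<Otimes>\<^sub>M ?N \<rightarrow>\<^sub>M ?M"
      "\<And>y. y \<in> space ?N \<Longrightarrow>
         distr unit_interval ?M (\<lambda>u. f1 u y) = (if y \<in> C \<times> C then R1 y else K y)"
    by metis
  obtain f2 where f2: "(\<lambda>(u, y). f2 u y) \<in> unit_interval \<Otimes>\<^sub>M ?N \<rightarrow>\<^sub>M ?M"
    "\<And>y. y \<in> space ?N \<Longrightarrow> distr unit_interval ?M (\<lambda>u. f2 u y) = K y"
    using kernel_randomization[OF E K ne] by metis
  obtain f3 where f3: "(\<lambda>(u, y). f3 u y) \<in> unit_interval \<Otimes>\<^sub>M ?N \<rightarrow>\<^sub>M ?M"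
    "\<And>y. y \<in> space ?N \<Longrightarrow> distr unit_interval ?M (\<lambda>u. f3 u y) = R3 y"
    using kernel_randomization[OF E R3_meas ne] by metis
  obtain f4 where f4: "(\<lambda>(u, y). f4 u y) \<in> unit_interval \<Otimes>\<^sub>M ?N \<rightarrow>\<^sub>M ?M"
    "\<And>y. y \<in> space ?N \<Longrightarrow> distr unit_interval ?M (\<lambda>u. f4 u y) = R4 y"
    using kernel_randomization[OF E R4_meas ne] by metis
  \<comment> \<open>The right law puts \<open>f3\<close> in \<open>C\<close> for almost every
    \<open>u\<close>, whereas membership is required for every \<open>u\<close>. The exceptional
    values are moved to \<open>c\<close>, which leaves the law unchanged.\<close>
  define g3 where "g3 u y = (if f3 u y \<in> C then f3 u y else c)" for u y
  have "c \<in> space ?M" using c CE sp_M by auto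
  have g3_meas: "(\<lambda>(u, y). g3 u y) \<in> unit_interval \<Otimes>\<^sub>M ?N \<rightarrow>\<^sub>M ?M"
  proof -
    have "(\<lambda>z. if z \<in> C then z else c) \<in> ?M \<rightarrow>\<^sub>M ?M"
      using \<open>c \<in> space ?M\<close> by measurable
    from measurable_compose[OF f3(1) this] show ?thesis by (simp add: g3_def case_prod_unfold cong: if_cong)
  qed
  have slice: "(\<lambda>u. f u y) \<in> unit_interval \<rightarrow>\<^sub>M ?M"
    if "(\<lambda>(u, y). f u y) \<in> unit_interval \<Otimes>\<^sub>M ?N \<rightarrow>\<^sub>M ?M" "y \<in> space ?N" for f :: "real \<Rightarrow> 'a \<times> 'a \<Rightarrow> 'a" and y
    using measurable_compose[OF measurable_Pair2'[OF that(2)] that(1)] by simp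
  have g3: "distr unit_interval ?M (\<lambda>u. g3 u y) = R3 y" if y: "y \<in> space ?N" for y
  proof -
    have R3y: "prob_space (R3 y)" "sets (R3 y) = sets ?M"
      using measurable_space[OF R3_meas y] by (auto simp: space_prob_algebra)
    have "measure (R3 y) C = 1" using R3[OF y C] pos[OF y] by simp
    then have "AE z in R3 y. z \<in> C"
      using prob_space.AE_prob_1[OF R3y(1)] by auto
    then have "AE u in unit_interval. f3 u y \<in> C"
      unfolding f3(2)[OF y, symmetric] using slice[OF f3(1) y] C
      by (subst (asm) AE_distr_iff) auto
    then have "distr unit_interval ?M (\<lambda>u. g3 u y) = distr unit_interval ?M (\<lambda>u. f3 u y)"
      using slice[OF g3_meas y] slice[OF f3(1) y] by (intro distr_cong_AE) (auto simp: g3_def)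
    then show ?thesis using f3(2)[OF y] by simp
  qed
  have curry: "(\<lambda>(u, y1, y2). f u (y1, y2)) = (\<lambda>(u, y). f u y)" for f :: "real \<Rightarrow> 'a \<times> 'a \<Rightarrow> 'a"
    by auto
  show thesis
  proof (rule that[of "\<lambda>u. f0 u (e, e)" "\<lambda>u y1 y2. f1 u (y1, y2)" "\<lambda>u y1 y2. f2 u (y1, y2)"
        "\<lambda>u y1 y2. g3 u (y1, y2)" "\<lambda>u y1 y2. f4 u (y1, y2)"], unfold coupling_functions_def, intro conjI ballI)
    show "(\<lambda>u. f0 u (e, e)) \<in> unit_interval \<rightarrow>\<^sub>M ?M"
      by (rule slice[OF f0(1)]) (simp add: sp_N e)
    show "distr unit_interval ?M (\<lambda>u. f0 u (e, e)) = \<phi>"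
      by (rule f0(2)) (simp add: sp_N e)
  next
    fix f assume "f \<in> {\<lambda>u y1 y2. f1 u (y1, y2), \<lambda>u y1 y2. f2 u (y1, y2), \<lambda>u y1 y2. g3 u (y1, y2), \<lambda>u y1 y2. f4 u (y1, y2)}"
    then show "(\<lambda>(u, y1, y2). f u y1 y2) \<in> unit_interval \<Otimes>\<^sub>M ?N \<rightarrow>\<^sub>M ?M"
      using f1(1) f2(1) g3_meas f4(1) by (auto simp: curry)
  next
    fix y1 y2 assume "y1 \<in> space ?M" "y2 \<in> space ?M"
    then have y: "(y1, y2) \<in> space ?N" by (simp add: sp_N sp_M)
    show "if y1 \<in> C \<and> y2 \<in> C
       then \<forall>A\<in>sets ?M. measure (distr unit_interval ?M (\<lambda>u. f1 u (y1, y2))) A =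
              1 / (1 - \<rho>2) * (measure (K (y1, y2)) A - \<rho>2 * measure \<phi> A)
       else distr unit_interval ?M (\<lambda>u. f1 u (y1, y2)) = K (y1, y2)"
      using R1[OF y] by (auto simp: f1(2)[OF y] P_def)
    show "distr unit_interval ?M (\<lambda>u. f2 u (y1, y2)) = K (y1, y2)" by (rule f2(2)[OF y])
    show "g3 u (y1, y2) \<in> C" for u using c by (simp add: g3_def)
    fix A assume A: "A \<in> sets ?M"
    show "measure (distr unit_interval ?M (\<lambda>u. g3 u (y1, y2))) A
        = measure (K (y1, y2)) (A \<inter> C) / measure (K (y1, y2)) C"
      using R3[OF y A] by (simp add: g3[OF y])
    show "measure (distr unit_interval ?M (\<lambda>u. f4 u (y1, y2))) A = 1 / (1 - \<rho>1) *
        (measure (K (y1, y2)) A - \<rho>1 * (measure (K (y1, y2)) (A \<inter> C) / measure (K (y1, y2)) C))"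
      using R4[OF y A] R3[OF y A] by (simp add: f4(2)[OF y])
  qed
qed

section \<open>Independence in the noise\<close>

abbreviation unit_square :: "(real \<times> real) measure" where
  "unit_square \<equiv> unit_interval \<Otimes>\<^sub>M unit_interval"

lemma prob_space_unit_square: "prob_space unit_square"
  by (intro prob_space_pair prob_space_unit_interval)

interpretation noise: product_prob_space "\<lambda>_::site. unit_square" UNIV
  by (intro product_prob_spaceI prob_space_unit_square)

lemma prob_space_noise: "prob_space noise"
  unfolding noise_def by (rule noise.prob_space_axioms)

lemma sets_noise[measurable_cong]: "sets noise = sets (Pi\<^sub>M UNIV (\<lambda>_. unit_square))"
  by (simp add: noise_def)

lemma space_noise: "space noise = UNIV \<rightarrow> {0<..<1} \<times> {0<..<1}"
  by (simp add: noise_def space_PiM space_pair_measure space_restrict_space PiE_UNIV_domain Pi_def)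

lemma measurable_noise_component[measurable]: "(\<lambda>u. u v) \<in> noise \<rightarrow>\<^sub>M unit_square"
  unfolding noise_def by measurable

lemma measurable_into_noise:
  assumes "\<And>v. (\<lambda>x. f x v) \<in> N \<rightarrow>\<^sub>M unit_square"
  shows "f \<in> N \<rightarrow>\<^sub>M noise"
  unfolding noise_def using assms measurable_space[OF assms]
  by (intro measurable_PiM_single') (auto simp: PiE_UNIV_domain)

lemma emeasure_noise_cylinder:
  assumes "finite I" "\<And>i. i \<in> I \<Longrightarrow> A i \<in> sets unit_square"
  shows "emeasure noise {u \<in> space noise. \<forall>i\<in>I. u i \<in> A i} = (\<Prod>i\<in>I. emeasure unit_square (A i))"
proof -
  have "{u \<in> space noise. \<forall>i\<in>I. u i \<in> A i} = prod_emb UNIV (\<lambda>_. unit_square) I (Pi\<^sub>E I A)"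
    by (auto simp: prod_emb_def noise_def space_PiM PiE_iff)
  then show ?thesis
    using assms noise.emeasure_PiM_emb[of I A] by (simp add: noise_def)
qed

lemma sets_noise_cylinder:
  assumes "finite I" "\<And>i. i \<in> I \<Longrightarrow> A i \<in> sets unit_square"
  shows "{u \<in> space noise. \<forall>i\<in>I. u i \<in> A i} \<in> sets noise"
proof -
  have [measurable]: "{u \<in> space noise. u i \<in> A i} \<in> sets noise" if "i \<in> I" for i
    using measurable_sets[OF measurable_noise_component assms(2)[OF that], of i]
    by (simp add: vimage_def Int_def conj_commute)
  have "countable I" using assms(1) by (rule countable_finite)
  then show ?thesis by measurable
qed

lemma measurable_noise_merge:
  "(\<lambda>(a, u) v. if v \<in> J then a v else u v) \<in> noise \<Otimes>\<^sub>M noise \<rightarrow>\<^sub>M noise"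
proof (rule measurable_into_noise)
  fix v show "(\<lambda>x. (case x of (a, u) \<Rightarrow> \<lambda>v. if v \<in> J then a v else u v) v) \<in> noise \<Otimes>\<^sub>M noise \<rightarrow>\<^sub>M unit_square"
    by (cases "v \<in> J") (simp_all add: split_beta)
qed

text \<open>Independence of blocks of coordinates, put as an invariance: a cylinder over
  \<open>I\<close> pulls back to a product of cylinders over \<open>I \<inter> J\<close> and
  \<open>I - J\<close>. Both product formulas for integrals are read off from it.\<close>

lemma noise_resample:
  "distr (noise \<Otimes>\<^sub>M noise) noise (\<lambda>(a, u) v. if v \<in> J then a v else u v) = noise"
proof -
  let ?m = "\<lambda>(a, u) v. if v \<in> J then a v else u v"
  note m[measurable] = measurable_noise_merge[of J]
  interpret N: prob_space noise by (rule prob_space_noise)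
  interpret pair_prob_space noise noise ..
  show ?thesis
  proof (rule measure_eqI_PiM_infinite[where I=UNIV and M="\<lambda>_. unit_square"])
    show "finite_measure (distr (noise \<Otimes>\<^sub>M noise) noise ?m)"
      using P.prob_space_distr[OF m] by (rule prob_space.axioms)
    fix A and I :: "site set"
    assume I: "finite I" and A: "\<And>i. i \<in> I \<Longrightarrow> A i \<in> sets unit_square"
    let ?c = "\<lambda>I. {u \<in> space noise. \<forall>i\<in>I. u i \<in> A i}"
    have emb: "prod_emb UNIV (\<lambda>_. unit_square) I (Pi\<^sub>E I A) = ?c I"
      by (auto simp: prod_emb_def noise_def space_PiM PiE_iff)
    have "?m -` ?c I \<inter> space (noise \<Otimes>\<^sub>M noise) = ?c (I \<inter> J) \<times> ?c (I - J)"
      using measurable_space[OF m] by (fastforce simp: space_pair_measure split: if_splits)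
    then have "emeasure (distr (noise \<Otimes>\<^sub>M noise) noise ?m) (?c I)
        = emeasure (noise \<Otimes>\<^sub>M noise) (?c (I \<inter> J) \<times> ?c (I - J))"
      by (simp add: emeasure_distr[OF m sets_noise_cylinder[OF I A]])
    also have "\<dots> = emeasure noise (?c (I \<inter> J)) * emeasure noise (?c (I - J))"
      using I A by (intro N.emeasure_pair_measure_Times sets_noise_cylinder) auto
    also have "\<dots> = (\<Prod>i\<in>I \<inter> J. emeasure unit_square (A i)) * (\<Prod>i\<in>I - J. emeasure unit_square (A i))"
      using I A by (intro arg_cong2[where f="(*)"] emeasure_noise_cylinder) auto
    also have "\<dots> = (\<Prod>i\<in>I. emeasure unit_square (A i))"
      using I by (rule prod.Int_Diff[symmetric])
    also have "\<dots> = emeasure noise (?c I)"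
      using I A by (rule emeasure_noise_cylinder[symmetric])
    finally show "emeasure (distr (noise \<Otimes>\<^sub>M noise) noise ?m)
          (prod_emb UNIV (\<lambda>_. unit_square) I (Pi\<^sub>E I A))
        = emeasure noise (prod_emb UNIV (\<lambda>_. unit_square) I (Pi\<^sub>E I A))"
      unfolding emb .
  qed (simp_all add: noise_def)
qed

text \<open>After resampling the block \<open>J\<close>, one factor depends on the first copy of the
  noise and the other on the second. Which coordinates a function reads is stated as a pointwise
  congruence, a form that recursively defined functions satisfy by induction.\<close>

lemma nn_integral_noise_indep:
  assumes F[measurable]: "F \<in> borel_measurable noise" and G[measurable]: "G \<in> borel_measurable noise"
    and F_cong: "\<And>a u. (\<And>v. v \<in> J \<Longrightarrow> a v = u v) \<Longrightarrow> F a = F u"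
    and G_cong: "\<And>a u. (\<And>v. v \<notin> J \<Longrightarrow> a v = u v) \<Longrightarrow> G a = G u"
  shows "(\<integral>\<^sup>+u. F u * G u \<partial>noise) = (\<integral>\<^sup>+u. F u \<partial>noise) * (\<integral>\<^sup>+u. G u \<partial>noise :: ennreal)"
proof -
  interpret prob_space noise by (rule prob_space_noise)
  let ?m = "\<lambda>(a, u) v. if v \<in> J then a v else u v"
  note m[measurable] = measurable_noise_merge[of J]
  have "(\<integral>\<^sup>+u. F u * G u \<partial>noise) = (\<integral>\<^sup>+u. F u * G u \<partial>distr (noise \<Otimes>\<^sub>M noise) noise ?m)"
    by (simp only: noise_resample)
  also have "\<dots> = (\<integral>\<^sup>+x. F (?m x) * G (?m x) \<partial>(noise \<Otimes>\<^sub>M noise))"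
    by (subst nn_integral_distr) auto
  also have "\<dots> = (\<integral>\<^sup>+x. F (fst x) * G (snd x) \<partial>(noise \<Otimes>\<^sub>M noise))"
    by (intro nn_integral_cong arg_cong2[where f="(*)"] F_cong G_cong) (auto simp: split_beta)
  also have "\<dots> = (\<integral>\<^sup>+a. \<integral>\<^sup>+u. F a * G u \<partial>noise \<partial>noise)"
    by (subst nn_integral_fst[symmetric]) auto
  also have "\<dots> = (\<integral>\<^sup>+u. F u \<partial>noise) * (\<integral>\<^sup>+u. G u \<partial>noise)"
    by (simp add: nn_integral_cmult nn_integral_multc)
  finally show ?thesis .
qed

section \<open>Open paths and the random region\<close>

lemma W_eq:
  "W \<rho>1 \<rho>2 u (h, k) = (if snd (u (h - 1, k)) \<in> {0<..<\<rho>1} \<and> snd (u (h, k - 1)) \<in> {0<..<\<rho>1} \<and>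
     snd (u (h, k)) \<in> {0<..<\<rho>2} then 0 else 1)"
  by (auto simp: W_def indicator_def)

lemma measurable_snd_noise[measurable]: "(\<lambda>u. snd (u v)) \<in> borel_measurable noise"
  by (rule measurable_compose[OF measurable_noise_component],
      rule measurable_compose[OF measurable_snd]) (simp add: measurable_restrict_space1)

lemma measurable_W[measurable]: "Measurable.pred noise (\<lambda>u. W \<rho>1 \<rho>2 u w = 0)"
  by (cases w) (simp add: W_eq)

lemma emeasure_W:
  assumes "0 \<le> \<rho>1" "\<rho>1 \<le> 1" "0 \<le> \<rho>2" "\<rho>2 \<le> 1"
  shows "emeasure noise {u \<in> space noise. W \<rho>1 \<rho>2 u w \<noteq> 0} = ennreal (1 - \<rho>1\<^sup>2 * \<rho>2)"
proof -
  obtain h k where w: "w = (h, k)" by fastforce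
  interpret prob_space noise by (rule prob_space_noise)
  define A where "A v = {0<..<1::real} \<times> {0<..<if v = w then \<rho>2 else \<rho>1}" for v
  have *: "{0<..<r} \<in> sets unit_interval" "emeasure unit_interval {0<..<r} = ennreal r"
    if "0 \<le> r" "r \<le> 1" for r :: real
  proof -
    have "{0<..<r} \<subseteq> {0<..<1}" using that by auto
    then show "{0<..<r} \<in> sets unit_interval" "emeasure unit_interval {0<..<r} = ennreal r"
      using that by (simp_all add: sets_restrict_space_iff emeasure_restrict_space)
  qed
  interpret U: prob_space unit_interval by (rule prob_space_unit_interval)
  have A: "A v \<in> sets unit_square" "emeasure unit_square (A v) = ennreal (if v = w then \<rho>2 else \<rho>1)" for v
    unfolding A_def using assms by (auto simp: * U.emeasure_pair_measure_Times)
  have "{u \<in> space noise. W \<rho>1 \<rho>2 u w = 0}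
      = {u \<in> space noise. \<forall>v\<in>{(h - 1, k), (h, k - 1), w}. u v \<in> A v}"
    by (auto simp: w W_eq A_def space_noise mem_Times_iff Pi_iff)
  also have "emeasure noise \<dots> = (\<Prod>v\<in>{(h - 1, k), (h, k - 1), w}. emeasure unit_square (A v))"
    using A by (intro emeasure_noise_cylinder) auto
  also have "\<dots> = ennreal (\<rho>1\<^sup>2 * \<rho>2)"
    using assms by (simp add: A w ennreal_mult power2_eq_square mult_ac)
  finally have "prob {u \<in> space noise. W \<rho>1 \<rho>2 u w = 0} = \<rho>1\<^sup>2 * \<rho>2"
    using assms by (simp add: measure_def)
  then have "prob {u \<in> space noise. \<not> W \<rho>1 \<rho>2 u w = 0} = 1 - \<rho>1\<^sup>2 * \<rho>2"
    by (subst prob_neg) auto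
  then show ?thesis by (simp add: emeasure_eq_measure)
qed

text \<open>Paths with the same start are counted separately, which makes the mean an exact power. A
  path is read backwards from its end \<open>w\<close>, and \<open>W\<close> is not tested at its
  start, so the count for length 0 is always 1.\<close>

primrec open_path_count ::
  "real \<Rightarrow> real \<Rightarrow> (site \<Rightarrow> real \<times> real) \<Rightarrow> nat \<Rightarrow> site \<Rightarrow> nat"
where
  "open_path_count \<rho>1 \<rho>2 u 0 w = 1"
| "open_path_count \<rho>1 \<rho>2 u (Suc n) w =
     (if W \<rho>1 \<rho>2 u w = 0 then 0 else \<Sum>p\<in>even_parents w. open_path_count \<rho>1 \<rho>2 u n p)"

lemma finite_even_parents[simp]: "finite (even_parents w)"
  by (cases w) (simp add: even_parents_def)

lemma card_even_parents: "card (even_parents w) = 3"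
  by (cases w) (simp add: even_parents_def)

lemma even_parents_level: "p \<in> even_parents w \<Longrightarrow> fst p + snd p = fst w + snd w - 2"
  by (cases w) (auto simp: even_parents_def)

lemma open_path_count_cong:
  assumes "\<And>v. fst v + snd v \<le> fst w + snd w \<Longrightarrow> u v = u' v"
  shows "open_path_count \<rho>1 \<rho>2 u n w = open_path_count \<rho>1 \<rho>2 u' n w"
  using assms
proof (induction n arbitrary: w)
  case (Suc n)
  have "W \<rho>1 \<rho>2 u w = W \<rho>1 \<rho>2 u' w"
    using Suc.prems by (cases w) (simp add: W_eq)
  moreover have "open_path_count \<rho>1 \<rho>2 u n p = open_path_count \<rho>1 \<rho>2 u' n p" if "p \<in> even_parents w" for p
    using even_parents_level[OF that] by (intro Suc.IH Suc.prems) simp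
  ultimately show ?case by simp
qed simp

lemma measurable_open_path_count[measurable]:
  "(\<lambda>u. open_path_count \<rho>1 \<rho>2 u n w) \<in> noise \<rightarrow>\<^sub>M count_space UNIV"
  by (induction n arbitrary: w) (simp_all, measurable)

text \<open>Neighbouring even sites of one level share an odd parent, so their \<open>W\<close>
  values are dependent; they enter only through a sum over the three parents, and expectations add.
  A generation contributes the factor 3 and the probability that \<open>w\<close> is open.\<close>

lemma nn_integral_open_path_count:
  assumes "0 \<le> \<rho>1" "\<rho>1 \<le> 1" "0 \<le> \<rho>2" "\<rho>2 \<le> 1"
  shows "(\<integral>\<^sup>+u. of_nat (open_path_count \<rho>1 \<rho>2 u n w) \<partial>noise) = ennreal ((3 * (1 - \<rho>1\<^sup>2 * \<rho>2)) ^ n)"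
proof (induction n arbitrary: w)
  case 0
  then show ?case using prob_space.emeasure_space_1[OF prob_space_noise] by simp
next
  case (Suc n)
  let ?q = "1 - \<rho>1\<^sup>2 * \<rho>2"
  have q: "0 \<le> ?q"
    using assms mult_le_one[of "\<rho>1\<^sup>2" \<rho>2] by (simp add: power_le_one)
  let ?F = "\<lambda>u. of_bool (W \<rho>1 \<rho>2 u w \<noteq> 0) :: ennreal"
  let ?G = "\<lambda>u. \<Sum>p\<in>even_parents w. of_nat (open_path_count \<rho>1 \<rho>2 u n p) :: ennreal"
  have "(\<integral>\<^sup>+u. of_nat (open_path_count \<rho>1 \<rho>2 u (Suc n) w) \<partial>noise) = (\<integral>\<^sup>+u. ?F u * ?G u \<partial>noise)"
    by (intro nn_integral_cong) simp
  \<comment> \<open>\<open>W\<close> reads the noise at the level of \<open>w\<close> and just below; the shorter paths only read lower levels.\<close>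
  also have "\<dots> = (\<integral>\<^sup>+u. ?F u \<partial>noise) * (\<integral>\<^sup>+u. ?G u \<partial>noise)"
  proof (rule nn_integral_noise_indep[where J="{v. fst v + snd v > fst w + snd w - 2}"])
    fix a u :: "site \<Rightarrow> real \<times> real"
    { assume "\<And>v. v \<in> {v. fst v + snd v > fst w + snd w - 2} \<Longrightarrow> a v = u v"
      then show "?F a = ?F u" by (cases w) (simp add: W_eq) }
    { assume "\<And>v. v \<notin> {v. fst v + snd v > fst w + snd w - 2} \<Longrightarrow> a v = u v"
      then show "?G a = ?G u"
        by (intro sum.cong refl arg_cong[where f=of_nat] open_path_count_cong) (auto dest: even_parents_level) }
  qed (simp_all add: of_bool_def)
  also have "(\<integral>\<^sup>+u. ?F u \<partial>noise) = (\<integral>\<^sup>+u. indicator {u \<in> space noise. W \<rho>1 \<rho>2 u w \<noteq> 0} u \<partial>noise)"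
    by (intro nn_integral_cong) (simp add: indicator_def)
  also have "\<dots> = ennreal ?q"
    using emeasure_W[OF assms] by (subst nn_integral_indicator) auto
  also have "(\<integral>\<^sup>+u. ?G u \<partial>noise) = (\<Sum>p\<in>even_parents w. ennreal ((3 * ?q) ^ n))"
    by (subst nn_integral_sum) (simp_all add: Suc.IH)
  also have "\<dots> = ennreal (3 * (3 * ?q) ^ n)"
    using q by (simp add: card_even_parents ennreal_mult del: power_mult_distrib)
  finally show ?case using q by (simp add: ennreal_mult[symmetric] mult_ac)
qed

text \<open>Markov's inequality at level 1, the count being an integer.\<close>

lemma prob_open_path_count:
  assumes "0 \<le> \<rho>1" "\<rho>1 \<le> 1" "0 \<le> \<rho>2" "\<rho>2 \<le> 1"
  shows "measure noise {u \<in> space noise. open_path_count \<rho>1 \<rho>2 u n w \<noteq> 0} \<le> (3 * (1 - \<rho>1\<^sup>2 * \<rho>2)) ^ n"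
proof -
  interpret prob_space noise by (rule prob_space_noise)
  have q: "0 \<le> 1 - \<rho>1\<^sup>2 * \<rho>2"
    using assms mult_le_one[of "\<rho>1\<^sup>2" \<rho>2] by (simp add: power_le_one)
  have "emeasure noise {u \<in> space noise. open_path_count \<rho>1 \<rho>2 u n w \<noteq> 0}
      = (\<integral>\<^sup>+u. indicator {u \<in> space noise. open_path_count \<rho>1 \<rho>2 u n w \<noteq> 0} u \<partial>noise)"
    by (rule nn_integral_indicator[symmetric]) measurable
  also have "\<dots> \<le> (\<integral>\<^sup>+u. of_nat (open_path_count \<rho>1 \<rho>2 u n w) \<partial>noise)"
  proof (rule nn_integral_mono)
    fix u
    have "(1::ennreal) \<le> of_nat k" if "k \<noteq> 0" for k :: nat
      using of_nat_mono[of 1 k, where ?'a=ennreal] that by simp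
    then show "indicator {u \<in> space noise. open_path_count \<rho>1 \<rho>2 u n w \<noteq> 0} u
        \<le> (of_nat (open_path_count \<rho>1 \<rho>2 u n w) :: ennreal)"
      by (simp add: indicator_def)
  qed
  finally show ?thesis
    using q unfolding nn_integral_open_path_count[OF assms] by (simp add: emeasure_eq_measure)
qed

lemma W_eq_1_iff: "W \<rho>1 \<rho>2 u w = 1 \<longleftrightarrow> W \<rho>1 \<rho>2 u w \<noteq> 0"
  by (cases w) (simp add: W_eq)

text \<open>The last \<open>n\<close> steps of an open path of length \<open>n + 1\<close> form an
  open path with the same end, so extinction is permanent.\<close>

lemma open_path_count_Suc_eq_0:
  "open_path_count \<rho>1 \<rho>2 u n w = 0 \<Longrightarrow> open_path_count \<rho>1 \<rho>2 u (Suc n) w = 0"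
proof (induction n arbitrary: w)
  case (Suc n)
  show ?case
  proof (cases "W \<rho>1 \<rho>2 u w = 0")
    case False
    then have "open_path_count \<rho>1 \<rho>2 u n p = 0" if "p \<in> even_parents w" for p
      using Suc.prems that by simp
    then have "open_path_count \<rho>1 \<rho>2 u (Suc n) p = 0" if "p \<in> even_parents w" for p
      using Suc.IH that by blast
    then show ?thesis by (subst open_path_count.simps(2)) simp
  qed simp
qed simp

lemma open_path_count_eq_0_mono:
  assumes "open_path_count \<rho>1 \<rho>2 u n w = 0" "n \<le> m"
  shows "open_path_count \<rho>1 \<rho>2 u m w = 0"
  using assms(2,1) by (induction m rule: dec_induct) (blast intro: open_path_count_Suc_eq_0)+

section \<open>The set of open ancestors and its size\<close>

primrec open_starts ::
  "real \<Rightarrow> real \<Rightarrow> (site \<Rightarrow> real \<times> real) \<Rightarrow> nat \<Rightarrow> site \<Rightarrow> site set"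
where
  "open_starts \<rho>1 \<rho>2 u 0 w = {w}"
| "open_starts \<rho>1 \<rho>2 u (Suc n) w =
     (if W \<rho>1 \<rho>2 u w = 0 then {} else \<Union>p\<in>even_parents w. open_starts \<rho>1 \<rho>2 u n p)"

lemma finite_open_starts[simp]: "finite (open_starts \<rho>1 \<rho>2 u n w)"
  by (induction n arbitrary: w) simp_all

lemma card_open_starts: "card (open_starts \<rho>1 \<rho>2 u n w) \<le> open_path_count \<rho>1 \<rho>2 u n w"
proof (induction n arbitrary: w)
  case (Suc n)
  have "card (\<Union>p\<in>even_parents w. open_starts \<rho>1 \<rho>2 u n p)
      \<le> (\<Sum>p\<in>even_parents w. card (open_starts \<rho>1 \<rho>2 u n p))"
    by (rule card_UN_le) simp
  also have "\<dots> \<le> (\<Sum>p\<in>even_parents w. open_path_count \<rho>1 \<rho>2 u n p)"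
    by (intro sum_mono Suc.IH)
  finally show ?case by simp
qed simp

lemma open_starts_empty_iff:
  "open_starts \<rho>1 \<rho>2 u n w = {} \<longleftrightarrow> open_path_count \<rho>1 \<rho>2 u n w = 0"
  by (induction n arbitrary: w) auto

lemma open_starts_level:
  "v \<in> open_starts \<rho>1 \<rho>2 u n w \<Longrightarrow> fst v + snd v = fst w + snd w - 2 * int n"
  by (induction n arbitrary: w) (fastforce dest: even_parents_level split: if_splits)+

lemma mem_open_starts_iff:
  "v \<in> open_starts \<rho>1 \<rho>2 u n w \<longleftrightarrow>
     (\<exists>p. p 0 = v \<and> p n = w \<and> (\<forall>k<n. p k \<in> even_parents (p (Suc k))) \<and>
          (\<forall>k\<in>{1..n}. W \<rho>1 \<rho>2 u (p k) \<noteq> 0))"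
  (is "_ \<longleftrightarrow> (\<exists>p. ?path n w p)")
proof (induction n arbitrary: w)
  case 0
  then show ?case by (auto intro!: exI[of _ "\<lambda>_. w"])
next
  case (Suc n)
  show ?case
  proof
    assume "v \<in> open_starts \<rho>1 \<rho>2 u (Suc n) w"
    then obtain w' where "W \<rho>1 \<rho>2 u w \<noteq> 0" "w' \<in> even_parents w" "v \<in> open_starts \<rho>1 \<rho>2 u n w'"
      by (auto split: if_splits)
    moreover from this obtain p where "?path n w' p" using Suc.IH by blast
    ultimately have "?path (Suc n) w (p(Suc n := w))"
      by (auto simp: less_Suc_eq le_Suc_eq)
    then show "\<exists>p. ?path (Suc n) w p" by blast
  next
    assume "\<exists>p. ?path (Suc n) w p"
    then obtain p where p: "?path (Suc n) w p" by blast
    then have "?path n (p n) p" by auto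
    then have "v \<in> open_starts \<rho>1 \<rho>2 u n (p n)" using Suc.IH by blast
    moreover have "p n \<in> even_parents w" "W \<rho>1 \<rho>2 u w \<noteq> 0" using p by auto
    ultimately show "v \<in> open_starts \<rho>1 \<rho>2 u (Suc n) w" by auto
  qed
qed

lemma even_parents_even: "p \<in> even_parents w \<Longrightarrow> p \<in> even_sites \<longleftrightarrow> w \<in> even_sites"
  by (cases w) (auto simp: even_parents_def even_sites_def)

text \<open>Passing to even parents preserves parity, so a path that ends at an even boundary site
  stays in \<open>even_sites\<close>. The recursive sets, which do not mention parity, therefore
  give exactly the open ancestors.\<close>

lemma open_ancestors_eq:
  assumes "inner_boundary \<Lambda> \<subseteq> even_sites"
  shows "open_ancestors \<rho>1 \<rho>2 \<Lambda> u = (\<Union>w\<in>inner_boundary \<Lambda>. \<Union>n. open_starts \<rho>1 \<rho>2 u (Suc n) w)"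
proof (intro set_eqI iffI)
  fix v assume "v \<in> open_ancestors \<rho>1 \<rho>2 \<Lambda> u"
  then obtain m p where p: "open_path \<rho>1 \<rho>2 u m p" "p 0 = v" "p m \<in> inner_boundary \<Lambda>"
    by (auto simp: open_ancestors_def)
  then have "v \<in> open_starts \<rho>1 \<rho>2 u m (p m)"
    unfolding mem_open_starts_iff open_path_def W_eq_1_iff by blast
  moreover obtain n where "m = Suc n" using p(1) by (cases m) (auto simp: open_path_def)
  ultimately show "v \<in> (\<Union>w\<in>inner_boundary \<Lambda>. \<Union>n. open_starts \<rho>1 \<rho>2 u (Suc n) w)"
    using p(3) by blast
next
  fix v assume "v \<in> (\<Union>w\<in>inner_boundary \<Lambda>. \<Union>n. open_starts \<rho>1 \<rho>2 u (Suc n) w)"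
  then obtain w n p where w: "w \<in> inner_boundary \<Lambda>"
    and p: "p 0 = v" "p (Suc n) = w" "\<And>k. k < Suc n \<Longrightarrow> p k \<in> even_parents (p (Suc k))"
      "\<And>k. k \<in> {1..Suc n} \<Longrightarrow> W \<rho>1 \<rho>2 u (p k) \<noteq> 0"
    unfolding UN_iff mem_open_starts_iff by blast
  have ev: "p k \<in> even_sites" if "k \<le> Suc n" for k
    using that
  proof (induction k rule: inc_induct)
    case base
    then show ?case using w p(2) assms by auto
  next
    case (step k)
    then show ?case using even_parents_even[OF p(3)[of k]] by simp
  qed
  have "open_path \<rho>1 \<rho>2 u (Suc n) p"
    unfolding open_path_def W_eq_1_iff using ev p(3,4) by blast
  then show "v \<in> open_ancestors \<rho>1 \<rho>2 \<Lambda> u"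
    unfolding open_ancestors_def using w p(1,2) ev[of 0] by blast
qed

lemma finite_inner_boundary: "finite \<Lambda> \<Longrightarrow> finite (inner_boundary \<Lambda>)"
  by (rule finite_subset[of _ \<Lambda>]) (auto simp: inner_boundary_def)

text \<open>A path of length \<open>n\<close> descends \<open>2 n\<close> levels, so a finite set of
  ancestors bounds the length of open paths. Conversely, extinction leaves finitely many
  generations, each of them finite.\<close>

lemma finite_open_ancestors_iff:
  assumes "finite \<Lambda>" "inner_boundary \<Lambda> \<subseteq> even_sites"
  shows "finite (open_ancestors \<rho>1 \<rho>2 \<Lambda> u) \<longleftrightarrow>
    (\<exists>n. \<forall>w\<in>inner_boundary \<Lambda>. open_path_count \<rho>1 \<rho>2 u n w = 0)"
proof
  let ?l = "\<lambda>v::site. fst v + snd v"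
  let ?A = "open_ancestors \<rho>1 \<rho>2 \<Lambda> u"
  assume fin: "finite ?A"
  obtain a where a: "\<And>v. v \<in> ?A \<Longrightarrow> a \<le> ?l v"
    using bdd_below_finite[OF finite_imageI[OF fin, of ?l]] unfolding bdd_below_def by blast
  obtain b where b: "\<And>w. w \<in> inner_boundary \<Lambda> \<Longrightarrow> ?l w \<le> b"
    using bdd_above_finite[OF finite_imageI[OF finite_inner_boundary[OF assms(1)], of ?l]]
    unfolding bdd_above_def by blast
  \<comment> \<open>A path of length \<open>Suc n\<close> descends more than \<open>b - a\<close>
    levels and so would start below the bound \<open>a\<close>.\<close>
  define n where "n = nat (b - a)"
  have "open_starts \<rho>1 \<rho>2 u (Suc n) w = {}" if w: "w \<in> inner_boundary \<Lambda>" for w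
  proof (rule equals0I)
    fix v assume v: "v \<in> open_starts \<rho>1 \<rho>2 u (Suc n) w"
    then have "v \<in> ?A" unfolding open_ancestors_eq[OF assms(2)] using w by blast
    from a[OF this] have "a \<le> ?l w - 2 * int (Suc n)" using open_starts_level[OF v] by simp
    then show False using b[OF w] by (simp add: n_def split: if_splits)
  qed
  then show "\<exists>n. \<forall>w\<in>inner_boundary \<Lambda>. open_path_count \<rho>1 \<rho>2 u n w = 0"
    using open_starts_empty_iff by blast
next
  assume "\<exists>n. \<forall>w\<in>inner_boundary \<Lambda>. open_path_count \<rho>1 \<rho>2 u n w = 0"
  then obtain n where n0: "\<And>w. w \<in> inner_boundary \<Lambda> \<Longrightarrow> open_path_count \<rho>1 \<rho>2 u n w = 0" by blast
  have n: "open_starts \<rho>1 \<rho>2 u m w = {}" if "w \<in> inner_boundary \<Lambda>" "n \<le> m" for m w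
    unfolding open_starts_empty_iff by (rule open_path_count_eq_0_mono[OF n0[OF that(1)] that(2)])
  have "open_ancestors \<rho>1 \<rho>2 \<Lambda> u \<subseteq> (\<Union>w\<in>inner_boundary \<Lambda>. \<Union>m<n. open_starts \<rho>1 \<rho>2 u (Suc m) w)"
  proof
    fix v assume "v \<in> open_ancestors \<rho>1 \<rho>2 \<Lambda> u"
    then obtain w m where w: "w \<in> inner_boundary \<Lambda>" and v: "v \<in> open_starts \<rho>1 \<rho>2 u (Suc m) w"
      unfolding open_ancestors_eq[OF assms(2)] by blast
    then have "m < n" using n[OF w, of "Suc m"] by (cases "m < n") auto
    then show "v \<in> (\<Union>w\<in>inner_boundary \<Lambda>. \<Union>m<n. open_starts \<rho>1 \<rho>2 u (Suc m) w)" using w v by blast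
  qed
  then show "finite (open_ancestors \<rho>1 \<rho>2 \<Lambda> u)"
    by (rule finite_subset) (simp add: finite_inner_boundary[OF assms(1)])
qed

text \<open>Sizes live in \<open>ennreal\<close>, so this union bound holds for every
  \<open>u\<close>, also when the region is infinite and the series diverges with it.\<close>

lemma emeasure_random_region:
  assumes "finite \<Lambda>" "inner_boundary \<Lambda> \<subseteq> even_sites"
  shows "emeasure (count_space UNIV) (random_region \<rho>1 \<rho>2 \<Lambda> u)
    \<le> of_nat (card \<Lambda>) + (\<Sum>w\<in>inner_boundary \<Lambda>. \<Sum>n. of_nat (open_path_count \<rho>1 \<rho>2 u (Suc n) w))"
proof -
  let ?c = "emeasure (count_space (UNIV :: site set))"
  have "?c (random_region \<rho>1 \<rho>2 \<Lambda> u) \<le> ?c \<Lambda> + ?c (open_ancestors \<rho>1 \<rho>2 \<Lambda> u)"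
    unfolding random_region_def by (rule emeasure_subadditive) auto
  also have "?c \<Lambda> = of_nat (card \<Lambda>)" using assms by simp
  also have "?c (open_ancestors \<rho>1 \<rho>2 \<Lambda> u)
      \<le> (\<Sum>w\<in>inner_boundary \<Lambda>. ?c (\<Union>n. open_starts \<rho>1 \<rho>2 u (Suc n) w))"
    unfolding open_ancestors_eq[OF assms(2)]
    by (rule emeasure_subadditive_finite) (use finite_inner_boundary[OF assms(1)] in auto)
  also have "\<dots> \<le> (\<Sum>w\<in>inner_boundary \<Lambda>. \<Sum>n. of_nat (open_path_count \<rho>1 \<rho>2 u (Suc n) w))"
  proof (rule sum_mono)
    fix w
    have "?c (\<Union>n. open_starts \<rho>1 \<rho>2 u (Suc n) w) \<le> (\<Sum>n. ?c (open_starts \<rho>1 \<rho>2 u (Suc n) w))"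
      by (rule emeasure_subadditive_countably) auto
    also have "\<dots> \<le> (\<Sum>n. of_nat (open_path_count \<rho>1 \<rho>2 u (Suc n) w))"
    proof (intro suminf_le allI)
      fix n show "?c (open_starts \<rho>1 \<rho>2 u (Suc n) w) \<le> of_nat (open_path_count \<rho>1 \<rho>2 u (Suc n) w)"
        using of_nat_mono[OF card_open_starts, where ?'a=ennreal]
        by (subst emeasure_count_space_finite[OF subset_UNIV finite_open_starts])
    qed auto
    finally show "?c (\<Union>n. open_starts \<rho>1 \<rho>2 u (Suc n) w)
        \<le> (\<Sum>n. of_nat (open_path_count \<rho>1 \<rho>2 u (Suc n) w))" .
  qed
  finally show ?thesis by (simp add: add_left_mono)
qed

text \<open>The union bound is integrated term by term, the path counts being measurable. The
  exponents start at 1 because ancestors are reached by paths of positive length.\<close>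

lemma nn_integral_random_region:
  assumes \<rho>: "0 \<le> \<rho>1" "\<rho>1 \<le> 1" "0 \<le> \<rho>2" "\<rho>2 \<le> 1"
    and \<Lambda>: "finite \<Lambda>" "inner_boundary \<Lambda> \<subseteq> even_sites"
  shows "of_nat (card \<Lambda>) \<le> (\<integral>\<^sup>+u. emeasure (count_space UNIV) (random_region \<rho>1 \<rho>2 \<Lambda> u) \<partial>noise)"
    and "(\<integral>\<^sup>+u. emeasure (count_space UNIV) (random_region \<rho>1 \<rho>2 \<Lambda> u) \<partial>noise)
      \<le> of_nat (card \<Lambda>) +
        (\<Sum>n. ennreal ((3 * (1 - \<rho>1\<^sup>2 * \<rho>2)) ^ Suc n)) * of_nat (card (inner_boundary \<Lambda>))"
proof -
  let ?c = "emeasure (count_space (UNIV :: site set))"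
  interpret prob_space noise by (rule prob_space_noise)
  have "of_nat (card \<Lambda>) = (\<integral>\<^sup>+u. of_nat (card \<Lambda>) \<partial>noise)" by (simp add: emeasure_space_1)
  also have "\<dots> \<le> (\<integral>\<^sup>+u. ?c (random_region \<rho>1 \<rho>2 \<Lambda> u) \<partial>noise)"
  proof (rule nn_integral_mono)
    fix u
    have "?c \<Lambda> \<le> ?c (random_region \<rho>1 \<rho>2 \<Lambda> u)"
      by (rule emeasure_mono) (auto simp: random_region_def)
    then show "of_nat (card \<Lambda>) \<le> ?c (random_region \<rho>1 \<rho>2 \<Lambda> u)" using \<Lambda>(1) by simp
  qed
  finally show "of_nat (card \<Lambda>) \<le> (\<integral>\<^sup>+u. ?c (random_region \<rho>1 \<rho>2 \<Lambda> u) \<partial>noise)" .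
  have "(\<integral>\<^sup>+u. ?c (random_region \<rho>1 \<rho>2 \<Lambda> u) \<partial>noise) \<le> (\<integral>\<^sup>+u. of_nat (card \<Lambda>) +
      (\<Sum>w\<in>inner_boundary \<Lambda>. \<Sum>n. of_nat (open_path_count \<rho>1 \<rho>2 u (Suc n) w)) \<partial>noise)"
    by (intro nn_integral_mono emeasure_random_region \<Lambda>)
  also have "\<dots> = of_nat (card \<Lambda>) + (\<Sum>w\<in>inner_boundary \<Lambda>. \<Sum>n.
      (\<integral>\<^sup>+u. of_nat (open_path_count \<rho>1 \<rho>2 u (Suc n) w) \<partial>noise))"
    by (subst nn_integral_add)
      (simp_all add: nn_integral_sum nn_integral_suminf emeasure_space_1 del: open_path_count.simps)
  also have "\<dots> = of_nat (card \<Lambda>) +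
      (\<Sum>n. ennreal ((3 * (1 - \<rho>1\<^sup>2 * \<rho>2)) ^ Suc n)) * of_nat (card (inner_boundary \<Lambda>))"
    unfolding nn_integral_open_path_count[OF \<rho>] by (simp add: mult.commute)
  finally show "(\<integral>\<^sup>+u. ?c (random_region \<rho>1 \<rho>2 \<Lambda> u) \<partial>noise) \<le> of_nat (card \<Lambda>) +
      (\<Sum>n. ennreal ((3 * (1 - \<rho>1\<^sup>2 * \<rho>2)) ^ Suc n)) * of_nat (card (inner_boundary \<Lambda>))" .
qed

section \<open>Isolating the noise at a single site\<close>

lemma distr_noise_component: "distr noise unit_square (\<lambda>u. u v) = unit_square"
  unfolding noise_def by (rule noise.PiM_component) simp

lemma emeasure_distr_nn_integral:
  assumes f: "f \<in> N \<rightarrow>\<^sub>M L" and A: "A \<in> sets L"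
  shows "emeasure (distr N L f) A = (\<integral>\<^sup>+x. indicator A (f x) \<partial>N)"
proof -
  have "(\<integral>\<^sup>+x. indicator A (f x) \<partial>N) = (\<integral>\<^sup>+y. indicator A y \<partial>distr N L f)"
    by (rule sym, rule nn_integral_distr[OF f]) (use A in simp)
  then show ?thesis using A by simp
qed

text \<open>In its second argument \<open>h\<close> ignores the coordinate \<open>w\<close>, so the
  noise at \<open>w\<close> can be drawn separately. This converts one step of the kernel iteration
  into one read of the noise.\<close>

lemma nn_integral_noise_split:
  assumes h[measurable]: "(\<lambda>(a, u). h a u) \<in> borel_measurable (unit_square \<Otimes>\<^sub>M noise)"
    and cong: "\<And>a u u'. (\<And>v. v \<noteq> w \<Longrightarrow> u v = u' v) \<Longrightarrow> h a u = h a u'"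
  shows "(\<integral>\<^sup>+u. h (u w) u \<partial>noise) = (\<integral>\<^sup>+a. \<integral>\<^sup>+u. h a u \<partial>noise \<partial>unit_square :: ennreal)"
proof -
  interpret prob_space noise by (rule prob_space_noise)
  define m :: "_ \<Rightarrow> site \<Rightarrow> real \<times> real"
    where "m = (\<lambda>(a, u) v. if v \<in> {w} then a v else u v)"
  have m[measurable]: "m \<in> noise \<Otimes>\<^sub>M noise \<rightarrow>\<^sub>M noise"
    unfolding m_def by (rule measurable_noise_merge)
  have hw: "(\<lambda>u. h (u w) u) \<in> borel_measurable noise"
    using measurable_compose[OF measurable_Pair[OF measurable_noise_component measurable_ident] h] by simp
  have hw2: "(\<lambda>x. h (fst x w) (snd x)) \<in> borel_measurable (noise \<Otimes>\<^sub>M noise)"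
    using measurable_compose[OF measurable_Pair[OF
        measurable_compose[OF measurable_fst measurable_noise_component] measurable_snd] h]
    by simp
  have "(\<integral>\<^sup>+u. h (u w) u \<partial>noise) = (\<integral>\<^sup>+u. h (u w) u \<partial>distr (noise \<Otimes>\<^sub>M noise) noise m)"
    unfolding m_def by (simp only: noise_resample)
  also have "\<dots> = (\<integral>\<^sup>+x. h (m x w) (m x) \<partial>(noise \<Otimes>\<^sub>M noise))"
    using m hw by (intro nn_integral_distr) simp_all
  also have "\<dots> = (\<integral>\<^sup>+x. h (fst x w) (snd x) \<partial>(noise \<Otimes>\<^sub>M noise))"
    by (intro nn_integral_cong) (auto simp: m_def split_beta intro!: cong)
  also have "\<dots> = (\<integral>\<^sup>+b. \<integral>\<^sup>+u. h (b w) u \<partial>noise \<partial>noise)"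
    using nn_integral_fst[OF hw2] by simp
  also have "\<dots> = (\<integral>\<^sup>+a. \<integral>\<^sup>+u. h a u \<partial>noise \<partial>distr noise unit_square (\<lambda>u. u w))"
    by (rule sym, rule nn_integral_distr[OF measurable_noise_component])
      (use borel_measurable_nn_integral_fst[OF h] in simp)
  finally show ?thesis by (simp only: distr_noise_component)
qed

section \<open>Unilateral fields as functions of the noise\<close>

definition west :: "site \<Rightarrow> site" where "west v = (fst v - 1, snd v)"
definition south :: "site \<Rightarrow> site" where "south v = (fst v, snd v - 1)"

lemma fst_west[simp]: "fst (west v) = fst v - 1" and snd_west[simp]: "snd (west v) = snd v"
  and fst_south[simp]: "fst (south v) = fst v" and snd_south[simp]: "snd (south v) = snd v - 1"
  by (simp_all add: west_def south_def)

lemma south_west: "south (west v) = west (south v)"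
  by (simp add: west_def south_def)

lemma parents_eq: "parents v = {west v, south v}"
  by (simp add: parents_def west_def south_def)

lemma even_parents_eq: "even_parents w = {west (west w), west (south w), south (south w)}"
  by (cases w) (auto simp: even_parents_def west_def south_def)

lemma even_sites_iff: "v \<in> even_sites \<longleftrightarrow> even (fst v + snd v)"
  by (cases v) (simp add: even_sites_def)

lemma even_sites_west[simp]: "west v \<in> even_sites \<longleftrightarrow> v \<notin> even_sites"
  and even_sites_south[simp]: "south v \<in> even_sites \<longleftrightarrow> v \<notin> even_sites"
  unfolding even_sites_iff fst_west snd_west fst_south snd_south by presburger+

text \<open>\<open>G\<close> holds the sites whose values are already known. That \<open>v\<close>
  does not recur ensures that every update reads fresh noise.\<close>

primrec parents_first :: "site set \<Rightarrow> site list \<Rightarrow> bool" where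
  "parents_first G [] \<longleftrightarrow> True"
| "parents_first G (v # vs) \<longleftrightarrow>
     west v \<in> G \<and> south v \<in> G \<and> v \<notin> set vs \<and> parents_first (insert v G) vs"

text \<open>The law of the unilateral field depends on the updates only through both having law
  \<open>K\<close>; which of the two acts at a site leaves it unchanged.\<close>

locale site_updates =
  fixes M :: "'a measure" and K :: "'a \<times> 'a \<Rightarrow> 'a measure"
    and s0 s1 :: "real \<times> real \<Rightarrow> 'a \<Rightarrow> 'a \<Rightarrow> 'a"
  assumes kernel: "two_point_kernel M K"
    and s0_measurable: "(\<lambda>(a, y1, y2). s0 a y1 y2) \<in> unit_square \<Otimes>\<^sub>M (M \<Otimes>\<^sub>M M) \<rightarrow>\<^sub>M M"
    and s1_measurable: "(\<lambda>(a, y1, y2). s1 a y1 y2) \<in> unit_square \<Otimes>\<^sub>M (M \<Otimes>\<^sub>M M) \<rightarrow>\<^sub>M M"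
    and s0_law: "\<And>y1 y2. y1 \<in> space M \<Longrightarrow> y2 \<in> space M \<Longrightarrow>
      distr unit_square M (\<lambda>a. s0 a y1 y2) = K (y1, y2)"
    and s1_law: "\<And>y1 y2. y1 \<in> space M \<Longrightarrow> y2 \<in> space M \<Longrightarrow>
      distr unit_square M (\<lambda>a. s1 a y1 y2) = K (y1, y2)"
begin

definition update :: "site \<Rightarrow> real \<times> real \<Rightarrow> 'a \<Rightarrow> 'a \<Rightarrow> 'a" where
  "update v = (if v \<in> even_sites then s0 else s1)"

lemma measurable_s0[measurable (raw)]:
  "\<lbrakk>a \<in> N \<rightarrow>\<^sub>M unit_square; f \<in> N \<rightarrow>\<^sub>M M; g \<in> N \<rightarrow>\<^sub>M M\<rbrakk> \<Longrightarrow> (\<lambda>x. s0 (a x) (f x) (g x)) \<in> N \<rightarrow>\<^sub>M M"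
  using measurable_compose[OF measurable_Pair[OF _ measurable_Pair] s0_measurable] by simp

lemma measurable_s1[measurable (raw)]:
  "\<lbrakk>a \<in> N \<rightarrow>\<^sub>M unit_square; f \<in> N \<rightarrow>\<^sub>M M; g \<in> N \<rightarrow>\<^sub>M M\<rbrakk> \<Longrightarrow> (\<lambda>x. s1 (a x) (f x) (g x)) \<in> N \<rightarrow>\<^sub>M M"
  using measurable_compose[OF measurable_Pair[OF _ measurable_Pair] s1_measurable] by simp

lemma measurable_update[measurable (raw)]:
  "\<lbrakk>a \<in> N \<rightarrow>\<^sub>M unit_square; f \<in> N \<rightarrow>\<^sub>M M; g \<in> N \<rightarrow>\<^sub>M M\<rbrakk> \<Longrightarrow>
     (\<lambda>x. update v (a x) (f x) (g x)) \<in> N \<rightarrow>\<^sub>M M"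
  by (simp add: update_def measurable_s0 measurable_s1)

lemma update_law:
  "y1 \<in> space M \<Longrightarrow> y2 \<in> space M \<Longrightarrow> distr unit_square M (\<lambda>a. update v a y1 y2) = K (y1, y2)"
  by (simp add: update_def s0_law s1_law)

text \<open>The noise and the parity of a site \<open>v\<close> are read off at \<open>v + t\<close>.\<close>

primrec run :: "site \<Rightarrow> site list \<Rightarrow> (site \<Rightarrow> 'a) \<Rightarrow> (site \<Rightarrow> real \<times> real) \<Rightarrow> site \<Rightarrow> 'a" where
  "run t [] x u = x"
| "run t (v # vs) x u = run t vs (x(v := update (v + t) (u (v + t)) (x (west v)) (x (south v)))) u"

lemma run_cong:
  assumes "\<And>v. v \<in> set vs \<Longrightarrow> u (v + t) = u' (v + t)"
  shows "run t vs x u = run t vs x u'"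
  using assms by (induction vs arbitrary: x) simp_all

lemma run_unchanged: "v \<notin> set vs \<Longrightarrow> run t vs x u v = x v"
  by (induction vs arbitrary: x) simp_all

text \<open>The starting configuration varies with a parameter \<open>z\<close>, because after one
  update it depends on the noise. Measurability is asked for at the known sites \<open>G\<close>
  only.\<close>

lemma measurable_run:
  assumes "parents_first G vs" "\<And>g. g \<in> G \<Longrightarrow> (\<lambda>z. F z g) \<in> N \<rightarrow>\<^sub>M M"
    and U[measurable]: "U \<in> N \<rightarrow>\<^sub>M noise" and "v \<in> G \<union> set vs"
  shows "(\<lambda>z. run t vs (F z) (U z) v) \<in> N \<rightarrow>\<^sub>M M"
  using assms(1,2,4)
proof (induction vs arbitrary: F G)
  case (Cons a vs)
  have [measurable]: "(\<lambda>z. F z (west a)) \<in> N \<rightarrow>\<^sub>M M" "(\<lambda>z. F z (south a)) \<in> N \<rightarrow>\<^sub>M M"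
    using Cons.prems by auto
  have [measurable]: "(\<lambda>z. U z (a + t)) \<in> N \<rightarrow>\<^sub>M unit_square"
    by (rule measurable_compose[OF U]) simp
  show ?case
    unfolding run.simps
  proof (rule Cons.IH[where G="insert a G"])
    fix g assume "g \<in> insert a G"
    then show "(\<lambda>z. ((F z)(a := update (a + t) (U z (a + t)) (F z (west a)) (F z (south a)))) g) \<in> N \<rightarrow>\<^sub>M M"
      using Cons.prems(2)[of g] by (cases "g = a") simp_all
  qed (use Cons.prems in auto)
qed simp

text \<open>The noise at \<open>v + t\<close> is read when \<open>v\<close> is updated and never
  again, so integrating over it is the same as integrating over \<open>K\<close>. The offset
  \<open>t\<close> is free, whatever its parity, because both updates have law
  \<open>K\<close>.\<close>

lemma iterated_kernel_eq_run:
  assumes "parents_first G vs" "\<And>g. g \<in> G \<Longrightarrow> x g \<in> space M" "S \<subseteq> G \<union> set vs"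
  shows "iterated_kernel M K S vs x = distr noise (config_space M S) (\<lambda>u. restrict (run t vs x u) S)"
  using assms
proof (induction vs arbitrary: x G)
  case Nil
  interpret prob_space noise by (rule prob_space_noise)
  have "restrict x S \<in> space (config_space M S)"
    using Nil by (auto simp: space_PiM)
  then show ?case
    unfolding iterated_kernel.simps run.simps by (rule distr_const[symmetric])
next
  case (Cons v vs)
  let ?C = "config_space M S"
  interpret N: prob_space noise by (rule prob_space_noise)
  have y12: "x (west v) \<in> space M" "x (south v) \<in> space M" using Cons.prems by auto
  define g where "g a = update (v + t) a (x (west v)) (x (south v))" for a
  have g[measurable]: "g \<in> unit_square \<rightarrow>\<^sub>M M"
    unfolding g_def[abs_def] using y12 by measurable
  define F where "F y u = restrict (run t vs (x(v := y)) u) S" for y u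
  have F[measurable]: "(\<lambda>(y, u). F y u) \<in> M \<Otimes>\<^sub>M noise \<rightarrow>\<^sub>M ?C"
    unfolding F_def case_prod_beta
  proof (rule measurable_restrict)
    fix w assume "w \<in> S"
    show "(\<lambda>p. run t vs (x(v := fst p)) (snd p) w) \<in> M \<Otimes>\<^sub>M noise \<rightarrow>\<^sub>M M"
    proof (rule measurable_run[where G="insert v G"])
      fix g' assume "g' \<in> insert v G"
      then show "(\<lambda>p. (x(v := fst p)) g') \<in> M \<Otimes>\<^sub>M noise \<rightarrow>\<^sub>M M"
        using Cons.prems(2)[of g'] by (cases "g' = v") simp_all
    qed (use Cons.prems \<open>w \<in> S\<close> in auto)
  qed
  have F_y[measurable]: "(\<lambda>u. F y u) \<in> noise \<rightarrow>\<^sub>M ?C" if "y \<in> space M" for y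
    using measurable_compose[OF measurable_Pair1'[OF that] F] by simp
  have Q: "(\<lambda>y. distr noise ?C (F y)) \<in> M \<rightarrow>\<^sub>M prob_algebra ?C"
    using F prob_space_noise by (intro measurable_distr_prob_space2[where M=noise]) (auto simp: space_prob_algebra)
  have "iterated_kernel M K S (v # vs) x
      = distr unit_square M g \<bind> (\<lambda>y. iterated_kernel M K S vs (x(v := y)))"
    using update_law[OF y12, of "v + t"] by (simp add: g_def[abs_def] west_def south_def)
  also have "\<dots> = distr unit_square M g \<bind> (\<lambda>y. distr noise ?C (F y))"
  proof (rule bind_cong[OF refl])
    fix y assume "y \<in> space (distr unit_square M g)"
    then show "iterated_kernel M K S vs (x(v := y)) = distr noise ?C (F y)"
      unfolding F_def using Cons.prems by (intro Cons.IH[where G="insert v G"]) auto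
  qed
  also have "\<dots> = distr noise ?C (\<lambda>u. F (g (u (v + t))) u)"
  proof (rule measure_eqI)
    have D: "distr unit_square M g \<in> space (prob_algebra M)"
      using prob_space.prob_space_distr[OF prob_space_unit_square g] by (simp add: space_prob_algebra)
    have m: "(\<lambda>u. F (g (u (v + t))) u) \<in> noise \<rightarrow>\<^sub>M ?C"
      using measurable_compose[OF measurable_Pair[OF
          measurable_compose[OF measurable_noise_component g] measurable_ident] F] by simp
    have Fg: "(\<lambda>x. F (g (fst x)) (snd x)) \<in> unit_square \<Otimes>\<^sub>M noise \<rightarrow>\<^sub>M ?C"
      using measurable_compose[OF measurable_Pair[OF
          measurable_compose[OF measurable_fst g] measurable_snd] F] by simp
    show "sets (distr unit_square M g \<bind> (\<lambda>y. distr noise ?C (F y)))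
        = sets (distr noise ?C (\<lambda>u. F (g (u (v + t))) u))"
      using prob_space_bind'[OF D Q] sets_bind'[OF D Q] by simp
    fix A assume "A \<in> sets (distr unit_square M g \<bind> (\<lambda>y. distr noise ?C (F y)))"
    then have A[measurable]: "A \<in> sets ?C" using sets_bind'[OF D Q] by simp
    have "emeasure (distr unit_square M g \<bind> (\<lambda>y. distr noise ?C (F y))) A
        = (\<integral>\<^sup>+y. emeasure (distr noise ?C (F y)) A \<partial>distr unit_square M g)"
      by (rule emeasure_bind_prob_algebra[OF D Q A])
    also have "\<dots> = (\<integral>\<^sup>+a. emeasure (distr noise ?C (F (g a))) A \<partial>unit_square)"
      using measurable_compose[OF measurable_prob_algebraD[OF Q] measurable_emeasure_subprob_algebra[OF A]]
      by (intro nn_integral_distr g) simp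
    also have "\<dots> = (\<integral>\<^sup>+a. \<integral>\<^sup>+u. indicator A (F (g a) u) \<partial>noise \<partial>unit_square)"
      by (intro nn_integral_cong emeasure_distr_nn_integral F_y A measurable_space[OF g])
    also have "\<dots> = (\<integral>\<^sup>+u. indicator A (F (g (u (v + t))) u) \<partial>noise)"
    proof (rule nn_integral_noise_split[symmetric])
      show "(\<lambda>(a, u). indicator A (F (g a) u) :: ennreal) \<in> borel_measurable (unit_square \<Otimes>\<^sub>M noise)"
        using measurable_compose[OF Fg borel_measurable_indicator[OF A]] by (simp add: split_beta)
      fix a :: "real \<times> real" and u u' :: "site \<Rightarrow> real \<times> real"
      assume u: "\<And>w. w \<noteq> v + t \<Longrightarrow> u w = u' w"
      have "run t vs (x(v := g a)) u = run t vs (x(v := g a)) u'"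
      proof (rule run_cong)
        fix w assume "w \<in> set vs"
        then have "w + t \<noteq> v + t" using Cons.prems(1) by auto
        then show "u (w + t) = u' (w + t)" by (rule u)
      qed
      then show "indicator A (F (g a) u) = (indicator A (F (g a) u') :: ennreal)"
        by (simp add: F_def)
    qed
    also have "\<dots> = emeasure (distr noise ?C (\<lambda>u. F (g (u (v + t))) u)) A"
      by (rule emeasure_distr_nn_integral[OF m A, symmetric])
    finally show "emeasure (distr unit_square M g \<bind> (\<lambda>y. distr noise ?C (F y))) A
        = emeasure (distr noise ?C (\<lambda>u. F (g (u (v + t))) u)) A" .
  qed
  finally show ?case unfolding F_def g_def run.simps .
qed

text \<open>A value once written is not overwritten, and disjointness from \<open>G\<close> protects
  the initial values. The relation that holds at the moment of an update thus survives in the final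
  configuration.\<close>

lemma run_solution:
  assumes "parents_first G vs" "G \<inter> set vs = {}" "v \<in> set vs"
  shows "run t vs x u v = update (v + t) (u (v + t)) (run t vs x u (west v)) (run t vs x u (south v))"
  using assms
proof (induction vs arbitrary: x G)
  case (Cons a vs)
  have ne: "west a \<noteq> a" "south a \<noteq> a" by (auto simp: prod_eq_iff)
  show ?case
  proof (cases "v = a")
    case True
    then have "v \<notin> set vs" "west v \<notin> set vs" "south v \<notin> set vs" using Cons.prems by auto
    then show ?thesis using True ne by (simp add: run_unchanged)
  next
    case False
    then show ?thesis
      using Cons.prems by (simp only: run.simps) (intro Cons.IH[where G="insert a G"]; auto)
  qed
qed simp

lemma run_in_space:
  assumes "parents_first G vs" "\<And>g. g \<in> G \<Longrightarrow> x g \<in> space M" "v \<in> G \<union> set vs" "u \<in> space noise"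
  shows "run t vs x u v \<in> space M"
proof -
  have "(\<lambda>u. run t vs x u v) \<in> noise \<rightarrow>\<^sub>M M"
    using assms by (intro measurable_run[where G=G]) auto
  from measurable_space[OF this assms(4)] show ?thesis .
qed

end

section \<open>Enumerating a rectangle column by column\<close>

lemma parents_first_append:
  "parents_first G (vs @ ws) \<longleftrightarrow>
     parents_first G vs \<and> parents_first (G \<union> set vs) ws \<and> set vs \<inter> set ws = {}"
  by (induction vs arbitrary: G) auto

lemma parents_first_column:
  assumes "(i, 0) \<in> G" "\<And>j. 1 \<le> j \<Longrightarrow> j \<le> int n \<Longrightarrow> (i - 1, j) \<in> G"
  shows "parents_first G (map (Pair i) [1..int n])"
  using assms
proof (induction n)
  case (Suc n)
  have eq: "[1..int (Suc n)] = [1..int n] @ [int (Suc n)]"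
    using upto_rec2[of 1 "int (Suc n)"] by simp
  show ?case
    unfolding eq map_append parents_first_append
    using Suc by (cases "n = 0") (auto simp: west_def south_def)
qed simp

lemma parents_first_rect:
  assumes "{1..int m} \<times> {0} \<union> {0} \<times> {1..int n} \<subseteq> G"
  shows "parents_first G [(i, j). i \<leftarrow> [1..int m], j \<leftarrow> [1..int n]]"
  using assms
proof (induction m)
  case (Suc m)
  let ?vs = "[(i, j). i \<leftarrow> [1..int m], j \<leftarrow> [1..int n]]"
  have "[1..int (Suc m)] = [1..int m] @ [int (Suc m)]"
    using upto_rec2[of 1 "int (Suc m)"] by simp
  then have "[(i, j). i \<leftarrow> [1..int (Suc m)], j \<leftarrow> [1..int n]]
      = ?vs @ map (Pair (int (Suc m))) [1..int n]"
    by simp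
  moreover have "parents_first G ?vs"
    by (rule Suc.IH) (use Suc.prems in \<open>auto simp: subset_iff\<close>)
  moreover have "parents_first (G \<union> set ?vs) (map (Pair (int (Suc m))) [1..int n])"
    using Suc.prems by (intro parents_first_column) (cases "m = 0"; force)+
  moreover have "set ?vs \<inter> set (map (Pair (int (Suc m))) [1..int n]) = {}" by auto
  ultimately show ?case by (simp only: parents_first_append simp_thms)
qed simp

lemma set_rect_list: "set [(i, j). i \<leftarrow> [1..int m], j \<leftarrow> [1..int n]] = rect m n"
  by (auto simp: rect_def)

section \<open>Convergence to the limit field\<close>

lemma tv_dist_bdd_above:
  assumes "prob_space P" "prob_space Q"
  shows "bdd_above ((\<lambda>A. \<bar>measure P A - measure Q A\<bar>) ` sets P)"
proof (rule bdd_aboveI2)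
  fix A
  show "\<bar>measure P A - measure Q A\<bar> \<le> 1"
    using prob_space.prob_le_1[OF assms(1), of A] prob_space.prob_le_1[OF assms(2), of A]
      measure_nonneg[of P A] measure_nonneg[of Q A] by linarith
qed

lemma tv_dist_upper:
  assumes "prob_space P" "prob_space Q" "A \<in> sets P"
  shows "\<bar>measure P A - measure Q A\<bar> \<le> tv_dist P Q"
  unfolding tv_dist_def by (rule cSUP_upper[OF assms(3) tv_dist_bdd_above[OF assms(1,2)]])

lemma tv_dist_nonneg:
  assumes "prob_space P" "prob_space Q"
  shows "0 \<le> tv_dist P Q"
  using tv_dist_upper[OF assms sets.empty_sets] by simp

text \<open>The coupling inequality: an event for \<open>f\<close> is contained in the same event
  for \<open>g\<close> together with \<open>B\<close>, and symmetrically.\<close>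

lemma tv_dist_distr_le:
  assumes "prob_space N" and f: "f \<in> N \<rightarrow>\<^sub>M L" and g: "g \<in> N \<rightarrow>\<^sub>M L" and B: "B \<in> sets N"
    and eq: "\<And>x. x \<in> space N \<Longrightarrow> x \<notin> B \<Longrightarrow> f x = g x"
  shows "tv_dist (distr N L f) (distr N L g) \<le> measure N B"
  unfolding tv_dist_def
proof (rule cSUP_least)
  interpret prob_space N by fact
  have one: "prob (f -` A \<inter> space N) \<le> prob (g -` A \<inter> space N) + prob B"
    if "A \<in> sets L" "f \<in> N \<rightarrow>\<^sub>M L" "g \<in> N \<rightarrow>\<^sub>M L" "\<And>x. x \<in> space N \<Longrightarrow> x \<notin> B \<Longrightarrow> f x = g x"
    for A f g
  proof -
    have "prob (f -` A \<inter> space N) \<le> prob ((g -` A \<inter> space N) \<union> B)"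
      using that B by (intro finite_measure_mono) (auto dest: measurable_sets)
    also have "\<dots> \<le> prob (g -` A \<inter> space N) + prob B"
      using that B by (intro measure_Un_le measurable_sets) auto
    finally show ?thesis .
  qed
  fix A assume "A \<in> sets (distr N L f)"
  then have A: "A \<in> sets L" by simp
  show "\<bar>measure (distr N L f) A - measure (distr N L g) A\<bar> \<le> prob B"
    using one[OF A f g eq] one[OF A g f eq[symmetric]] by (simp add: measure_distr f g A)
qed auto

text \<open>The pointwise side of the coupling: for a small second noise coordinate,
  \<open>s1\<close> lands in \<open>C\<close> from any arguments and \<open>s0\<close> forgets
  arguments in \<open>C\<close>. The laws of the coupling functions are already absorbed into
  \<open>site_updates\<close>.\<close>

locale percolating_updates = site_updates M K s0 s1
  for M :: "'a measure" and K s0 s1 +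
  fixes C :: "'a set" and \<rho>1 \<rho>2 :: real and f0 :: "real \<Rightarrow> 'a"
  assumes f0_measurable: "f0 \<in> unit_interval \<rightarrow>\<^sub>M M"
    and \<rho>: "0 \<le> \<rho>1" "\<rho>1 \<le> 1" "0 \<le> \<rho>2" "\<rho>2 \<le> 1"
    and subcritical: "\<rho>1\<^sup>2 * \<rho>2 > 2 / 3"
    and s1_in_C: "\<And>a y1 y2. a \<in> space unit_square \<Longrightarrow> snd a \<in> {0<..<\<rho>1} \<Longrightarrow>
      y1 \<in> space M \<Longrightarrow> y2 \<in> space M \<Longrightarrow> s1 a y1 y2 \<in> C"
    and s0_regenerates: "\<And>a y1 y2. snd a \<in> {0<..<\<rho>2} \<Longrightarrow> y1 \<in> C \<Longrightarrow> y2 \<in> C \<Longrightarrow>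
      s0 a y1 y2 = f0 (fst a)"
begin

lemma f0_half_in_space: "f0 (1 / 2) \<in> space M"
  by (rule measurable_space[OF f0_measurable]) (simp add: space_restrict_space)

abbreviation "growth \<equiv> 3 * (1 - \<rho>1\<^sup>2 * \<rho>2)"

lemma growth: "0 \<le> growth" "growth < 1"
proof -
  have "\<rho>1\<^sup>2 * \<rho>2 \<le> 1" using \<rho> mult_le_one[of "\<rho>1\<^sup>2" \<rho>2] by (simp add: power_le_one)
  then show "0 \<le> growth" "growth < 1" using subcritical by auto
qed

abbreviation "npaths \<equiv> open_path_count \<rho>1 \<rho>2"

text \<open>
  The recursion for \<open>Y\<close> cut off after \<open>n\<close> generations; the value \<open>f0 (1 / 2)\<close> at the cut is
  arbitrary and irrelevant once \<open>w\<close> has no open path of length \<open>n\<close>.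
\<close>

primrec truncated_Y :: "(site \<Rightarrow> real \<times> real) \<Rightarrow> nat \<Rightarrow> site \<Rightarrow> 'a" where
  "truncated_Y u 0 w = f0 (1 / 2)"
| "truncated_Y u (Suc n) w =
     (if W \<rho>1 \<rho>2 u w = 0 then f0 (fst (u w))
      else s0 (u w)
        (s1 (u (west w)) (truncated_Y u n (west (west w))) (truncated_Y u n (west (south w))))
        (s1 (u (south w)) (truncated_Y u n (west (south w))) (truncated_Y u n (south (south w)))))"

lemma measurable_truncated_Y[measurable]: "(\<lambda>u. truncated_Y u n w) \<in> noise \<rightarrow>\<^sub>M M"
proof (induction n arbitrary: w)
  case 0
  then show ?case using f0_half_in_space by simp
next
  case (Suc n)
  note Suc.IH[measurable]
  have [measurable]: "(\<lambda>u. f0 (fst (u w))) \<in> noise \<rightarrow>\<^sub>M M"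
    by (rule measurable_compose[OF measurable_noise_component],
        rule measurable_compose[OF measurable_fst f0_measurable])
  show ?case by simp
qed

lemma count_Suc_eq_0_iff:
  "npaths u (Suc n) w = 0 \<longleftrightarrow> W \<rho>1 \<rho>2 u w = 0 \<or>
     npaths u n (west (west w)) = 0 \<and> npaths u n (west (south w)) = 0 \<and> npaths u n (south (south w)) = 0"
  by (simp add: even_parents_eq)

text \<open>Every branch of the recursion meets a site with \<open>W = 0\<close> before the cut, so
  the value at the cut is never reached. The case of \<open>n = 0\<close> is vacuous, the count
  being 1.\<close>

lemma truncated_Y_stable:
  "npaths u n w = 0 \<Longrightarrow> n \<le> m \<Longrightarrow> truncated_Y u m w = truncated_Y u n w"
proof (induction n arbitrary: w m)
  case (Suc n)
  then obtain m' where m': "m = Suc m'" "n \<le> m'" by (cases m) auto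
  show ?case
  proof (cases "W \<rho>1 \<rho>2 u w = 0")
    case False
    with Suc.prems(1) show ?thesis
      using Suc.IH[OF _ m'(2)] by (simp add: m'(1) count_Suc_eq_0_iff del: open_path_count.simps)
  qed (simp add: m'(1))
qed simp

text \<open>If no \<open>n\<close> qualifies, \<open>LEAST\<close> is an unspecified number and the
  value is still a point of \<open>space M\<close>. The field is thus defined on the whole noise
  space and measurable there.\<close>

definition Y_limit :: "(site \<Rightarrow> real \<times> real) \<Rightarrow> site \<Rightarrow> 'a" where
  "Y_limit u w = truncated_Y u (LEAST n. npaths u n w = 0) w"

definition X_limit :: "(site \<Rightarrow> real \<times> real) \<Rightarrow> site \<Rightarrow> 'a" where
  "X_limit u v = (if v \<in> even_sites then Y_limit u v
     else s1 (u v) (Y_limit u (west v)) (Y_limit u (south v)))"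

lemma Y_limit_eq: "npaths u n w = 0 \<Longrightarrow> Y_limit u w = truncated_Y u n w"
  unfolding Y_limit_def
  by (rule truncated_Y_stable[symmetric]) (auto intro: LeastI Least_le)

lemma measurable_Y_limit[measurable]: "(\<lambda>u. Y_limit u w) \<in> noise \<rightarrow>\<^sub>M M"
  unfolding Y_limit_def by (rule measurable_compose_countable) measurable

lemma measurable_X_limit[measurable]: "(\<lambda>u. X_limit u v) \<in> noise \<rightarrow>\<^sub>M M"
  by (cases "v \<in> even_sites") (simp_all add: X_limit_def)

definition extinct :: "nat \<Rightarrow> site \<Rightarrow> (site \<Rightarrow> real \<times> real) \<Rightarrow> bool" where
  "extinct n v u \<longleftrightarrow> (if v \<in> even_sites then npaths u n v = 0
     else npaths u n (west v) = 0 \<and> npaths u n (south v) = 0)"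

lemma measurable_extinct[measurable]: "Measurable.pred noise (extinct n v)"
  by (cases "v \<in> even_sites") (simp_all add: extinct_def[abs_def])

text \<open>The factor 2 is for odd sites, which require extinction at both even parents.\<close>

lemma prob_not_extinct: "measure noise {u \<in> space noise. \<not> extinct n v u} \<le> 2 * growth ^ n"
proof (cases "v \<in> even_sites")
  case True
  have "growth ^ n \<le> 2 * growth ^ n" using growth(1) zero_le_power[of growth n] by linarith
  then show ?thesis
    using prob_open_path_count[OF \<rho>, of n v] True by (simp add: extinct_def)
next
  case False
  interpret prob_space noise by (rule prob_space_noise)
  have "{u \<in> space noise. \<not> extinct n v u}
      = {u \<in> space noise. npaths u n (west v) \<noteq> 0} \<union> {u \<in> space noise. npaths u n (south v) \<noteq> 0}"
    using False by (auto simp: extinct_def)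
  also have "prob \<dots> \<le> prob {u \<in> space noise. npaths u n (west v) \<noteq> 0}
      + prob {u \<in> space noise. npaths u n (south v) \<noteq> 0}"
    by (rule measure_Un_le) measurable
  also have "\<dots> \<le> growth ^ n + growth ^ n"
    by (intro add_mono prob_open_path_count \<rho>)
  finally show ?thesis by simp
qed

lemma noise_in_unit_square: "u \<in> space noise \<Longrightarrow> u v \<in> space unit_square"
  using measurable_space[OF measurable_noise_component] by blast

text \<open>
  A regenerating site forgets its past, so a solution of the recursion on a large enough box
  agrees with the truncated field as soon as there are no long open paths.
\<close>

lemma solution_eq_truncated_Y:
  assumes u: "u \<in> space noise" and rec: "\<And>v. v \<in> B \<Longrightarrow>
      R v = update v (u v) (R (west v)) (R (south v)) \<and> R (west v) \<in> space M \<and> R (south v) \<in> space M"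
    and "w \<in> even_sites" "npaths u n w = 0"
    and "\<And>v. fst w - 2 * int n < fst v \<Longrightarrow> fst v \<le> fst w \<Longrightarrow>
           snd w - 2 * int n < snd v \<Longrightarrow> snd v \<le> snd w \<Longrightarrow> v \<in> B"
  shows "R w = truncated_Y u n w"
  using assms(3-5)
proof (induction n arbitrary: w)
  case (Suc n)
  have B: "w \<in> B" "west w \<in> B" "south w \<in> B" by (intro Suc.prems; simp)+
  have Rw: "R w = s0 (u w) (R (west w)) (R (south w))"
    using rec[OF B(1)] Suc.prems(1) by (simp add: update_def)
  have Rp: "R p = s1 (u p) (R (west p)) (R (south p))" if "p = west w \<or> p = south w" for p
    using that rec[OF B(2)] rec[OF B(3)] Suc.prems(1) by (auto simp: update_def)
  show ?case
  proof (cases "W \<rho>1 \<rho>2 u w = 0")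
    case True
    then have sn: "snd (u (west w)) \<in> {0<..<\<rho>1}" "snd (u (south w)) \<in> {0<..<\<rho>1}" "snd (u w) \<in> {0<..<\<rho>2}"
      by (cases w; simp add: W_eq west_def south_def split: if_splits)+
    \<comment> \<open>The values two steps back enter only as points of \<open>space M\<close>. This
      is where the dependence on the boundary conditions is lost.\<close>
    have "R (west w) \<in> C"
      using s1_in_C[OF noise_in_unit_square[OF u] sn(1)] Rp[of "west w"] rec[OF B(2)] by metis
    moreover have "R (south w) \<in> C"
      using s1_in_C[OF noise_in_unit_square[OF u] sn(2)] Rp[of "south w"] rec[OF B(3)] by metis
    ultimately show ?thesis using Rw s0_regenerates[OF sn(3)] True by simp
  next
    case False
    have "R p = truncated_Y u n p" if "p \<in> even_parents w" for p
    proof (rule Suc.IH)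
      show "p \<in> even_sites" using even_parents_even[OF that] Suc.prems(1) by simp
      show "npaths u n p = 0" using Suc.prems(2) False that by simp
      fix v assume "fst p - 2 * int n < fst v" "fst v \<le> fst p" "snd p - 2 * int n < snd v" "snd v \<le> snd p"
      then show "v \<in> B" using that by (intro Suc.prems(3)) (auto simp: even_parents_eq)
    qed
    then show ?thesis using Rw Rp False by (simp add: even_parents_eq south_west)
  qed
qed simp

text \<open>The box is closed below, where that of \<open>solution_eq_truncated_Y\<close> is open;
  the additional layer covers the step from an odd site to its even parents.\<close>

lemma solution_eq_X_limit:
  assumes u: "u \<in> space noise" and rec: "\<And>v. v \<in> B \<Longrightarrow>
      R v = update v (u v) (R (west v)) (R (south v)) \<and> R (west v) \<in> space M \<and> R (south v) \<in> space M"
    and "extinct n v u"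
    and B: "\<And>v'. fst v - 2 * int n \<le> fst v' \<Longrightarrow> fst v' \<le> fst v \<Longrightarrow>
           snd v - 2 * int n \<le> snd v' \<Longrightarrow> snd v' \<le> snd v \<Longrightarrow> v' \<in> B"
  shows "R v = X_limit u v"
proof (cases "v \<in> even_sites")
  case True
  then have "R v = truncated_Y u n v"
    using assms(3) by (intro solution_eq_truncated_Y[OF u rec]) (auto simp: extinct_def intro!: B)
  then show ?thesis using True assms(3) by (simp add: X_limit_def Y_limit_eq extinct_def)
next
  case False
  have "R p = truncated_Y u n p" if "p = west v \<or> p = south v" for p
    using assms(3) False that by (intro solution_eq_truncated_Y[OF u rec]) (auto simp: extinct_def intro!: B)
  moreover have "v \<in> B" by (rule B) auto
  ultimately show ?thesis
    using False assms(3) rec[of v] Y_limit_eq[of u n "west v"] Y_limit_eq[of u n "south v"]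
    by (simp add: X_limit_def extinct_def update_def)
qed

end

section \<open>The equilibrium field\<close>

abbreviation window :: "'a measure \<Rightarrow> (site \<Rightarrow> 'a) measure \<Rightarrow> site \<Rightarrow> site set \<Rightarrow> (site \<Rightarrow> 'a) measure" where
  "window M \<mu> t S \<equiv> distr \<mu> (config_space M S) (\<lambda>w. \<lambda>v\<in>S. w (v + t))"

lemma measurable_shift:
  assumes "\<And>v. v \<in> S \<Longrightarrow> v + t \<in> T"
  shows "(\<lambda>w. \<lambda>v\<in>S. w (v + t)) \<in> config_space M T \<rightarrow>\<^sub>M config_space M S"
  using assms by (intro measurable_restrict measurable_component_singleton) auto

lemma measurable_marginal:
  "S \<subseteq> T \<Longrightarrow> (\<lambda>w. restrict w S) \<in> config_space M T \<rightarrow>\<^sub>M config_space M S"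
  by (rule measurable_restrict_subset)

lemma measurable_field_shift:
  assumes "sets \<mu> = sets (config_space M UNIV)"
  shows "(\<lambda>w. \<lambda>v\<in>S. w (v + t)) \<in> \<mu> \<rightarrow>\<^sub>M config_space M S"
  unfolding measurable_cong_sets[OF assms refl] by (rule measurable_shift) simp

lemma measurable_field_marginal:
  assumes "sets \<mu> = sets (config_space M UNIV)"
  shows "(\<lambda>w. restrict w S) \<in> \<mu> \<rightarrow>\<^sub>M config_space M S"
  unfolding measurable_cong_sets[OF assms refl] by (rule measurable_marginal) simp

lemma marginal_marginal:
  assumes "S \<subseteq> T" and \<mu>: "sets \<mu> = sets (config_space M UNIV)"
  shows "marginal M (marginal M \<mu> T) S = marginal M \<mu> S"
proof -
  have "marginal M (marginal M \<mu> T) S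
      = distr \<mu> (config_space M S) (\<lambda>w. restrict (restrict w T) S)"
    unfolding marginal_def
      distr_distr[OF measurable_marginal[OF assms(1)] measurable_field_marginal[OF \<mu>]] comp_def ..
  also have "(\<lambda>w. restrict (restrict w T) S) = (\<lambda>w. restrict w S :: site \<Rightarrow> 'a)"
    using assms(1) by (auto simp: restrict_def fun_eq_iff)
  finally show ?thesis unfolding marginal_def .
qed

lemma window_window:
  assumes \<mu>: "sets \<mu> = sets (config_space M UNIV)" and S: "\<And>v. v \<in> S \<Longrightarrow> v + s \<in> T"
  shows "window M (window M \<mu> t T) s S = window M \<mu> (s + t) S"
proof -
  have "window M (window M \<mu> t T) s S
      = distr \<mu> (config_space M S) (\<lambda>w. \<lambda>v\<in>S. (\<lambda>v\<in>T. w (v + t)) (v + s))"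
    by (subst distr_distr[OF measurable_shift[OF S] measurable_field_shift[OF \<mu>]])
      (simp_all only: comp_def)
  also have "(\<lambda>w. \<lambda>v\<in>S. (\<lambda>v\<in>T. w (v + t)) (v + s)) = (\<lambda>w. \<lambda>v\<in>S. w (v + (s + t)) :: 'a)"
    using S by (auto simp: fun_eq_iff add.assoc)
  finally show ?thesis .
qed

lemma marginal_eq_window: "marginal M \<mu> S = window M \<mu> 0 S"
  unfolding marginal_def by (simp add: restrict_def)

lemma stationary_field_marginal:
  assumes "stationary_field M UNIV \<mu>"
  shows "stationary_field M S (marginal M \<mu> S)"
proof -
  have \<mu>: "prob_space \<mu>" "sets \<mu> = sets (config_space M UNIV)"
    and st: "\<And>t. window M \<mu> t UNIV = \<mu>"
    using assms by (auto simp: stationary_field_def)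
  have "prob_space (marginal M \<mu> S)"
    unfolding marginal_def
    by (rule prob_space.prob_space_distr[OF \<mu>(1) measurable_field_marginal[OF \<mu>(2)]])
  moreover have "window M (marginal M \<mu> S) t S = marginal M \<mu> S" if "\<forall>v\<in>S. v + t \<in> S" for t
  proof -
    have "window M (marginal M \<mu> S) t S = window M \<mu> t S"
      using that unfolding marginal_eq_window by (subst window_window[OF \<mu>(2)]) auto
    also have "\<dots> = window M (window M \<mu> t UNIV) 0 S"
      by (subst window_window[OF \<mu>(2)]) auto
    finally show ?thesis by (simp only: st marginal_eq_window)
  qed
  ultimately show ?thesis
    by (simp add: stationary_field_def marginal_def)
qed

lemma finite_subset_rect:
  assumes "finite (J :: site set)"
  obtains a m n where "\<And>j. j \<in> J \<Longrightarrow> j - a \<in> rect m n"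
proof -
  obtain b where b: "\<And>j. j \<in> J \<Longrightarrow> \<bar>fst j\<bar> + \<bar>snd j\<bar> \<le> b"
    using bdd_above_finite[OF finite_imageI[OF assms, of "\<lambda>j. \<bar>fst j\<bar> + \<bar>snd j\<bar>"]]
    unfolding bdd_above_def by blast
  show thesis
  proof
    fix j assume "j \<in> J"
    \<comment> \<open>Coordinates of absolute value at most \<open>\<bar>b\<bar>\<close> are moved
      to \<open>1, ..., 2 * \<bar>b\<bar> + 1\<close>, since rectangles start at 1.\<close>
    then show "j - (- \<bar>b\<bar> - 1, - \<bar>b\<bar> - 1) \<in> rect (nat (2 * \<bar>b\<bar> + 1)) (nat (2 * \<bar>b\<bar> + 1))"
      using b[of j] by (cases j) (auto simp: rect_def)
  qed
qed

text \<open>A finite set of sites fits into a translated rectangle, so the windows determine the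
  probabilities of all cylinders.\<close>

lemma field_eqI_windows:
  assumes P: "sets P = sets (config_space M UNIV)" and Q: "sets Q = sets (config_space M UNIV)"
    and "finite_measure P"
    and eq: "\<And>a m n. window M P a (rect m n) = window M Q a (rect m n)"
  shows "P = Q"
proof (rule measure_eqI_PiM_infinite[OF P Q _ assms(3)])
  fix A and J :: "site set"
  assume J: "finite J" and A: "\<And>j. j \<in> J \<Longrightarrow> A j \<in> sets M"
  obtain a m n where a: "\<And>j. j \<in> J \<Longrightarrow> j - a \<in> rect m n" using finite_subset_rect[OF J] by blast
  let ?S = "rect m n"
  let ?X = "{w \<in> space (config_space M ?S). \<forall>j\<in>J. w (j - a) \<in> A j}"
  have "{w \<in> space (config_space M ?S). w (j - a) \<in> A j} \<in> sets (config_space M ?S)" if "j \<in> J" for j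
    using measurable_sets[OF measurable_component_singleton[OF a[OF that], where M="\<lambda>_. M"] A[OF that]]
    by (simp add: vimage_def Int_def conj_commute)
  then have X: "?X \<in> sets (config_space M ?S)"
    by (rule sets.sets_Collect_finite_All) (assumption, rule J)
  have "emeasure R (prod_emb UNIV (\<lambda>_. M) J (Pi\<^sub>E J A)) = emeasure (window M R a ?S) ?X"
    if R: "sets R = sets (config_space M UNIV)" for R
  proof -
    have m: "(\<lambda>w. \<lambda>v\<in>?S. w (v + a)) \<in> R \<rightarrow>\<^sub>M config_space M ?S"
      by (rule measurable_field_shift[OF R])
    have "prod_emb UNIV (\<lambda>_. M) J (Pi\<^sub>E J A) = (\<lambda>w. \<lambda>v\<in>?S. w (v + a)) -` ?X \<inter> space R"
      using measurable_space[OF m] sets_eq_imp_space_eq[OF R] a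
      by (auto simp: prod_emb_def space_PiM PiE_iff)
    then show ?thesis by (simp add: emeasure_distr[OF m X])
  qed
  from this[OF P] this[OF Q] show "emeasure P (prod_emb UNIV (\<lambda>_. M) J (Pi\<^sub>E J A))
      = emeasure Q (prod_emb UNIV (\<lambda>_. M) J (Pi\<^sub>E J A))"
    by (simp only: eq)
qed

text \<open>Total variation convergence gives convergence of the probability of each event, and real
  limits along a nontrivial filter are unique.\<close>

lemma tv_limit_unique:
  assumes "F \<noteq> bot" and R: "\<And>i. prob_space (R i)" "\<And>i. sets (R i) = sets P"
    and P: "prob_space P" and Q: "prob_space Q" "sets Q = sets P"
    and lim: "((\<lambda>i. tv_dist (R i) P) \<longlongrightarrow> 0) F" "((\<lambda>i. tv_dist (R i) Q) \<longlongrightarrow> 0) F"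
  shows "P = Q"
proof (rule measure_eqI)
  have conv: "((\<lambda>i. measure (R i) A) \<longlongrightarrow> measure L A) F"
    if "A \<in> sets P" "prob_space L" "((\<lambda>i. tv_dist (R i) L) \<longlongrightarrow> 0) F" for A L
  proof -
    have "((\<lambda>i. measure (R i) A - measure L A) \<longlongrightarrow> 0) F"
      using that(3)
    proof (rule Lim_null_comparison[rotated])
      show "\<forall>\<^sub>F i in F. norm (measure (R i) A - measure L A) \<le> tv_dist (R i) L"
        using that(1,2) R tv_dist_upper[OF R(1) that(2), of A] by simp
    qed
    then show ?thesis by (rule LIM_zero_cancel)
  qed
  fix A assume "A \<in> sets P"
  then have "measure P A = measure Q A"
    using tendsto_unique[OF assms(1) conv conv] P Q lim by blast
  then show "emeasure P A = emeasure Q A"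
    using P Q(1) by (simp add: finite_measure.emeasure_eq_measure prob_space.axioms(1))
qed (simp add: Q)

section \<open>Comparing unilateral windows with the limit field\<close>

context percolating_updates
begin

definition limit_law :: "site \<Rightarrow> nat \<Rightarrow> nat \<Rightarrow> (site \<Rightarrow> 'a) measure" where
  "limit_law s m n = distr noise (config_space M (rect m n)) (\<lambda>u. \<lambda>v\<in>rect m n. X_limit u (v + s))"

lemma measurable_limit_window:
  "(\<lambda>u. \<lambda>v\<in>S. X_limit u (v + s)) \<in> noise \<rightarrow>\<^sub>M config_space M S"
  by (intro measurable_restrict measurable_X_limit)

lemma prob_space_limit_law: "prob_space (limit_law s m n)"
  unfolding limit_law_def by (rule prob_space.prob_space_distr[OF prob_space_noise measurable_limit_window])

abbreviation "rect_list m n \<equiv> [(i, j). i \<leftarrow> [1..int m], j \<leftarrow> [1..int n]]"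

text \<open>The origin is left out: it is the parent of no site of the positive quadrant, and
  \<open>boundary_conditions\<close> does not constrain the value there.\<close>

abbreviation "axes \<equiv> {1..} \<times> {0} \<union> {0} \<times> {1..} :: site set"

lemma parents_first_axes: "parents_first axes (rect_list m n)"
  by (rule parents_first_rect) auto

lemma boundary_axes: "x \<in> boundary_conditions M \<Longrightarrow> g \<in> axes \<Longrightarrow> x g \<in> space M"
  by (auto simp: boundary_conditions_def)

lemma measurable_run_window:
  assumes "x \<in> boundary_conditions M" "\<And>v. v \<in> S \<Longrightarrow> v + s \<in> rect m n"
  shows "(\<lambda>u. \<lambda>v\<in>S. run t (rect_list m n) x u (v + s)) \<in> noise \<rightarrow>\<^sub>M config_space M S"
proof (intro measurable_restrict)
  fix v assume "v \<in> S"
  show "(\<lambda>u. run t (rect_list m n) x u (v + s)) \<in> noise \<rightarrow>\<^sub>M M"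
  proof (rule measurable_run[OF parents_first_axes])
    show "v + s \<in> axes \<union> set (rect_list m n)"
      unfolding set_rect_list using assms(2)[OF \<open>v \<in> S\<close>] by blast
  qed (use boundary_axes[OF assms(1)] in simp_all)
qed

lemma unilateral_window_law_eq_run:
  assumes x: "x \<in> boundary_conditions M"
  shows "unilateral_window_law M K x h l m n = distr noise (config_space M (rect m n))
    (\<lambda>u. \<lambda>v\<in>rect m n. run t (rect_list (h + m) (l + n)) x u (v + (int h, int l)))"
proof -
  let ?vs = "rect_list (h + m) (l + n)" and ?R = "rect (h + m) (l + n)"
  have sub: "v + (int h, int l) \<in> ?R" if "v \<in> rect m n" for v
    using that by (auto simp: rect_def)
  have law: "unilateral_law M K x (h + m) (l + n)
      = distr noise (config_space M ?R) (\<lambda>u. restrict (run t ?vs x u) ?R)"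
    unfolding unilateral_law_def
    by (rule iterated_kernel_eq_run[OF parents_first_axes boundary_axes[OF x]])
      (simp_all only: set_rect_list, blast)
  have meas: "(\<lambda>u. restrict (run t ?vs x u) ?R) \<in> noise \<rightarrow>\<^sub>M config_space M ?R"
    using measurable_run_window[OF x, of ?R 0 "h + m" "l + n" t] by (simp add: restrict_def)
  have "unilateral_window_law M K x h l m n = distr noise (config_space M (rect m n))
      (\<lambda>u. \<lambda>v\<in>rect m n. restrict (run t ?vs x u) ?R (v + (int h, int l)))"
    unfolding unilateral_window_law_def law
    by (subst distr_distr[OF measurable_shift[OF sub] meas]) (simp_all only: comp_def)
  also have "(\<lambda>u. \<lambda>v\<in>rect m n. restrict (run t ?vs x u) ?R (v + (int h, int l)))
      = (\<lambda>u. \<lambda>v\<in>rect m n. run t ?vs x u (v + (int h, int l)))"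
    using sub by (auto simp: fun_eq_iff)
  finally show ?thesis .
qed

text \<open>Both fields are driven by the same noise and agree on the window unless one of its sites
  fails to be extinct after \<open>N\<close> generations. The bound does not involve
  \<open>x\<close>, whence the uniformity.\<close>

lemma tv_dist_window_limit_law:
  assumes x: "x \<in> boundary_conditions M" and "2 * N \<le> h" "2 * N \<le> l"
  shows "tv_dist (unilateral_window_law M K x h l m n) (limit_law s m n)
    \<le> real (card (rect m n)) * (2 * growth ^ N)"
proof -
  interpret prob_space noise by (rule prob_space_noise)
  \<comment> \<open>With this offset the window at \<open>(h, l)\<close> sits over the sites
    \<open>v + s\<close> of the noise for all \<open>h\<close> and \<open>l\<close>, so every
    unilateral field is compared with one fixed window of the limit field.\<close>
  define t where "t = s - (int h, int l)"
  let ?vs = "rect_list (h + m) (l + n)" and ?R = "rect (h + m) (l + n)"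
  have sub: "v + (int h, int l) \<in> ?R" if "v \<in> rect m n" for v
    using that by (auto simp: rect_def)
  define B where "B = (\<Union>v\<in>rect m n. {u \<in> space noise. \<not> extinct N (v + s) u})"
  have fin: "finite (rect m n)" by (simp add: rect_def)
  have disj: "axes \<inter> set ?vs = {}" unfolding set_rect_list by (auto simp: rect_def)
  have "tv_dist (unilateral_window_law M K x h l m n) (limit_law s m n) \<le> prob B"
    unfolding unilateral_window_law_eq_run[OF x, where t=t] limit_law_def
  proof (rule tv_dist_distr_le[OF prob_space_noise measurable_run_window[OF x sub] measurable_limit_window])
    show "B \<in> events" unfolding B_def using fin by (intro sets.finite_UN) auto
    fix u assume u: "u \<in> space noise" "u \<notin> B"
    define R where "R v = run t ?vs x u (v - t)" for v
    have "R (v + s) = X_limit u (v + s)" if v: "v \<in> rect m n" for v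
    proof (rule solution_eq_X_limit[where B="{v. v - t \<in> ?R}", OF u(1)])
      show "extinct N (v + s) u" using u v by (auto simp: B_def)
      fix v' assume "fst (v + s) - 2 * int N \<le> fst v'" "fst v' \<le> fst (v + s)"
        "snd (v + s) - 2 * int N \<le> snd v'" "snd v' \<le> snd (v + s)"
      \<comment> \<open>Window coordinates exceed \<open>h\<close> and \<open>l\<close> by at least
        1, so going back by \<open>2 * N\<close> in either direction stays inside the
        rectangle.\<close>
      then show "v' \<in> {v. v - t \<in> ?R}"
        using v assms(2,3) by (cases v'; cases v; cases s) (auto simp: rect_def t_def)
    next
      fix v' assume "v' \<in> {v. v - t \<in> ?R}"
      then have mem: "v' - t \<in> set ?vs" unfolding set_rect_list by simp
      obtain a b where ab: "v' - t = (a, b)" by fastforce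
      have p: "west (v' - t) \<in> axes \<union> set ?vs" "south (v' - t) \<in> axes \<union> set ?vs"
        using mem unfolding ab set_rect_list by (auto simp: rect_def west_def south_def)
      have sh: "west v' - t = west (v' - t)" "south v' - t = south (v' - t)"
        by (simp_all add: west_def south_def prod_eq_iff)
      show "R v' = update v' (u v') (R (west v')) (R (south v')) \<and> R (west v') \<in> space M \<and> R (south v') \<in> space M"
        using run_solution[OF parents_first_axes disj mem, of t x u]
          run_in_space[OF parents_first_axes boundary_axes[OF x] p(1) u(1)]
          run_in_space[OF parents_first_axes boundary_axes[OF x] p(2) u(1)]
        by (simp add: R_def sh)
    qed
    moreover have "v + s - t = v + (int h, int l)" for v by (simp add: t_def)
    ultimately show "(\<lambda>v\<in>rect m n. run t ?vs x u (v + (int h, int l))) = (\<lambda>v\<in>rect m n. X_limit u (v + s))"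
      by (auto simp: R_def fun_eq_iff)
  qed
  also have "prob B \<le> (\<Sum>v\<in>rect m n. prob {u \<in> space noise. \<not> extinct N (v + s) u})"
    unfolding B_def using fin by (intro finite_measure_subadditive_finite) auto
  also have "\<dots> \<le> real (card (rect m n)) * (2 * growth ^ N)"
    by (rule sum_bounded_above) (rule prob_not_extinct)
  finally show ?thesis .
qed

lemma prob_space_window_law:
  assumes "x \<in> boundary_conditions M"
  shows "prob_space (unilateral_window_law M K x h l m n)"
proof -
  have "v + (int h, int l) \<in> rect (h + m) (l + n)" if "v \<in> rect m n" for v
    using that by (auto simp: rect_def)
  then show ?thesis
    unfolding unilateral_window_law_eq_run[OF assms, where t=0]
    by (intro prob_space.prob_space_distr[OF prob_space_noise measurable_run_window[OF assms]])
qed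

lemma uniform_limit_limit_law:
  "uniform_limit (boundary_conditions M)
     (\<lambda>(h, l) x. tv_dist (unilateral_window_law M K x h l m n) (limit_law s m n))
     (\<lambda>_. 0) (sequentially \<times>\<^sub>F sequentially)"
proof (rule uniform_limitI)
  fix e :: real assume "0 < e"
  have "(\<lambda>N. real (card (rect m n)) * (2 * growth ^ N)) \<longlonglongrightarrow> real (card (rect m n)) * (2 * 0)"
    using growth by (intro tendsto_mult tendsto_const LIMSEQ_power_zero) simp
  then have "\<forall>\<^sub>F N in sequentially. real (card (rect m n)) * (2 * growth ^ N) < e"
    using \<open>0 < e\<close> by (intro order_tendstoD) simp_all
  then obtain N where N: "real (card (rect m n)) * (2 * growth ^ N) < e"
    by (auto simp: eventually_sequentially)
  have "dist (tv_dist (unilateral_window_law M K x h l m n) (limit_law s m n)) 0 < e"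
    if "2 * N \<le> h" "2 * N \<le> l" "x \<in> boundary_conditions M" for h l x
    using tv_dist_window_limit_law[OF that(3,1,2), of m n s] N
      tv_dist_nonneg[OF prob_space_window_law[OF that(3)] prob_space_limit_law]
    by (simp add: dist_real_def)
  then show "\<forall>\<^sub>F hl in sequentially \<times>\<^sub>F sequentially. \<forall>x\<in>boundary_conditions M.
      dist ((case hl of (h, l) \<Rightarrow> \<lambda>x. tv_dist (unilateral_window_law M K x h l m n) (limit_law s m n)) x) 0 < e"
    unfolding eventually_prod_sequentially by (intro exI[of _ "2 * N"]) auto
qed

lemma boundary_conditions_nonempty: "(\<lambda>_. f0 (1 / 2)) \<in> boundary_conditions M"
  using f0_half_in_space by (simp add: boundary_conditions_def)

text \<open>The uniform limit is evaluated at a single constant boundary condition, which is enough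
  to identify \<open>P\<close>.\<close>

lemma limit_law_unique:
  assumes P: "prob_space P" "sets P = sets (config_space M (rect m n))"
    and lim: "uniform_limit (boundary_conditions M)
     (\<lambda>(h, l) x. tv_dist (unilateral_window_law M K x h l m n) P) (\<lambda>_. 0) (sequentially \<times>\<^sub>F sequentially)"
  shows "P = limit_law s m n"
proof (rule tv_limit_unique[where F="sequentially \<times>\<^sub>F sequentially"
      and R="\<lambda>(h, l). unilateral_window_law M K (\<lambda>_. f0 (1 / 2)) h l m n"])
  note x = boundary_conditions_nonempty
  show "(sequentially \<times>\<^sub>F sequentially :: (nat \<times> nat) filter) \<noteq> bot"
    by (simp add: prod_filter_eq_bot)
  show "((\<lambda>i. tv_dist (case i of (h, l) \<Rightarrow> unilateral_window_law M K (\<lambda>_. f0 (1 / 2)) h l m n) P) \<longlongrightarrow> 0)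
      (sequentially \<times>\<^sub>F sequentially)"
    using tendsto_uniform_limitI[OF lim x] by (simp add: case_prod_beta)
  show "((\<lambda>i. tv_dist (case i of (h, l) \<Rightarrow> unilateral_window_law M K (\<lambda>_. f0 (1 / 2)) h l m n) (limit_law s m n)) \<longlongrightarrow> 0)
      (sequentially \<times>\<^sub>F sequentially)"
    using tendsto_uniform_limitI[OF uniform_limit_limit_law x] by (simp add: case_prod_beta)
  show "prob_space (case i of (h, l) \<Rightarrow> unilateral_window_law M K (\<lambda>_. f0 (1 / 2)) h l m n)" for i
    using prob_space_window_law[OF x] by (simp only: case_prod_beta)
  show "sets (case i of (h, l) \<Rightarrow> unilateral_window_law M K (\<lambda>_. f0 (1 / 2)) h l m n) = sets P" for i
    by (simp only: case_prod_beta unilateral_window_law_def sets_distr P(2))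
  show "sets (limit_law s m n) = sets P"
    by (simp only: limit_law_def sets_distr P(2))
qed (rule P(1), rule prob_space_limit_law)

text \<open>
  The windows of the unilateral field may be compared with the limit field at any corner \<open>s\<close>,
  of either parity, so uniqueness of the limit gives stationarity under all translations.
\<close>

lemma limit_law_shift: "limit_law s m n = limit_law t m n"
  by (rule limit_law_unique[OF prob_space_limit_law _ uniform_limit_limit_law]) (simp add: limit_law_def)

section \<open>The equilibrium law, its stationarity and uniqueness\<close>

definition equilibrium :: "(site \<Rightarrow> 'a) measure" where
  "equilibrium = distr noise (config_space M UNIV) X_limit"

lemma measurable_X_limit_field: "X_limit \<in> noise \<rightarrow>\<^sub>M config_space M UNIV"
  using measurable_limit_window[where S=UNIV and s=0] by (simp add: restrict_def)

lemma sets_equilibrium: "sets equilibrium = sets (config_space M UNIV)"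
  by (simp add: equilibrium_def)

lemma prob_space_equilibrium: "prob_space equilibrium"
  unfolding equilibrium_def by (rule prob_space.prob_space_distr[OF prob_space_noise measurable_X_limit_field])

lemma window_equilibrium:
  "window M equilibrium t S = distr noise (config_space M S) (\<lambda>u. \<lambda>v\<in>S. X_limit u (v + t))"
  unfolding equilibrium_def
  by (subst distr_distr[OF measurable_shift measurable_X_limit_field]) (simp_all add: comp_def)

lemma equilibrium_field_equilibrium: "equilibrium_field M K equilibrium"
proof -
  have "window M equilibrium t UNIV = equilibrium" for t
  proof (rule field_eqI_windows)
    show "finite_measure (window M equilibrium t UNIV)"
      by (intro prob_space.axioms(1) prob_space.prob_space_distr[OF prob_space_equilibrium]
          measurable_field_shift[OF sets_equilibrium])
    fix a m n
    have "window M (window M equilibrium t UNIV) a (rect m n) = limit_law (a + t) m n"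
      by (subst window_window[OF sets_equilibrium]) (simp_all add: window_equilibrium limit_law_def)
    also have "\<dots> = window M equilibrium a (rect m n)"
      using limit_law_shift[of "a + t" m n a] by (simp add: window_equilibrium limit_law_def)
    finally show "window M (window M equilibrium t UNIV) a (rect m n) = window M equilibrium a (rect m n)" .
  qed (simp_all add: sets_equilibrium)
  then have st: "stationary_field M UNIV equilibrium"
    by (simp add: stationary_field_def prob_space_equilibrium sets_equilibrium)
  have "marginal M (marginal M equilibrium quadrant) (rect m n) = limit_law 0 m n" for m n
  proof -
    have "rect m n \<subseteq> quadrant" by (auto simp: rect_def quadrant_def)
    from marginal_marginal[OF this sets_equilibrium] show ?thesis
      by (simp only: marginal_eq_window[of _ _ "rect m n"] window_equilibrium limit_law_def)
  qed
  then show ?thesis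
    using st stationary_field_marginal[OF st] uniform_limit_limit_law
    by (simp add: equilibrium_field_def ergodic_limit_def)
qed

text \<open>Ergodicity identifies the rectangles at the origin, and stationarity on the whole plane
  moves every other window there.\<close>

lemma equilibrium_field_unique:
  assumes "equilibrium_field M K \<mu>"
  shows "\<mu> = equilibrium"
proof -
  have \<mu>: "prob_space \<mu>" "sets \<mu> = sets (config_space M UNIV)" and st: "\<And>t. window M \<mu> t UNIV = \<mu>"
    and lim: "\<And>m n. uniform_limit (boundary_conditions M)
        (\<lambda>(h, l) x. tv_dist (unilateral_window_law M K x h l m n)
           (marginal M (marginal M \<mu> quadrant) (rect m n)))
        (\<lambda>_. 0) (sequentially \<times>\<^sub>F sequentially)"
    using assms by (auto simp: equilibrium_field_def stationary_field_def ergodic_limit_def)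
  have marg: "marginal M \<mu> (rect m n) = limit_law s m n" for s m n
  proof (rule limit_law_unique)
    show "prob_space (marginal M \<mu> (rect m n))"
      unfolding marginal_def
      by (rule prob_space.prob_space_distr[OF \<mu>(1) measurable_field_marginal[OF \<mu>(2)]])
    have "rect m n \<subseteq> quadrant" by (auto simp: rect_def quadrant_def)
    from marginal_marginal[OF this \<mu>(2)] show "uniform_limit (boundary_conditions M)
        (\<lambda>(h, l) x. tv_dist (unilateral_window_law M K x h l m n) (marginal M \<mu> (rect m n)))
        (\<lambda>_. 0) (sequentially \<times>\<^sub>F sequentially)"
      using lim[of m n] by (simp only:)
  qed (simp add: marginal_def)
  show ?thesis
  proof (rule field_eqI_windows[OF \<mu>(2) sets_equilibrium prob_space.axioms(1)[OF \<mu>(1)]])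
    fix a m n
    have "window M \<mu> a (rect m n) = window M (window M \<mu> a UNIV) 0 (rect m n)"
      by (subst window_window[OF \<mu>(2)]) auto
    also have "\<dots> = limit_law a m n"
      unfolding st marginal_eq_window[symmetric] by (rule marg)
    finally show "window M \<mu> a (rect m n) = window M equilibrium a (rect m n)"
      by (simp add: window_equilibrium limit_law_def)
  qed
qed

end

section \<open>The law of Upsilon\<close>

lemma parents_of_interior:
  assumes "v \<in> \<Lambda>" "v \<notin> inner_boundary \<Lambda>"
  shows "west v \<in> \<Lambda>" "south v \<in> \<Lambda>"
  using assms by (auto simp: inner_boundary_def parent_boundary_def parents_eq)

text \<open>A finite region has a lowest level, and an interior site has both parents in the region,
  one level down.\<close>

lemma finite_region_induct[consumes 2, case_names boundary interior]:
  assumes "finite \<Lambda>" "v \<in> \<Lambda>"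
    and boundary: "\<And>v. v \<in> \<Lambda> \<Longrightarrow> v \<in> inner_boundary \<Lambda> \<Longrightarrow> P v"
    and interior: "\<And>v. v \<in> \<Lambda> \<Longrightarrow> v \<notin> inner_boundary \<Lambda> \<Longrightarrow> P (west v) \<Longrightarrow> P (south v) \<Longrightarrow> P v"
  shows "P v"
proof -
  obtain b where b: "\<And>v. v \<in> \<Lambda> \<Longrightarrow> b \<le> fst v + snd v"
    using bdd_below_finite[OF finite_imageI[OF assms(1), of "\<lambda>v. fst v + snd v"]]
    unfolding bdd_below_def by blast
  show ?thesis using \<open>v \<in> \<Lambda>\<close>
  proof (induction "nat (fst v + snd v - b)" arbitrary: v rule: less_induct)
    case less
    show ?case
    proof (cases "v \<in> inner_boundary \<Lambda>")
      case False
      note p = parents_of_interior[OF less.prems False]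
      have "P (west v)" "P (south v)"
        using b[OF p(1)] b[OF p(2)] by (auto intro!: less.hyps p)
      then show ?thesis by (rule interior[OF less.prems False])
    qed (intro boundary less.prems)
  qed
qed

lemma X_value_dom_region:
  assumes "finite \<Lambda>" "v \<in> \<Lambda>"
  shows "X_value_dom \<Lambda> v"
  using assms
proof (induction v rule: finite_region_induct)
  case (boundary v)
  then show ?case using X_value.domintros[of "fst v" "snd v" \<Lambda>] by simp
next
  case (interior v)
  then have "X_value_dom \<Lambda> (fst v - 1, snd v)" "X_value_dom \<Lambda> (fst v, snd v - 1)"
    by (simp_all only: west_def south_def)
  from X_value.domintros[of "fst v" "snd v", OF this] show ?case by simp
qed

section \<open>Evaluating the partial recursions\<close>

context percolating_updates
begin

abbreviation "Y_val \<equiv> Y_value f0 s0 s1 \<rho>1 \<rho>2"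
abbreviation "X_val \<equiv> X_value f0 s0 s1 \<rho>1 \<rho>2"

text \<open>Termination and value are proved together, since the equations of the partial recursion
  hold only on its domain. Extinction bounds the recursion depth.\<close>

lemma Y_value_eq_truncated:
  "npaths u n w = 0 \<Longrightarrow> Y_value_dom \<rho>1 \<rho>2 u w \<and> Y_val u w = truncated_Y u n w"
proof (induction n arbitrary: w)
  case (Suc n)
  obtain h k where w: "w = (h, k)" by fastforce
  have par: "west (west w) = (h - 2, k)" "west (south w) = (h - 1, k - 1)" "south (south w) = (h, k - 2)"
    by (simp_all add: w west_def south_def)
  show ?case
  proof (cases "W \<rho>1 \<rho>2 u w = 0")
    case True
    then have "Y_value_dom \<rho>1 \<rho>2 u w" unfolding w by - (rule Y_value.domintros, simp_all)
    with True show ?thesis by (simp add: w Y_value.psimps)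
  next
    case False
    then have "npaths u n (west (west w)) = 0 \<and> npaths u n (west (south w)) = 0 \<and> npaths u n (south (south w)) = 0"
      using Suc.prems unfolding count_Suc_eq_0_iff by blast
    then have z: "npaths u n (h - 2, k) = 0" "npaths u n (h - 1, k - 1) = 0" "npaths u n (h, k - 2) = 0"
      unfolding par by blast+
    note IH = Suc.IH[OF z(1)] Suc.IH[OF z(2)] Suc.IH[OF z(3)]
    have "Y_value_dom \<rho>1 \<rho>2 u w" unfolding w using IH by - (rule Y_value.domintros, simp_all)
    then show ?thesis
      using False IH by (simp add: w Y_value.psimps west_def south_def)
  qed
qed simp

lemma Y_value_eq_Y_limit: "npaths u n w = 0 \<Longrightarrow> Y_val u w = Y_limit u w"
  using Y_value_eq_truncated Y_limit_eq by simp

lemma X_value_region: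
  assumes "finite \<Lambda>" "v \<in> \<Lambda>"
  shows "X_val \<Lambda> u v = (if v \<in> inner_boundary \<Lambda> then Y_val u v
    else update v (u v) (X_val \<Lambda> u (west v)) (X_val \<Lambda> u (south v)))"
proof -
  obtain i j where v: "v = (i, j)" by fastforce
  show ?thesis
    using X_value_dom_region[OF assms]
    by (simp add: v X_value.psimps update_def even_sites_iff west_def south_def)
qed

text \<open>\<open>Y_val\<close> is unspecified where its recursion does not terminate, so
  measurability is obtained for a function that agrees with \<open>X_val\<close> on the event of
  extinction at the boundary.\<close>

lemma X_value_measurable_version:
  assumes \<Lambda>: "finite \<Lambda>" and v: "v \<in> \<Lambda>"
  shows "\<exists>g \<in> noise \<rightarrow>\<^sub>M M. \<forall>u. (\<forall>w\<in>inner_boundary \<Lambda>. \<exists>n. npaths u n w = 0) \<longrightarrow> X_val \<Lambda> u v = g u"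
  using \<Lambda> v
proof (induction v rule: finite_region_induct)
  case (boundary v)
  show ?case
  proof (intro bexI[of _ "\<lambda>u. Y_limit u v"] allI impI measurable_Y_limit)
    fix u assume "\<forall>w\<in>inner_boundary \<Lambda>. \<exists>n. npaths u n w = 0"
    then obtain n where "npaths u n v = 0" using boundary by blast
    then show "X_val \<Lambda> u v = Y_limit u v"
      using boundary X_value_region[OF \<Lambda> boundary(1)] Y_value_eq_Y_limit by simp
  qed
next
  case (interior v)
  then obtain g1 g2 where g[measurable]: "g1 \<in> noise \<rightarrow>\<^sub>M M" "g2 \<in> noise \<rightarrow>\<^sub>M M"
    and eq: "\<And>u. \<forall>w\<in>inner_boundary \<Lambda>. \<exists>n. npaths u n w = 0 \<Longrightarrow>
      X_val \<Lambda> u (west v) = g1 u \<and> X_val \<Lambda> u (south v) = g2 u"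
    by blast
  show ?case
  proof (intro bexI[of _ "\<lambda>u. update v (u v) (g1 u) (g2 u)"] allI impI)
    fix u assume "\<forall>w\<in>inner_boundary \<Lambda>. \<exists>n. npaths u n w = 0"
    from eq[OF this] show "X_val \<Lambda> u v = update v (u v) (g1 u) (g2 u)"
      using interior X_value_region[OF \<Lambda> interior(1)] by simp
  qed measurable
qed

text \<open>The extinction times of finitely many boundary sites have a maximum, and extinction is
  permanent.\<close>

lemma finite_open_ancestors_pointwise:
  assumes "finite \<Lambda>" "inner_boundary \<Lambda> \<subseteq> even_sites"
  shows "finite (open_ancestors \<rho>1 \<rho>2 \<Lambda> u) \<longleftrightarrow> (\<forall>w\<in>inner_boundary \<Lambda>. \<exists>n. npaths u n w = 0)"
proof -
  have "\<exists>n. \<forall>w\<in>inner_boundary \<Lambda>. npaths u n w = 0" if "\<forall>w\<in>inner_boundary \<Lambda>. \<exists>n. npaths u n w = 0"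
  proof -
    obtain N where N: "\<And>w. w \<in> inner_boundary \<Lambda> \<Longrightarrow> npaths u (N w) w = 0"
      using \<open>\<forall>w\<in>inner_boundary \<Lambda>. \<exists>n. npaths u n w = 0\<close> by metis
    have "npaths u (Max (N ` inner_boundary \<Lambda>)) w = 0" if "w \<in> inner_boundary \<Lambda>" for w
      using finite_inner_boundary[OF assms(1)] that
      by (intro open_path_count_eq_0_mono[OF N[OF that]]) simp
    then show ?thesis by blast
  qed
  then show ?thesis unfolding finite_open_ancestors_iff[OF assms] by blast
qed

lemma measurable_Upsilon:
  assumes "finite \<Lambda>" "inner_boundary \<Lambda> \<subseteq> even_sites"
  shows "Upsilon M f0 s0 s1 \<rho>1 \<rho>2 \<Lambda> \<in> noise \<rightarrow>\<^sub>M config_space M \<Lambda>"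
proof -
  obtain g where g: "\<And>v. v \<in> \<Lambda> \<Longrightarrow> g v \<in> noise \<rightarrow>\<^sub>M M"
    and eq: "\<And>v u. v \<in> \<Lambda> \<Longrightarrow> \<forall>w\<in>inner_boundary \<Lambda>. \<exists>n. npaths u n w = 0 \<Longrightarrow> X_val \<Lambda> u v = g v u"
    using X_value_measurable_version[OF assms(1)] by metis
  have "(SOME e. e \<in> space M) \<in> space M" using f0_half_in_space by (rule someI)
  then have c: "(\<lambda>u. \<lambda>v\<in>\<Lambda>. SOME e. e \<in> space M) \<in> noise \<rightarrow>\<^sub>M config_space M \<Lambda>"
    by (intro measurable_restrict measurable_const)
  have m: "(\<lambda>u. \<lambda>v\<in>\<Lambda>. g v u) \<in> noise \<rightarrow>\<^sub>M config_space M \<Lambda>"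
    by (intro measurable_restrict g)
  have p: "Measurable.pred noise (\<lambda>u. \<forall>w\<in>inner_boundary \<Lambda>. \<exists>n. npaths u n w = 0)"
    using countable_finite[OF finite_inner_boundary[OF assms(1)]] by measurable
  have "Upsilon M f0 s0 s1 \<rho>1 \<rho>2 \<Lambda> = (\<lambda>u. if \<forall>w\<in>inner_boundary \<Lambda>. \<exists>n. npaths u n w = 0
      then \<lambda>v\<in>\<Lambda>. g v u else (\<lambda>v\<in>\<Lambda>. SOME e. e \<in> space M))"
    unfolding Upsilon_def[abs_def] finite_open_ancestors_pointwise[OF assms]
    by (intro ext if_cong refl restrict_ext) (rule eq, assumption+)
  then show ?thesis using measurable_If[OF m c] p by (simp add: pred_def)
qed

text \<open>Survival at a site has probability at most \<open>growth ^ n\<close> for every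
  \<open>n\<close>, hence 0, and there are countably many sites.\<close>

lemma AE_extinct: "AE u in noise. \<forall>w. \<exists>n. npaths u n w = 0"
  unfolding AE_all_countable
proof
  fix w
  interpret prob_space noise by (rule prob_space_noise)
  let ?A = "{u \<in> space noise. \<forall>n. npaths u n w \<noteq> 0}"
  have A: "?A \<in> events" by measurable
  have "(\<lambda>n. growth ^ n) \<longlonglongrightarrow> 0" using growth by (intro LIMSEQ_power_zero) simp
  moreover have "prob ?A \<le> growth ^ n" for n
  proof -
    have "prob ?A \<le> prob {u \<in> space noise. npaths u n w \<noteq> 0}"
      by (rule finite_measure_mono) auto
    also have "\<dots> \<le> growth ^ n" by (rule prob_open_path_count[OF \<rho>])
    finally show ?thesis .
  qed
  ultimately have "prob ?A \<le> 0" by (intro LIMSEQ_le_const) auto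
  then have "prob ?A = 0" using measure_nonneg[of noise ?A] by linarith
  then have "?A \<in> null_sets noise" using A by (simp add: emeasure_eq_measure null_sets_def)
  then show "AE u in noise. \<exists>n. npaths u n w = 0" by (rule AE_I') auto
qed

lemma Y_limit_in_space: "u \<in> space noise \<Longrightarrow> Y_limit u w \<in> space M"
  using measurable_space[OF measurable_Y_limit] by blast

text \<open>\<open>Upsilon\<close> fills the interior by the site recursion at both parities, while
  \<open>X_limit\<close> is given at even sites by the regeneration recursion. The two agree,
  because at a regenerating site \<open>s0\<close> returns the same value of
  \<open>f0\<close>.\<close>

lemma X_limit_recursion:
  assumes u: "u \<in> space noise" and ext: "\<And>w. \<exists>n. npaths u n w = 0"
  shows "X_limit u v = update v (u v) (X_limit u (west v)) (X_limit u (south v))"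
proof (cases "v \<in> even_sites")
  case False
  then show ?thesis by (simp add: X_limit_def update_def)
next
  case True
  obtain N where N: "\<And>p. npaths u (N p) p = 0" using ext by metis
  \<comment> \<open>A depth common to the three even parents, so that one truncation level serves
    all of them and \<open>Suc n\<close> serves \<open>v\<close>.\<close>
  define n where "n = Max (N ` even_parents v)"
  have n: "npaths u n p = 0" if "p \<in> even_parents v" for p
    unfolding n_def using that by (intro open_path_count_eq_0_mono[OF N]) simp
  then have Yn: "Y_limit u p = truncated_Y u n p" if "p \<in> even_parents v" for p
    using that Y_limit_eq by blast
  have "npaths u (Suc n) v = 0" using n by simp
  then have Yv: "Y_limit u v = truncated_Y u (Suc n) v" by (rule Y_limit_eq)
  have Xp: "X_limit u p = s1 (u p) (Y_limit u (west p)) (Y_limit u (south p))" if "p = west v \<or> p = south v" for p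
    using that True by (auto simp: X_limit_def)
  show ?thesis
  proof (cases "W \<rho>1 \<rho>2 u v = 0")
    case W: True
    then have sn: "snd (u (west v)) \<in> {0<..<\<rho>1}" "snd (u (south v)) \<in> {0<..<\<rho>1}" "snd (u v) \<in> {0<..<\<rho>2}"
      by (cases v; simp add: W_eq west_def south_def split: if_splits)+
    have "X_limit u (west v) \<in> C"
      using s1_in_C[OF noise_in_unit_square[OF u] sn(1) Y_limit_in_space[OF u] Y_limit_in_space[OF u]]
        Xp[of "west v"] by metis
    moreover have "X_limit u (south v) \<in> C"
      using s1_in_C[OF noise_in_unit_square[OF u] sn(2) Y_limit_in_space[OF u] Y_limit_in_space[OF u]]
        Xp[of "south v"] by metis
    ultimately show ?thesis
      using True W s0_regenerates[OF sn(3)] by (simp add: X_limit_def[of u v] update_def Yv)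
  next
    case False
    have "Y_limit u (west (west v)) = truncated_Y u n (west (west v))"
      "Y_limit u (west (south v)) = truncated_Y u n (west (south v))"
      "Y_limit u (south (south v)) = truncated_Y u n (south (south v))"
      by (rule Yn; simp add: even_parents_eq)+
    then show ?thesis
      using True False Xp[of "west v"] Xp[of "south v"]
      by (simp add: X_limit_def[of u v] update_def Yv south_west)
  qed
qed

text \<open>Boundary sites are even, and there \<open>X_limit\<close> is \<open>Y_limit\<close>;
  from the boundary inwards both sides obey the same recursion.\<close>

lemma X_value_eq_X_limit:
  assumes u: "u \<in> space noise" and ext: "\<And>w. \<exists>n. npaths u n w = 0"
    and \<Lambda>: "finite \<Lambda>" "inner_boundary \<Lambda> \<subseteq> even_sites" and v: "v \<in> \<Lambda>"
  shows "X_val \<Lambda> u v = X_limit u v"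
  using \<Lambda>(1) v
proof (induction v rule: finite_region_induct)
  case (boundary v)
  obtain n where "npaths u n v = 0" using ext by blast
  then show ?case
    using boundary \<Lambda>(2) Y_value_eq_Y_limit X_value_region[OF \<Lambda>(1) boundary(1)]
    by (auto simp: X_limit_def)
next
  case (interior v)
  then show ?case
    using X_value_region[OF \<Lambda>(1) interior(1), of u] X_limit_recursion[OF u ext, of v] by simp
qed

text \<open>The two configurations are functions of the same noise and agree almost surely, which is
  more than equality in law.\<close>

lemma marginal_equilibrium_eq_Upsilon:
  assumes \<Lambda>: "finite \<Lambda>" "inner_boundary \<Lambda> \<subseteq> even_sites"
  shows "marginal M equilibrium \<Lambda> =
    distr noise (config_space M \<Lambda>) (Upsilon M f0 s0 s1 \<rho>1 \<rho>2 \<Lambda>)"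
proof -
  have "marginal M equilibrium \<Lambda> = distr noise (config_space M \<Lambda>) (\<lambda>u. \<lambda>v\<in>\<Lambda>. X_limit u (v + 0))"
    unfolding marginal_eq_window window_equilibrium ..
  also have "\<dots> = distr noise (config_space M \<Lambda>) (Upsilon M f0 s0 s1 \<rho>1 \<rho>2 \<Lambda>)"
  proof (rule distr_cong_AE[OF refl refl _ measurable_limit_window measurable_Upsilon[OF \<Lambda>]])
    show "AE u in noise. (\<lambda>v\<in>\<Lambda>. X_limit u (v + 0)) = Upsilon M f0 s0 s1 \<rho>1 \<rho>2 \<Lambda> u"
      using AE_extinct AE_space
    proof eventually_elim
      case (elim u)
      then have "finite (open_ancestors \<rho>1 \<rho>2 \<Lambda> u)"
        unfolding finite_open_ancestors_pointwise[OF \<Lambda>] by blast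
      then show ?case
        using elim X_value_eq_X_limit[OF _ _ \<Lambda>] by (auto simp: Upsilon_def fun_eq_iff)
    qed
  qed
  finally show ?thesis .
qed

end

section \<open>Coupling functions yield the kernel\<close>

text \<open>The second coordinate is an independent coin that selects \<open>f\<close> or
  \<open>g\<close>: the preimage of \<open>A\<close> is a disjoint union of two rectangles.\<close>

lemma measure_distr_mixture:
  assumes f: "f \<in> unit_interval \<rightarrow>\<^sub>M M" and g: "g \<in> unit_interval \<rightarrow>\<^sub>M M"
    and \<rho>: "0 < \<rho>" "\<rho> < 1" and A: "A \<in> sets M"
    and h: "h \<in> unit_square \<rightarrow>\<^sub>M M"
    and h_eq: "\<And>a. a \<in> space unit_square \<Longrightarrow>
      h a = (if snd a \<in> {0<..<\<rho>} then f (fst a) else g (fst a))"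
  shows "measure (distr unit_square M h) A =
    \<rho> * measure (distr unit_interval M f) A + (1 - \<rho>) * measure (distr unit_interval M g) A"
proof -
  interpret U: prob_space unit_interval by (rule prob_space_unit_interval)
  have sp: "space unit_interval = {0<..<1}" by (simp add: space_restrict_space)
  let ?F = "f -` A \<inter> space unit_interval" and ?G = "g -` A \<inter> space unit_interval"
  have FG: "?F \<in> sets unit_interval" "?G \<in> sets unit_interval"
    using measurable_sets[OF f A] measurable_sets[OF g A] by auto
  have sub: "{0<..<\<rho>} \<subseteq> {0<..<1}" "{\<rho>..<1} \<subseteq> {0<..<1}" using \<rho> by auto
  then have I: "{0<..<\<rho>} \<in> sets unit_interval" "{\<rho>..<1} \<in> sets unit_interval"
    by (simp_all add: sets_restrict_space_iff)
  have len: "measure unit_interval {0<..<\<rho>} = \<rho>" "measure unit_interval {\<rho>..<1} = 1 - \<rho>"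
    using sub \<rho> by (simp_all add: measure_restrict_space)
  have times: "measure unit_square (X \<times> Y) = measure unit_interval X * measure unit_interval Y"
    if "X \<in> sets unit_interval" "Y \<in> sets unit_interval" for X Y
    using U.emeasure_pair_measure_Times[OF that] by (simp add: measure_def enn2real_mult)
  have "h -` A \<inter> space unit_square = ?F \<times> {0<..<\<rho>} \<union> ?G \<times> {\<rho>..<1}"
    using \<rho> by (auto simp: h_eq space_pair_measure sp split: if_splits)
  then have "measure (distr unit_square M h) A
      = measure unit_square (?F \<times> {0<..<\<rho>} \<union> ?G \<times> {\<rho>..<1})"
    by (simp add: measure_distr[OF h A])
  also have "\<dots> = measure unit_square (?F \<times> {0<..<\<rho>}) + measure unit_square (?G \<times> {\<rho>..<1})"
    using FG I
    by (intro finite_measure.finite_measure_Union prob_space.axioms(1)[OF prob_space_unit_square] pair_measureI) auto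
  also have "\<dots> = \<rho> * measure unit_interval ?F + (1 - \<rho>) * measure unit_interval ?G"
    by (simp only: times FG I len mult.commute)
  finally show ?thesis by (simp only: measure_distr[OF f A] measure_distr[OF g A])
qed

lemma prob_measure_eqI:
  assumes "prob_space P" "prob_space Q" "sets P = sets Q" "\<And>A. A \<in> sets P \<Longrightarrow> measure P A = measure Q A"
  shows "P = Q"
  using assms by (intro measure_eqI) (simp_all add: finite_measure.emeasure_eq_measure prob_space.axioms(1))

text \<open>The pieces recombine to \<open>K\<close>: \<open>f0\<close> and \<open>f1\<close> with
  weights \<open>\<rho>2\<close> and \<open>1 - \<rho>2\<close> on \<open>C \<times> C\<close>, and
  \<open>f3\<close> and \<open>f4\<close> with weights \<open>\<rho>1\<close> and
  \<open>1 - \<rho>1\<close> everywhere.\<close>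

lemma percolating_updates_coupling:
  assumes K: "two_point_kernel M K" and C[measurable]: "C \<in> sets M"
    and \<rho>: "0 < \<rho>1" "\<rho>1 < 1" "0 < \<rho>2" "\<rho>2 < 1" "\<rho>1\<^sup>2 * \<rho>2 > 2 / 3"
    and cf: "coupling_functions M K C \<phi> \<rho>1 \<rho>2 f0 f1 f2 f3 f4"
  shows "percolating_updates M K (even_update C \<rho>2 f0 f1 f2) (odd_update \<rho>1 f3 f4) C \<rho>1 \<rho>2 f0"
proof -
  let ?s0 = "even_update C \<rho>2 f0 f1 f2" and ?s1 = "odd_update \<rho>1 f3 f4"
  have f0[measurable]: "f0 \<in> unit_interval \<rightarrow>\<^sub>M M"
    and f: "\<And>f. f \<in> {f1, f2, f3, f4} \<Longrightarrow>
      (\<lambda>(u, y1, y2). f u y1 y2) \<in> unit_interval \<Otimes>\<^sub>M (M \<Otimes>\<^sub>M M) \<rightarrow>\<^sub>M M"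
    and \<phi>: "distr unit_interval M f0 = \<phi>"
    and laws: "\<And>y1 y2. y1 \<in> space M \<Longrightarrow> y2 \<in> space M \<Longrightarrow>
       (if y1 \<in> C \<and> y2 \<in> C
         then \<forall>A\<in>sets M. measure (distr unit_interval M (\<lambda>u. f1 u y1 y2)) A =
                1 / (1 - \<rho>2) * (measure (K (y1, y2)) A - \<rho>2 * measure \<phi> A)
         else distr unit_interval M (\<lambda>u. f1 u y1 y2) = K (y1, y2)) \<and>
        distr unit_interval M (\<lambda>u. f2 u y1 y2) = K (y1, y2) \<and>
        (\<forall>u\<in>{0<..<1}. f3 u y1 y2 \<in> C) \<and>
        (\<forall>A\<in>sets M. measure (distr unit_interval M (\<lambda>u. f3 u y1 y2)) A =
           measure (K (y1, y2)) (A \<inter> C) / measure (K (y1, y2)) C) \<and>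
        (\<forall>A\<in>sets M. measure (distr unit_interval M (\<lambda>u. f4 u y1 y2)) A =
           1 / (1 - \<rho>1) * (measure (K (y1, y2)) A
             - \<rho>1 * (measure (K (y1, y2)) (A \<inter> C) / measure (K (y1, y2)) C)))"
    using cf unfolding coupling_functions_def by blast+
  have f_comp: "(\<lambda>x. f (fst (fst x)) (fst (snd x)) (snd (snd x))) \<in> unit_square \<Otimes>\<^sub>M (M \<Otimes>\<^sub>M M) \<rightarrow>\<^sub>M M"
    if "f \<in> {f1, f2, f3, f4}" for f
  proof -
    have "(\<lambda>x. (fst (fst x), snd x)) \<in> unit_square \<Otimes>\<^sub>M (M \<Otimes>\<^sub>M M) \<rightarrow>\<^sub>M unit_interval \<Otimes>\<^sub>M (M \<Otimes>\<^sub>M M)"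
      by measurable
    from measurable_compose[OF this f[OF that]] show ?thesis by (simp add: split_beta)
  qed
  have f_section: "(\<lambda>u. f u y1 y2) \<in> unit_interval \<rightarrow>\<^sub>M M"
    if "f \<in> {f1, f2, f3, f4}" "y1 \<in> space M" "y2 \<in> space M" for f y1 y2
    using measurable_compose[OF measurable_Pair2'[of "(y1, y2)"] f[OF that(1)]] that(2,3)
    by (simp add: space_pair_measure)
  have [measurable]: "(\<lambda>a. snd a) \<in> unit_square \<rightarrow>\<^sub>M (borel :: real measure)"
    by (rule measurable_compose[OF measurable_snd]) (simp add: measurable_restrict_space1)
  have snd_fst[measurable]: "(\<lambda>x. snd (fst x)) \<in> unit_square \<Otimes>\<^sub>M (M \<Otimes>\<^sub>M M) \<rightarrow>\<^sub>M (borel :: real measure)"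
    by (rule measurable_compose[OF measurable_fst]) simp
  have f0_comp: "(\<lambda>x. f0 (fst (fst x))) \<in> unit_square \<Otimes>\<^sub>M (M \<Otimes>\<^sub>M M) \<rightarrow>\<^sub>M M"
    by measurable
  have s0_meas: "(\<lambda>(a, y1, y2). ?s0 a y1 y2) \<in> unit_square \<Otimes>\<^sub>M (M \<Otimes>\<^sub>M M) \<rightarrow>\<^sub>M M"
    unfolding even_update_def case_prod_beta
    by (intro measurable_If f0_comp f_comp; (simp; fail)?) measurable
  have s1_meas: "(\<lambda>(a, y1, y2). ?s1 a y1 y2) \<in> unit_square \<Otimes>\<^sub>M (M \<Otimes>\<^sub>M M) \<rightarrow>\<^sub>M M"
    unfolding odd_update_def case_prod_beta
    by (intro measurable_If f_comp; (simp; fail)?) measurable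
  have K_prob: "prob_space (K (y1, y2))" "sets (K (y1, y2)) = sets M" if "y1 \<in> space M" "y2 \<in> space M" for y1 y2
    using measurable_space[OF K, of "(y1, y2)"] that by (auto simp: space_pair_measure space_prob_algebra)
  have eq_K: "distr unit_square M (\<lambda>a. s a y1 y2) = K (y1, y2)"
    if s: "(\<lambda>(a, y1, y2). s a y1 y2) \<in> unit_square \<Otimes>\<^sub>M (M \<Otimes>\<^sub>M M) \<rightarrow>\<^sub>M M"
      and y: "y1 \<in> space M" "y2 \<in> space M" and r: "0 < r" "r < 1"
      and fg: "f \<in> unit_interval \<rightarrow>\<^sub>M M" "g \<in> unit_interval \<rightarrow>\<^sub>M M"
      and s_eq: "\<And>a. a \<in> space unit_square \<Longrightarrow> s a y1 y2 = (if snd a \<in> {0<..<r} then f (fst a) else g (fst a))"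
      and mix: "\<And>A. A \<in> sets M \<Longrightarrow> r * measure (distr unit_interval M f) A
        + (1 - r) * measure (distr unit_interval M g) A = measure (K (y1, y2)) A"
    for s y1 y2 r f g
  proof -
    have m: "(\<lambda>a. s a y1 y2) \<in> unit_square \<rightarrow>\<^sub>M M"
      using measurable_compose[OF measurable_Pair2'[of "(y1, y2)"] s] y by (simp add: space_pair_measure)
    show ?thesis
    proof (rule prob_measure_eqI)
      fix A assume "A \<in> sets (distr unit_square M (\<lambda>a. s a y1 y2))"
      then have A: "A \<in> sets M" by simp
      show "measure (distr unit_square M (\<lambda>a. s a y1 y2)) A = measure (K (y1, y2)) A"
        using measure_distr_mixture[OF fg r A m s_eq] mix[OF A] by simp
    qed (simp_all add: K_prob y prob_space.prob_space_distr[OF prob_space_unit_square m])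
  qed
  show ?thesis
  proof unfold_locales
    fix y1 y2 assume y: "y1 \<in> space M" "y2 \<in> space M"
    show "distr unit_square M (\<lambda>a. ?s0 a y1 y2) = K (y1, y2)"
    proof (cases "y1 \<in> C \<and> y2 \<in> C")
      case True
      show ?thesis
      proof (rule eq_K[OF s0_meas y \<rho>(3,4) f0 f_section[of f1, OF _ y]])
        fix A assume "A \<in> sets M"
        then have "measure (distr unit_interval M (\<lambda>u. f1 u y1 y2)) A =
            1 / (1 - \<rho>2) * (measure (K (y1, y2)) A - \<rho>2 * measure \<phi> A)"
          using laws[OF y] True by simp
        then show "\<rho>2 * measure (distr unit_interval M f0) A
            + (1 - \<rho>2) * measure (distr unit_interval M (\<lambda>u. f1 u y1 y2)) A = measure (K (y1, y2)) A"
          using \<rho> by (simp add: \<phi>)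
      qed (use True in \<open>simp_all add: even_update_def\<close>)
    next
      case False
      show ?thesis
      \<comment> \<open>Outside \<open>C \<times> C\<close> the coin is ignored, which is the
        mixture of \<open>f2\<close> with itself.\<close>
      proof (rule eq_K[OF s0_meas y \<rho>(3,4) f_section[of f2, OF _ y] f_section[of f2, OF _ y]])
        fix A assume "A \<in> sets M"
        show "\<rho>2 * measure (distr unit_interval M (\<lambda>u. f2 u y1 y2)) A
            + (1 - \<rho>2) * measure (distr unit_interval M (\<lambda>u. f2 u y1 y2)) A = measure (K (y1, y2)) A"
          using laws[OF y] by (simp add: algebra_simps)
      qed (use False in \<open>auto simp: even_update_def\<close>)
    qed
    show "distr unit_square M (\<lambda>a. ?s1 a y1 y2) = K (y1, y2)"
    proof (rule eq_K[OF s1_meas y \<rho>(1,2) f_section[of f3, OF _ y] f_section[of f4, OF _ y]])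
      fix A assume "A \<in> sets M"
      then have "measure (distr unit_interval M (\<lambda>u. f3 u y1 y2)) A =
           measure (K (y1, y2)) (A \<inter> C) / measure (K (y1, y2)) C"
        "measure (distr unit_interval M (\<lambda>u. f4 u y1 y2)) A =
           1 / (1 - \<rho>1) * (measure (K (y1, y2)) A
             - \<rho>1 * (measure (K (y1, y2)) (A \<inter> C) / measure (K (y1, y2)) C))"
        using laws[OF y] by blast+
      then show "\<rho>1 * measure (distr unit_interval M (\<lambda>u. f3 u y1 y2)) A
          + (1 - \<rho>1) * measure (distr unit_interval M (\<lambda>u. f4 u y1 y2)) A = measure (K (y1, y2)) A"
        using \<rho> by simp
    qed (simp_all add: odd_update_def)
  next
    fix a :: "real \<times> real" and y1 y2
    assume "a \<in> space unit_square" "snd a \<in> {0<..<\<rho>1}" "y1 \<in> space M" "y2 \<in> space M"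
    then show "?s1 a y1 y2 \<in> C"
      using laws[of y1 y2] by (auto simp: odd_update_def space_pair_measure space_restrict_space)
  next
    fix a :: "real \<times> real" and y1 y2
    assume "snd a \<in> {0<..<\<rho>2}" "y1 \<in> C" "y2 \<in> C"
    then show "?s0 a y1 y2 = f0 (fst a)" by (simp add: even_update_def)
  qed (use K s0_meas s1_meas f0 \<rho> in simp_all)
qed

text \<open>Uniqueness of the equilibrium field gives sense to speaking of the stationary version,
  and its existence keeps the clause on \<open>Upsilon\<close> from being vacuous.\<close>

theorem theorem5p2:
  fixes E C :: "'a::polish_space set"
    and K :: "'a \<times> 'a \<Rightarrow> 'a measure"
    and \<phi> :: "'a measure"
    and \<rho>1 \<rho>2 :: real
  assumes "E \<in> sets borel"
    and "two_point_kernel (borel_on E) K"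
    and "C \<in> sets (borel_on E)"
    and "prob_space \<phi>" and "sets \<phi> = sets (borel_on E)"
    and "0 < \<rho>1" and "\<rho>1 < 1" and "0 < \<rho>2" and "\<rho>2 < 1"
    and "\<rho>1\<^sup>2 * \<rho>2 > 2 / 3"
    and "\<forall>y1\<in>E. \<forall>y2\<in>E. measure (K (y1, y2)) C \<ge> \<rho>1"
    and "\<forall>y1\<in>C. \<forall>y2\<in>C. \<forall>A\<in>sets (borel_on E). measure (K (y1, y2)) A \<ge> \<rho>2 * measure \<phi> A"
  shows
    "uniformly_ergodic (borel_on E) K \<and>
     (\<exists>!\<mu>. equilibrium_field (borel_on E) K \<mu>) \<and>
     (\<forall>\<mu> f0 f1 f2 f3 f4 \<Lambda>.
        equilibrium_field (borel_on E) K \<mu> \<longrightarrow>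
        coupling_functions (borel_on E) K C \<phi> \<rho>1 \<rho>2 f0 f1 f2 f3 f4 \<longrightarrow>
        finite \<Lambda> \<longrightarrow> inner_boundary \<Lambda> \<subseteq> even_sites \<longrightarrow>
        marginal (borel_on E) \<mu> \<Lambda> =
        distr noise (config_space (borel_on E) \<Lambda>)
          (Upsilon (borel_on E) f0 (even_update C \<rho>2 f0 f1 f2) (odd_update \<rho>1 f3 f4) \<rho>1 \<rho>2 \<Lambda>)) \<and>
     (\<exists>c::ennreal. c < \<infinity> \<and>
        (\<forall>\<Lambda>. finite \<Lambda> \<longrightarrow> inner_boundary \<Lambda> \<subseteq> even_sites \<longrightarrow>
           of_nat (card \<Lambda>) \<le> (\<integral>\<^sup>+u. emeasure (count_space UNIV) (random_region \<rho>1 \<rho>2 \<Lambda> u) \<partial>noise) \<and>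
           (\<integral>\<^sup>+u. emeasure (count_space UNIV) (random_region \<rho>1 \<rho>2 \<Lambda> u) \<partial>noise)
             \<le> of_nat (card \<Lambda>) + c * of_nat (card (inner_boundary \<Lambda>))))"
proof -
  let ?M = "borel_on E"
  have spM: "space ?M = E" by (simp add: space_restrict_space)
  obtain f0 f1 f2 f3 f4 where cf: "coupling_functions ?M K C \<phi> \<rho>1 \<rho>2 f0 f1 f2 f3 f4"
    using coupling_functions_exist[OF assms(1-9)] assms(11,12) by blast
  note updates = percolating_updates_coupling[OF assms(2,3,6-10)]
  interpret ex: percolating_updates ?M K "even_update C \<rho>2 f0 f1 f2" "odd_update \<rho>1 f3 f4" C \<rho>1 \<rho>2 f0
    by (rule updates[OF cf])
  have "uniformly_ergodic ?M K"
    using ex.equilibrium_field_equilibrium by (auto simp: uniformly_ergodic_def equilibrium_field_def)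
  moreover have "\<exists>!\<mu>. equilibrium_field ?M K \<mu>"
    using ex.equilibrium_field_equilibrium ex.equilibrium_field_unique by blast
  moreover have "marginal ?M \<mu> \<Lambda> = distr noise (config_space ?M \<Lambda>)
      (Upsilon ?M g0 (even_update C \<rho>2 g0 g1 g2) (odd_update \<rho>1 g3 g4) \<rho>1 \<rho>2 \<Lambda>)"
    if "equilibrium_field ?M K \<mu>" "coupling_functions ?M K C \<phi> \<rho>1 \<rho>2 g0 g1 g2 g3 g4"
      "finite \<Lambda>" "inner_boundary \<Lambda> \<subseteq> even_sites" for \<mu> g0 g1 g2 g3 g4 \<Lambda>
  proof -
    \<comment> \<open>The given functions build a limit field of their own; uniqueness identifies
      its law with \<open>\<mu>\<close>.\<close>
    interpret g: percolating_updates ?M K "even_update C \<rho>2 g0 g1 g2" "odd_update \<rho>1 g3 g4" C \<rho>1 \<rho>2 g0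
      by (rule updates[OF that(2)])
    show ?thesis
      using g.equilibrium_field_unique[OF that(1)] g.marginal_equilibrium_eq_Upsilon[OF that(3,4)] by simp
  qed
  \<comment> \<open>The constant \<open>c\<close> is the geometric series of the growth rate from
    exponent 1 on, and it is the same for all regions.\<close>
  moreover have "(\<Sum>n. ennreal ((3 * (1 - \<rho>1\<^sup>2 * \<rho>2)) ^ Suc n)) < \<infinity>"
  proof -
    have "summable (\<lambda>n. (3 * (1 - \<rho>1\<^sup>2 * \<rho>2)) ^ Suc n)"
      using ex.growth by (subst summable_Suc_iff) (rule summable_geometric, simp)
    then show ?thesis
      using ex.growth by (subst suminf_ennreal2) (simp_all add: top.not_eq_extremum[symmetric])
  qed
  ultimately show ?thesis
    using nn_integral_random_region[OF ex.\<rho>] by blast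
qed

end
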